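(* The only complete multinets induced from $Q_n$ ($n\ge 1$) are the $(3,2)$-net of Coxeter type $A_3$ and the $(3,2n)$-multinets of type $G(n,1,3)$. That is, for every $n\ge1$, every complete multinet induced from $Q_n$ is (up to projective equivalence) either the $(3,2)$-net of Coxeter type $A_3$ or the $(3,2n)$-multinet of type $G(n,1,3)$; and conversely the $(3,2)$-net of Coxeter type $A_3$ and, for every $n\geq 1$, the $(3,2n)$-multinet of type $G(n,1,3)$ are complete and arise as multinets induced from some $Q_m$, $m\ge 1$.
   Context: All lines lie in the complex projective plane $\mathbb{P}^2$. A pencil of plane curves of degree $d$ is a line in the projective space of homogeneous polynomials of degree $d$ in three variables over $\mathbb{C}$; its members are called fibers. The pencil has no fixed component if its fibers have no common component; then its base $\mathcal{X}$, the common intersection of any two distinct fibers, is a finite set. A fiber is completely reducible if it has the form $\prod_i \alpha_i^{m_i}$ with $\alpha_i$ pairwise non-proportional linear forms and $m_i\in\mathbb{Z}_{>0}$. A $(k,d)$-multinet ($k\ge 3$) is the multi-arrangement $\mathcal{A}$ of lines given by $k$ distinct completely reducible fibers of a pencil of degree $d$ without fixed components. It is partitioned into blocks $\mathcal{A}_1,\dots,\mathcal{A}_k$ (the sets of lines in the $k$ fibers), and each line $\ell$ carries the multiplicity $m(\ell)$ of its linear form in its fiber. The following connectivity condition is required: for any two lines $\ell,\ell'$ of the same block there is a sequence of lines of that block $\ell=\ell_0,\ell_1,\dots,\ell_r=\ell'$ with $\ell_{i-1}\cap\ell_i\notin\mathcal{X}$ for $1\le i\le r$. The base $\mathcal{X}$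 of the pencil is the base of the multinet; it is the set of intersection points of lines from different blocks. For $p\in\mathcal{X}$ the number $n_p=\sum_{\ell\in\mathcal{A}_i,\,p\in\ell}m(\ell)$ does not depend on $i$ and is called the multiplicity of $p$. The multinet is a net if $|\mathcal{X}|=d^2$. Let $|\mathcal{A}|$ be the number of distinct lines of $\mathcal{A}$, let $\overline{\mathcal{X}}$ be the set of intersection points of lines of $\mathcal{A}$ that are not in $\mathcal{X}$, and for $p\in\overline{\mathcal{X}}$ let $m_p$ be the number of distinct lines of $\mathcal{A}$ through $p$. A $(k,d)$-multinet with $d\ge 2$ is complete if $$3+|\mathcal{X}|=(2-k)\Big[3d-d^2+\sum_{p\in\mathcal{X}}(n_p^2-n_p)\Big]+2|\mathcal{A}|-\sum_{p\in\overline{\mathcal{X}}}(m_p-1).$$ Induced multinets: for $n\ge1$ let $Q_n=F_1F_2F_3$ be the arrangement of planes in $\mathbb{P}^3$ with blocks $F_1=(x_0^n-x_1^n)(x_2^n-x_3^n)$, $F_2=(x_0^n-x_2^n)(x_1^n-x_3^n)$, $F_3=(x_0^n-x_3^n)(x_1^n-x_2^n)$; these three polynomials lie in one pencil. Let $H\subset\mathbb{P}^3$ be a plane that is not one of the planes of $Q_n$. The restrictions $F_1|_H,F_2|_H,F_3|_H$ lie in a pencil on $H\cong\mathbb{P}^2$ and are products of linear forms. Divide them by their greatest common divisor (if it is nontrivial) to remove fixed components. The resulting multi-arrangement in $H$, with its three blocks, is called the multinet induced from $Q_n$ (by $H$). The $(3,2)$-net of Coxeter type $A_3$ is the net with defining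 polynomial $[x(y-z)][y(x-z)][z(x-y)]$, brackets giving blocks. The $(3,2n)$-multinet of type $G(n,1,3)$ is the one with defining polynomial $[x^n(y^n-z^n)][y^n(x^n-z^n)][z^n(x^n-y^n)]$, brackets giving blocks and exponents giving multiplicities. Projective equivalence means that some projective transformation carries the lines of one multi-arrangement onto those of the other, matching multiplicities and blocks (up to permutation of blocks). *)

theory Defs
  imports "HOL-Analysis.Analysis" "HOL-Library.Poly_Mapping"
begin

text \<open>
  Polynomials over the complex numbers in variables indexed by a finite type, as finitely
  supported maps from exponent vectors to coefficients; multiplication is the convolution
  product of Poly_Mapping.
\<close>

type_synonym 'v mpoly = "('v \<Rightarrow>\<^sub>0 nat) \<Rightarrow>\<^sub>0 complex"

definition Const :: "complex \<Rightarrow> 'v mpoly" where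
  "Const c = Poly_Mapping.single 0 c"

definition Var :: "'v \<Rightarrow> 'v mpoly" where
  "Var i = Poly_Mapping.single (Poly_Mapping.single i 1) 1"

definition eval_poly :: "'v::finite mpoly \<Rightarrow> complex ^ 'v \<Rightarrow> complex" where
  "eval_poly f x =
     (\<Sum>m\<in>Poly_Mapping.keys f. Poly_Mapping.lookup f m * (\<Prod>i\<in>UNIV. (x $ i) ^ Poly_Mapping.lookup m i))"

definition subst_poly :: "('v::finite \<Rightarrow> 'w mpoly) \<Rightarrow> 'v mpoly \<Rightarrow> 'w mpoly" where
  "subst_poly \<sigma> f =
     (\<Sum>m\<in>Poly_Mapping.keys f.
        Const (Poly_Mapping.lookup f m) * (\<Prod>i\<in>UNIV. \<sigma> i ^ Poly_Mapping.lookup m i))"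

definition homogeneous :: "nat \<Rightarrow> 'v::finite mpoly \<Rightarrow> bool" where
  "homogeneous d f \<longleftrightarrow>
     (\<forall>m\<in>Poly_Mapping.keys f. (\<Sum>i\<in>UNIV. Poly_Mapping.lookup m i) = d)"

definition zero_set :: "'v::finite mpoly \<Rightarrow> (complex ^ 'v) set" where
  "zero_set f = {x. eval_poly f x = 0}"

definition linear_form :: "'v::finite mpoly \<Rightarrow> bool" where
  "linear_form \<alpha> \<longleftrightarrow> homogeneous 1 \<alpha> \<and> \<alpha> \<noteq> 0"

text \<open>
  Projective subspaces are represented by the corresponding linear subspaces: a point of the
  projective plane is a 1-dimensional subspace of the space of complex triples, a line is a
  2-dimensional one (the zero set of a linear form), and incidence is inclusion.  Thus
  the intersection point of two distinct lines is just their set-theoretic intersection.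
\<close>

type_synonym pline = "(complex ^ 3) set"
type_synonym ppoint = "(complex ^ 3) set"

definition is_point :: "ppoint \<Rightarrow> bool" where
  "is_point p \<longleftrightarrow> vec.subspace p \<and> vec.dim p = 1"

text \<open>
  A multi-arrangement with blocks is the list of its blocks, each block being the multiset
  of its lines (the multiplicity of a line is its count).
\<close>

type_synonym arrangement = "pline multiset list"

text \<open>
  The form f is a product of linear forms whose lines, with multiplicities, are those of B.
  The nonzero scalar is harmless, since fibers are only defined up to scalars.
\<close>

definition splits_into :: "3 mpoly \<Rightarrow> pline multiset \<Rightarrow> bool" where
  "splits_into f B \<longleftrightarrow>
     (\<exists>c \<alpha>. c \<noteq> 0 \<and> (\<forall>l\<in>#B. linear_form (\<alpha> l) \<and> zero_set (\<alpha> l) = l) \<and>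
            f = Const c * (\<Prod>l\<in>#B. \<alpha> l))"

text \<open>The block of a given product of linear forms; unspecified for other polynomials.\<close>

definition block_of :: "3 mpoly \<Rightarrow> pline multiset" where
  "block_of f = (THE B. splits_into f B)"

text \<open>
  A pencil is a 2-dimensional space of forms of degree d; its fibers are its nonzero
  elements up to scalars.
\<close>

definition is_pencil :: "nat \<Rightarrow> 3 mpoly set \<Rightarrow> bool" where
  "is_pencil d W \<longleftrightarrow>
     (\<exists>f g. homogeneous d f \<and> homogeneous d g \<and>
            (\<forall>a b. Const a * f + Const b * g = 0 \<longrightarrow> a = 0 \<and> b = 0) \<and>
            W = {Const a * f + Const b * g | a b. True})"

definition no_fixed_component :: "3 mpoly set \<Rightarrow> bool" where
  "no_fixed_component W \<longleftrightarrow> (\<forall>h. (\<forall>f\<in>W. h dvd f) \<longrightarrow> h dvd 1)"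

definition base_locus :: "3 mpoly set \<Rightarrow> ppoint set" where
  "base_locus W = {p. is_point p \<and> (\<forall>f\<in>W. p \<subseteq> zero_set f)}"

definition block_connected :: "ppoint set \<Rightarrow> pline multiset \<Rightarrow> bool" where
  "block_connected X B \<longleftrightarrow>
     (\<forall>l\<in>#B. \<forall>l'\<in>#B. (l, l') \<in> {(a, b). a \<in># B \<and> b \<in># B \<and> a \<inter> b \<notin> X}\<^sup>*)"

definition multinet_of_pencil :: "3 mpoly set \<Rightarrow> nat \<Rightarrow> nat \<Rightarrow> arrangement \<Rightarrow> bool" where
  "multinet_of_pencil W k d A \<longleftrightarrow>
     k \<ge> 3 \<and> length A = k \<and> is_pencil d W \<and> no_fixed_component W \<and>
     (\<exists>F. (\<forall>i<k. F i \<in> W \<and> splits_into (F i) (A ! i)) \<and>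
          (\<forall>i<k. \<forall>j<k. i \<noteq> j \<longrightarrow> \<not> (\<exists>c. F i = Const c * F j))) \<and>
     (\<forall>B\<in>set A. block_connected (base_locus W) B)"

definition is_net :: "nat \<Rightarrow> nat \<Rightarrow> arrangement \<Rightarrow> bool" where
  "is_net k d A \<longleftrightarrow> (\<exists>W. multinet_of_pencil W k d A \<and> card (base_locus W) = d\<^sup>2)"

definition lines_of :: "arrangement \<Rightarrow> pline set" where
  "lines_of A = (\<Union>B\<in>set A. set_mset B)"

text \<open>
  The multiplicity of a base point.  For a multinet it does not depend on the block used to
  compute it, so the first block is taken.
\<close>

definition base_mult :: "arrangement \<Rightarrow> ppoint \<Rightarrow> nat" where
  "base_mult A p = (\<Sum>l\<in>{l \<in> set_mset (hd A). p \<subseteq> l}. count (hd A) l)"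

definition other_points :: "ppoint set \<Rightarrow> arrangement \<Rightarrow> ppoint set" where
  "other_points X A = {l \<inter> l' | l l'. l \<in> lines_of A \<and> l' \<in> lines_of A \<and> l \<noteq> l'} - X"

definition num_lines_through :: "arrangement \<Rightarrow> ppoint \<Rightarrow> nat" where
  "num_lines_through A p = card {l \<in> lines_of A. p \<subseteq> l}"

definition complete_multinet :: "nat \<Rightarrow> nat \<Rightarrow> arrangement \<Rightarrow> bool" where
  "complete_multinet k d A \<longleftrightarrow>
     d \<ge> 2 \<and>
     (\<exists>W. multinet_of_pencil W k d A \<and>
        3 + int (card (base_locus W)) =
          (2 - int k) * (3 * int d - (int d)\<^sup>2
             + (\<Sum>p\<in>base_locus W. (int (base_mult A p))\<^sup>2 - int (base_mult A p)))
          + 2 * int (card (lines_of A))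
          - (\<Sum>p\<in>other_points (base_locus W) A. int (num_lines_through A p) - 1))"

definition proj_equiv :: "arrangement \<Rightarrow> arrangement \<Rightarrow> bool" where
  "proj_equiv A A' \<longleftrightarrow>
     (\<exists>T :: complex ^ 3 ^ 3. invertible T \<and>
        mset (map (image_mset (\<lambda>l. (\<lambda>v. T *v v) ` l)) A) = mset A')"

text \<open>The three blocks of the arrangement of planes, in four homogeneous coordinates.\<close>

definition Q_blocks :: "nat \<Rightarrow> 4 mpoly list" where
  "Q_blocks n =
     [(Var 0 ^ n - Var 1 ^ n) * (Var 2 ^ n - Var 3 ^ n),
      (Var 0 ^ n - Var 2 ^ n) * (Var 1 ^ n - Var 3 ^ n),
      (Var 0 ^ n - Var 3 ^ n) * (Var 1 ^ n - Var 2 ^ n)]"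

definition Q_planes :: "nat \<Rightarrow> (complex ^ 4) set set" where
  "Q_planes n = {zero_set \<alpha> | \<alpha>. linear_form \<alpha> \<and> \<alpha> dvd prod_list (Q_blocks n)}"

text \<open>
  Restriction of a form in four variables to a plane, in the coordinates on that plane given
  by a parametrization P (an injective linear map whose range is the plane).
\<close>

definition restrict_along :: "complex ^ 3 ^ 4 \<Rightarrow> 4 mpoly \<Rightarrow> 3 mpoly" where
  "restrict_along P f = subst_poly (\<lambda>i. \<Sum>j\<in>UNIV. Const (P $ i $ j) * Var j) f"

definition is_gcd3 :: "3 mpoly \<Rightarrow> 3 mpoly list \<Rightarrow> bool" where
  "is_gcd3 g Fs \<longleftrightarrow> (\<forall>f\<in>set Fs. g dvd f) \<and> (\<forall>h. (\<forall>f\<in>set Fs. h dvd f) \<longrightarrow> h dvd g)"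

text \<open>
  The identification of H with the projective plane is arbitrary, so the induced
  multi-arrangement is determined up to projective equivalence.
\<close>

definition induced_by :: "nat \<Rightarrow> (complex ^ 4) set \<Rightarrow> arrangement \<Rightarrow> bool" where
  "induced_by n H A \<longleftrightarrow>
     vec.subspace H \<and> vec.dim H = 3 \<and> H \<notin> Q_planes n \<and>
     (\<exists>P :: complex ^ 3 ^ 4. inj ((*v) P) \<and> range ((*v) P) = H \<and>
        (\<exists>g R. is_gcd3 g (map (restrict_along P) (Q_blocks n)) \<and>
               map (restrict_along P) (Q_blocks n) = map (\<lambda>r. g * r) R \<and>
               list_all2 splits_into R A))"

definition induced_from_Q :: "nat \<Rightarrow> arrangement \<Rightarrow> bool" where
  "induced_from_Q n A \<longleftrightarrow> (\<exists>H. induced_by n H A)"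

text \<open>Below, the coordinates x, y, z are the variables with indices 1, 2, 3.\<close>

definition A3_net :: arrangement where
  "A3_net = map block_of
     [Var 1 * (Var 2 - Var 3), Var 2 * (Var 1 - Var 3), Var 3 * (Var 1 - Var 2)]"

definition G_multinet :: "nat \<Rightarrow> arrangement" where
  "G_multinet n = map block_of
     [Var 1 ^ n * (Var 2 ^ n - Var 3 ^ n),
      Var 2 ^ n * (Var 1 ^ n - Var 3 ^ n),
      Var 3 ^ n * (Var 1 ^ n - Var 2 ^ n)]"

end

(*
  Write a plane H of 3-space as a0 y0 + a1 y1 + a2 y2 + a3 y3 = 0.  The block ij|kl of the trace of
  Q_n on H consists of the pencils y_i = z y_j and y_k = w y_l (z, w n-th roots of unity), and a point
  of H lies on lines of all three blocks iff three of the n-th powers of its coordinates agree.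
  Common factors of the blocks are therefore explicit: they occur only if exactly one a_i is 0.

  Counting pairs of lines of two blocks by their intersection points shows that the squares of the
  multiplicities n_p add up to d^2, so the completeness condition for k = 3 becomes
      3d + 3 + sum (m_p - 1) = 2 |A| + sum (n_p - 1).
  The points with n_p > 1 are vertices of the coordinate tetrahedron and points whose coordinates have
  equal n-th powers; the latter correspond to vanishing sums a0 z0 + ... + a3 z3 over roots of unity
  and are few, because two circles meet in at most two points.  The first sum is about 3 n^2, since
  the two pencils of each block meet in n^2 points.  Comparing both sides by the number of vanishing
  a_i leaves, for n > 1, only the coordinate planes and, for n = 2, the planes with a_i = +a_j or -a_j,
  and both give the multinet of type G(n,1,3).  For n = 1 the planes not through (1,1,1,1) give A_3,
  which is G(1,1,3), and through (1,1,1,1) connectivity fails.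
*)
theory Submission
  imports Defs
begin

section \<open>Polynomials\<close>

text \<open>Apart from \<open>n = 1\<close>, completeness is used only as an inequality: the sum of
  \<open>m_p - 1\<close> is bounded below by exhibiting disjoint families of points off the base,
  while \<open>|A|\<close> and the sum of \<open>n_p - 1\<close> are bounded above, so the
  arrangement is never computed exactly. The obstacle is the common factor that is divided out. Its
  lines lie in all three blocks, so each of their points has three coordinates with equal n-th
  powers; the families avoid such points, and the lower bounds survive the division. The second
  difficulty is that a line \<open>y_i = z y_j\<close> may pass through the centre
  \<open>y_k = y_l = 0\<close> of the opposite pencil, which happens when
  \<open>a_i z + a_j = 0\<close>. Each such coincidence costs intersection points and is tracked as
  a number 0 or 1. The quadratic estimate alone settles \<open>n \<ge> 4\<close>. For
  \<open>n = 3\<close> it can hold with equality, and for \<open>n = 2\<close> it has genuine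
  solutions, so these values need facts about square and cube roots of unity. For the converse,
  G(n,1,3) is realized on \<open>y_0 = 0\<close>, where all the counts are exact.\<close>

lemma eval_poly_superset:
  assumes "finite S" "Poly_Mapping.keys f \<subseteq> S"
  shows "eval_poly f x =
    (\<Sum>m\<in>S. Poly_Mapping.lookup f m * (\<Prod>i\<in>UNIV. (x $ i) ^ Poly_Mapping.lookup m i))"
  unfolding eval_poly_def
  by (rule sum.mono_neutral_left) (use assms in \<open>auto simp: in_keys_iff\<close>)

lemma eval_zero [simp]: "eval_poly 0 x = 0"
  by (simp add: eval_poly_def)

lemma eval_single [simp]:
  "eval_poly (Poly_Mapping.single m c) x = c * (\<Prod>i\<in>UNIV. (x $ i) ^ Poly_Mapping.lookup m i)"
  by (subst eval_poly_superset[of "{m}"]) auto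

lemma eval_add [simp]: "eval_poly (f + g) x = eval_poly f x + eval_poly g x"
proof -
  let ?S = "Poly_Mapping.keys f \<union> Poly_Mapping.keys g"
  have "Poly_Mapping.keys (f + g) \<subseteq> ?S" by (rule keys_add)
  then show ?thesis
    by (simp add: eval_poly_superset[of ?S] lookup_add distrib_right sum.distrib)
qed

lemma eval_uminus [simp]: "eval_poly (- f) x = - eval_poly f x"
  using eval_add[of f "- f" x] by (simp add: eq_neg_iff_add_eq_0 add.commute)

lemma eval_diff [simp]: "eval_poly (f - g) x = eval_poly f x - eval_poly g x"
  using eval_add[of f "- g" x] by simp

lemma eval_sum [simp]: "eval_poly (sum f S) x = (\<Sum>i\<in>S. eval_poly (f i) x)"
  by (induction S rule: infinite_finite_induct) auto

lemma poly_mapping_sum_singles: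
  "f = (\<Sum>m\<in>Poly_Mapping.keys f. Poly_Mapping.single m (Poly_Mapping.lookup f m))"
proof (rule poly_mapping_eqI)
  fix k
  have "Poly_Mapping.lookup (\<Sum>m\<in>Poly_Mapping.keys f. Poly_Mapping.single m (Poly_Mapping.lookup f m)) k
     = (\<Sum>m\<in>Poly_Mapping.keys f. Poly_Mapping.lookup f m when m = k)"
    by (simp add: lookup_sum lookup_single)
  also have "\<dots> = Poly_Mapping.lookup f k"
    by (simp add: when_def in_keys_iff)
  finally show "Poly_Mapping.lookup f k =
    Poly_Mapping.lookup (\<Sum>m\<in>Poly_Mapping.keys f. Poly_Mapping.single m (Poly_Mapping.lookup f m)) k"
    by simp
qed

lemma eval_mult [simp]: "eval_poly (f * g) x = eval_poly f x * eval_poly g x"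
proof -
  have s: "eval_poly (Poly_Mapping.single m c * Poly_Mapping.single m' c') x =
     eval_poly (Poly_Mapping.single m c) x * eval_poly (Poly_Mapping.single m' c') x" for m c m' c'
    by (simp add: mult_single lookup_add power_add prod.distrib)
  let ?s = "\<lambda>f m. Poly_Mapping.single m (Poly_Mapping.lookup f m)"
  have "eval_poly (f * g) x =
    eval_poly ((\<Sum>m\<in>Poly_Mapping.keys f. ?s f m) * (\<Sum>m\<in>Poly_Mapping.keys g. ?s g m)) x"
    by (simp flip: poly_mapping_sum_singles)
  also have "\<dots> = (\<Sum>m\<in>Poly_Mapping.keys f. \<Sum>m'\<in>Poly_Mapping.keys g. eval_poly (?s f m * ?s g m') x)"
    by (simp add: sum_product)
  also have "\<dots> = (\<Sum>m\<in>Poly_Mapping.keys f. \<Sum>m'\<in>Poly_Mapping.keys g. eval_poly (?s f m) x * eval_poly (?s g m') x)"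
    by (simp only: s)
  also have "\<dots> = eval_poly (\<Sum>m\<in>Poly_Mapping.keys f. ?s f m) x * eval_poly (\<Sum>m\<in>Poly_Mapping.keys g. ?s g m) x"
    by (simp only: sum_product eval_sum)
  finally show ?thesis by (simp flip: poly_mapping_sum_singles)
qed

lemma eval_Const [simp]: "eval_poly (Const c) x = c"
  by (simp add: Const_def)

lemma eval_Var [simp]: "eval_poly (Var i) x = x $ i"
proof -
  have "(\<Prod>j\<in>UNIV. (x $ j) ^ Poly_Mapping.lookup (Poly_Mapping.single i (1::nat)) j)
     = (\<Prod>j\<in>UNIV. if j = i then x $ i else 1)"
    by (rule prod.cong) (auto simp: lookup_single when_def)
  then show ?thesis by (simp add: Var_def)
qed

lemma Const_1 [simp]: "Const 1 = 1"
  by (simp add: Const_def)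

lemma Const_0 [simp]: "Const 0 = 0"
  by (simp add: Const_def)

lemma Const_mult: "Const (a * b) = Const a * Const b"
  by (simp add: Const_def mult_single)

lemma eval_one [simp]: "eval_poly 1 x = 1"
  by (metis Const_1 eval_Const)

lemma eval_power [simp]: "eval_poly (f ^ n) x = eval_poly f x ^ n"
  by (induction n) auto

lemma eval_prod [simp]: "eval_poly (prod f S) x = (\<Prod>i\<in>S. eval_poly (f i) x)"
  by (induction S rule: infinite_finite_induct) auto

lemma eval_subst: "eval_poly (subst_poly \<sigma> f) x = eval_poly f (\<chi> i. eval_poly (\<sigma> i) x)"
  unfolding subst_poly_def by (simp add: eval_poly_def[of f])

text \<open>Uniqueness of digits in base \<open>N\<close>; it keeps the exponents apart in the
  substitution below.\<close>

lemma base_expansion_inj: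
  fixes a b c N :: nat
  assumes "a < N" "b < N" "c < N" "a' < N" "b' < N" "c' < N"
    and eq: "a + N * b + N * N * c = a' + N * b' + N * N * c'"
  shows "a = a' \<and> b = b' \<and> c = c'"
proof -
  have eq': "a + N * (b + N * c) = a' + N * (b' + N * c')"
    using eq by (simp add: algebra_simps)
  have "a = a'" using arg_cong[OF eq', of "\<lambda>t. t mod N"] assms by simp
  moreover have e2: "b + N * c = b' + N * c'" using arg_cong[OF eq', of "\<lambda>t. t div N"] assms by simp
  moreover have "b = b'" using arg_cong[OF e2, of "\<lambda>t. t mod N"] assms by simp
  ultimately show ?thesis using assms by auto
qed

text \<open>Kronecker substitution: with N larger than all exponents, the monomials remain
  distinct after the substitution of t, t^N, t^(N^2) for the three variables.\<close>

lemma eval_eq_0_imp: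
  fixes f :: "3 mpoly"
  assumes "\<And>x. eval_poly f x = 0"
  shows "f = 0"
proof (rule ccontr)
  assume "f \<noteq> 0"
  then obtain m0 where m0: "m0 \<in> Poly_Mapping.keys f" by fastforce
  define N where "N = Suc (Max ((\<lambda>(m,i). Poly_Mapping.lookup m i) ` (Poly_Mapping.keys f \<times> UNIV)))"
  have N: "Poly_Mapping.lookup m i < N" if "m \<in> Poly_Mapping.keys f" for m i
  proof -
    have "Poly_Mapping.lookup m i \<le> Max ((\<lambda>(m,i). Poly_Mapping.lookup m i) ` (Poly_Mapping.keys f \<times> UNIV))"
      by (rule Max_ge) (use that in force)+
    then show ?thesis by (simp add: N_def)
  qed
  define e where "e m = Poly_Mapping.lookup m 1 + N * Poly_Mapping.lookup m 2
    + N * N * Poly_Mapping.lookup m 3" for m :: "3 \<Rightarrow>\<^sub>0 nat"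
  have inj: "m = m'" if "m \<in> Poly_Mapping.keys f" "m' \<in> Poly_Mapping.keys f" "e m = e m'" for m m'
  proof -
    have "Poly_Mapping.lookup m i = Poly_Mapping.lookup m' i" for i
      using base_expansion_inj[OF N N N N N N that(3)[unfolded e_def]] that exhaust_3[of i] by auto
    then show ?thesis by (simp add: poly_mapping_eqI)
  qed
  define p where "p = (\<Sum>m\<in>Poly_Mapping.keys f. monom (Poly_Mapping.lookup f m) (e m))"
  have "poly p t = 0" for t
  proof -
    let ?x = "(vector [t, t ^ N, t ^ (N * N)] :: complex ^ 3)"
    have prod3: "(\<Prod>i\<in>UNIV. g i) = g 1 * (g 2 * g 3)" for g :: "3 \<Rightarrow> complex"
      unfolding UNIV_3 by simp
    have "poly p t = eval_poly f ?x"
      unfolding p_def eval_poly_def poly_sum poly_monom e_def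
      by (simp only: prod3 vector_3 power_add power_mult mult.assoc)
    then show ?thesis using assms by simp
  qed
  then have "p = 0" using poly_all_0_iff_0 by blast
  then have "0 = coeff p (e m0)" by simp
  also have "\<dots> = (\<Sum>m\<in>Poly_Mapping.keys f. if m = m0 then Poly_Mapping.lookup f m else 0)"
    unfolding p_def coeff_sum by (rule sum.cong) (use inj m0 in auto)
  also have "\<dots> = Poly_Mapping.lookup f m0" using m0 by simp
  finally show False using m0 by (simp add: in_keys_iff)
qed

lemma mpoly_eqI:
  fixes f g :: "3 mpoly"
  assumes "\<And>x. eval_poly f x = eval_poly g x"
  shows "f = g"
  using eval_eq_0_imp[of "f - g"] assms by simp

text \<open>Along a ray a polynomial in several variables becomes a univariate one. This makes
  degree arguments available when the constants are characterized as divisors of constants.\<close>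

lemma eval_on_ray:
  fixes f :: "'v::finite mpoly" and x :: "complex ^ 'v"
  shows "\<exists>p. \<forall>t. eval_poly f (t *s x) = poly p t"
proof -
  define p where "p = (\<Sum>m\<in>Poly_Mapping.keys f. monom (Poly_Mapping.lookup f m *
     (\<Prod>i\<in>UNIV. (x $ i) ^ Poly_Mapping.lookup m i)) (\<Sum>i\<in>UNIV. Poly_Mapping.lookup m i))"
  have "eval_poly f (t *s x) = poly p t" for t
    unfolding p_def eval_poly_def poly_sum poly_monom
    by (rule sum.cong) (auto simp: power_mult_distrib prod.distrib power_sum)
  then show ?thesis by blast
qed

section \<open>Homogeneous forms\<close>

lemma eval_homogeneous:
  assumes "homogeneous d f"
  shows "eval_poly f (t *s x) = t ^ d * eval_poly f x"
proof -
  have "(\<Prod>i\<in>UNIV. (t * x $ i) ^ Poly_Mapping.lookup m i) = t ^ d * (\<Prod>i\<in>UNIV. (x $ i) ^ Poly_Mapping.lookup m i)"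
    if "m \<in> Poly_Mapping.keys f" for m
    using assms that by (auto simp: power_mult_distrib prod.distrib power_sum[symmetric] homogeneous_def)
  then show ?thesis by (simp add: eval_poly_def sum_distrib_left mult_ac)
qed

lemma homogeneous_0 [simp]: "homogeneous d 0"
  by (simp add: homogeneous_def)

lemma homogeneous_add: "homogeneous d f \<Longrightarrow> homogeneous d g \<Longrightarrow> homogeneous d (f + g)"
  using keys_add[of f g] by (auto simp: homogeneous_def)

lemma homogeneous_uminus: "homogeneous d f \<Longrightarrow> homogeneous d (- f)"
  by (auto simp: homogeneous_def in_keys_iff)

lemma homogeneous_diff: "homogeneous d f \<Longrightarrow> homogeneous d g \<Longrightarrow> homogeneous d (f - g)"
  using homogeneous_add[of d f "- g"] by (simp add: homogeneous_uminus)

lemma homogeneous_mult: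
  assumes "homogeneous d f" "homogeneous e g"
  shows "homogeneous (d + e) (f * g)"
  unfolding homogeneous_def
proof
  fix m assume "m \<in> Poly_Mapping.keys (f * g)"
  then obtain a b where "m = a + b" "a \<in> Poly_Mapping.keys f" "b \<in> Poly_Mapping.keys g"
    using keys_mult[of f g] by blast
  then show "(\<Sum>i\<in>UNIV. Poly_Mapping.lookup m i) = d + e"
    using assms by (simp add: homogeneous_def lookup_add sum.distrib)
qed

lemma homogeneous_Const: "homogeneous 0 (Const c)"
  by (simp add: homogeneous_def Const_def)

lemma homogeneous_Var: "homogeneous 1 (Var i)"
  by (simp add: homogeneous_def Var_def lookup_single when_def)

lemma homogeneous_power: "homogeneous d f \<Longrightarrow> homogeneous (n * d) (f ^ n)"
proof (induction n)
  case 0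
  then show ?case using homogeneous_Const[of 1] by simp
next
  case (Suc n)
  then show ?case using homogeneous_mult[of d f "n * d" "f ^ n"] by simp
qed

lemma homogeneous_sum: "(\<And>i. i \<in> S \<Longrightarrow> homogeneous d (f i)) \<Longrightarrow> homogeneous d (sum f S)"
  by (induction S rule: infinite_finite_induct) (auto simp: homogeneous_add)

section \<open>Linear forms\<close>

definition dot :: "complex ^ 'v::finite \<Rightarrow> complex ^ 'v \<Rightarrow> complex" where
  "dot a x = (\<Sum>i\<in>UNIV. a $ i * x $ i)"

definition lin :: "complex ^ 3 \<Rightarrow> 3 mpoly" where
  "lin a = (\<Sum>i\<in>UNIV. Const (a $ i) * Var i)"

lemma eval_lin [simp]: "eval_poly (lin a) x = dot a x"
  by (simp add: lin_def dot_def)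

lemma dot_axis: "dot a (axis i c) = a $ i * c"
proof -
  have "dot a (axis i c) = (\<Sum>j\<in>UNIV. if j = i then a $ i * c else 0)"
    unfolding dot_def by (rule sum.cong) (auto simp: axis_def)
  then show ?thesis by simp
qed

lemma dot_add_right: "dot a (x + y) = dot a x + dot a y"
  by (simp add: dot_def distrib_left sum.distrib)

lemma dot_add_left: "dot (a + b) x = dot a x + dot b x"
  by (simp add: dot_def distrib_right sum.distrib)

lemma dot_diff_right: "dot a (x - y) = dot a x - dot a y"
  by (simp add: dot_def right_diff_distrib sum_subtractf)

lemma dot_diff_left: "dot (a - b) x = dot a x - dot b x"
  by (simp add: dot_def left_diff_distrib sum_subtractf)

lemma dot_scale_right [simp]: "dot a (c *s x) = c * dot a x"
  by (simp add: dot_def sum_distrib_left mult_ac)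

lemma dot_scale_left [simp]: "dot (c *s a) x = c * dot a x"
  by (simp add: dot_def sum_distrib_left mult_ac)

lemma dot_zero [simp]: "dot a 0 = 0" "dot 0 x = 0"
  by (simp_all add: dot_def)

lemma dot_nonzero: "a \<noteq> 0 \<Longrightarrow> \<exists>x. dot a x \<noteq> 0"
  by (metis dot_axis mult.right_neutral vec_eq_iff zero_index)

lemma lin_scale: "lin (c *s a) = Const c * lin a"
  by (rule mpoly_eqI) simp

lemma lin_eq_0_iff: "lin a = 0 \<longleftrightarrow> a = 0"
  by (metis dot_nonzero eval_lin eval_zero mpoly_eqI dot_zero(2))

lemma linear_form_lin: "a \<noteq> 0 \<Longrightarrow> linear_form (lin a)"
  unfolding linear_form_def lin_eq_0_iff unfolding lin_def
  using homogeneous_mult[OF homogeneous_Const homogeneous_Var] by (auto intro!: homogeneous_sum)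

lemma eval_linear_form:
  assumes "homogeneous 1 \<alpha>"
  shows "\<exists>a. \<forall>x. eval_poly \<alpha> x = dot a x"
proof -
  let ?e = "\<lambda>i. Poly_Mapping.single i (1::nat)"
  have keys: "Poly_Mapping.keys \<alpha> \<subseteq> range ?e"
  proof
    fix m assume "m \<in> Poly_Mapping.keys \<alpha>"
    then have s: "(\<Sum>i\<in>UNIV. Poly_Mapping.lookup m i) = 1" using assms by (auto simp: homogeneous_def)
    then obtain i where i: "Poly_Mapping.lookup m i = 1" "\<forall>j. j \<noteq> i \<longrightarrow> Poly_Mapping.lookup m j = 0"
      by (subst (asm) sum_eq_1_iff) auto
    then have "m = ?e i" by (intro poly_mapping_eqI) (auto simp: lookup_single when_def)
    then show "m \<in> range ?e" by blast
  qed
  have "eval_poly \<alpha> x = dot (\<chi> i. Poly_Mapping.lookup \<alpha> (?e i)) x" for x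
  proof -
    have inj: "inj ?e" by (rule injI) (metis keys_single singleton_inject zero_neq_one)
    have "eval_poly \<alpha> x = (\<Sum>m\<in>range ?e. Poly_Mapping.lookup \<alpha> m * eval_poly (Poly_Mapping.single m 1) x)"
      by (subst eval_poly_superset[OF _ keys]) auto
    also have "\<dots> = (\<Sum>i\<in>UNIV. Poly_Mapping.lookup \<alpha> (?e i) * eval_poly (Var i) x)"
      by (simp only: sum.reindex[OF inj] o_def Var_def)
    finally show ?thesis by (simp add: dot_def)
  qed
  then show ?thesis by blast
qed

lemma linear_formE:
  fixes \<alpha> :: "3 mpoly"
  assumes "linear_form \<alpha>"
  obtains a where "a \<noteq> 0" "\<alpha> = lin a"
proof -
  obtain a where "\<alpha> = lin a"
    using eval_linear_form[of \<alpha>] assms mpoly_eqI[of \<alpha>] unfolding linear_form_def by (metis eval_lin)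
  then show thesis using that[of a] assms lin_eq_0_iff by (auto simp: linear_form_def)
qed

text \<open>Reduction modulo a linear form: substituting for one variable its value on the zero
  set of the form does not change the residue class.\<close>

lemma lin_dvd_iff:
  assumes a: "a \<noteq> 0"
  shows "\<exists>\<sigma> :: 3 \<Rightarrow> 3 mpoly. (\<forall>x. dot a (\<chi> i. eval_poly (\<sigma> i) x) = 0) \<and> (\<forall>f. lin a dvd f \<longleftrightarrow> subst_poly \<sigma> f = 0)"
proof -
  obtain i where i: "a $ i \<noteq> 0" using a by (metis vec_eq_iff zero_index)
  define \<sigma> where "\<sigma> j = (if j = i then Var i - Const (1 / a $ i) * lin a else Var j)" for j
  have ev: "(\<chi> j. eval_poly (\<sigma> j) x) = x - axis i (dot a x / a $ i)" for x
    by (simp add: vec_eq_iff \<sigma>_def axis_def)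
  have zero: "dot a (\<chi> j. eval_poly (\<sigma> j) x) = 0" for x
    using i by (simp add: ev dot_diff_right dot_axis)
  have sub_eq: "subst_poly Var f = f" for f :: "3 mpoly"
    by (rule mpoly_eqI) (simp add: eval_subst)
  have cm: "lin a dvd f * g - f' * g'" if "lin a dvd f - f'" "lin a dvd g - g'" for f g f' g'
  proof -
    have "f * g - f' * g' = f * (g - g') + (f - f') * g'" by (simp add: algebra_simps)
    then show ?thesis using that by simp
  qed
  have cp: "lin a dvd f ^ n - f' ^ n" if "lin a dvd f - f'" for f f' n
    by (induction n) (use that cm in auto)
  have cpr: "lin a dvd prod f S - prod f' S" if "\<And>j. lin a dvd f j - f' j" for f f' and S :: "3 set"
    by (induction S rule: infinite_finite_induct) (use that cm in auto)
  have d: "lin a dvd Var j - \<sigma> j" for j by (simp add: \<sigma>_def)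
  have dvd: "lin a dvd f - subst_poly \<sigma> f" for f
  proof -
    have "lin a dvd subst_poly Var f - subst_poly \<sigma> f"
      unfolding subst_poly_def sum_subtractf[symmetric]
      by (intro dvd_sum cm cpr cp d) auto
    then show ?thesis by (simp add: sub_eq)
  qed
  have "lin a dvd f \<longleftrightarrow> subst_poly \<sigma> f = 0" for f
  proof
    assume "lin a dvd f"
    then obtain g where "f = lin a * g" by (auto simp: dvd_def)
    then show "subst_poly \<sigma> f = 0"
      by (intro eval_eq_0_imp) (simp add: eval_subst zero)
  next
    assume "subst_poly \<sigma> f = 0"
    then show "lin a dvd f" using dvd[of f] by simp
  qed
  then show ?thesis using zero by blast
qed

text \<open>Reduction modulo the form is a multiplicative substitution into an integral domain, and
  its kernel consists of the multiples of the form.\<close>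

lemma lin_prime:
  assumes a: "a \<noteq> 0" and dvd: "lin a dvd f * g"
  shows "lin a dvd f \<or> lin a dvd g"
proof -
  obtain \<sigma> :: "3 \<Rightarrow> 3 mpoly" where \<sigma>: "\<And>f. lin a dvd f \<longleftrightarrow> subst_poly \<sigma> f = 0" using lin_dvd_iff[OF a] by blast
  have "subst_poly \<sigma> f * subst_poly \<sigma> g = subst_poly \<sigma> (f * g)"
    by (rule mpoly_eqI) (simp add: eval_subst)
  then show ?thesis using dvd \<sigma> by (metis mult_eq_0_iff)
qed

section \<open>Lines and products of linear forms\<close>

definition hyp :: "complex ^ 'v::finite \<Rightarrow> (complex ^ 'v) set" where
  "hyp a = {x. dot a x = 0}"

definition is_line :: "pline \<Rightarrow> bool" where
  "is_line l \<longleftrightarrow> (\<exists>a. a \<noteq> 0 \<and> l = hyp a)"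

text \<open>A line determines its form only up to a scalar. Fixing one choice collects the scalar
  ambiguity of a factorization in a single constant.\<close>

definition line_form :: "pline \<Rightarrow> 3 mpoly" where
  "line_form l = lin (SOME a. a \<noteq> 0 \<and> l = hyp a)"

lemma zero_set_lin: "zero_set (lin a) = hyp a"
  by (simp add: zero_set_def hyp_def)

lemma is_line_hyp: "a \<noteq> 0 \<Longrightarrow> is_line (hyp a)"
  by (auto simp: is_line_def)

text \<open>The vectors \<open>axis j (a $ i) - axis i (a $ j)\<close> lie in the hyperplane of
  \<open>a\<close>; evaluating \<open>b\<close> on them gives the proportionality of
  coefficients.\<close>

lemma hyp_subset_imp_scale:
  fixes a b :: "complex ^ 'v::finite"
  assumes "a \<noteq> 0" "b \<noteq> 0" "hyp a \<subseteq> hyp b"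
  shows "\<exists>c. c \<noteq> 0 \<and> b = c *s a"
proof -
  obtain i where i: "a $ i \<noteq> 0" using assms(1) by (metis vec_eq_iff zero_index)
  have e: "b $ j * a $ i = b $ i * a $ j" for j
  proof -
    have "axis j (a $ i) - axis i (a $ j) \<in> hyp a"
      by (simp add: hyp_def dot_diff_right dot_axis)
    then have "axis j (a $ i) - axis i (a $ j) \<in> hyp b" using assms(3) by blast
    then show ?thesis by (simp add: hyp_def dot_diff_right dot_axis)
  qed
  have "b = (b $ i / a $ i) *s a"
    using i e by (simp add: vec_eq_iff field_simps)
  moreover have "b $ i / a $ i \<noteq> 0" using calculation assms(2) by (metis vector_smult_lzero)
  ultimately show ?thesis by blast
qed

lemma hyp_scale: "c \<noteq> 0 \<Longrightarrow> hyp (c *s a) = hyp a"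
  by (simp add: hyp_def)

lemma line_subset_eq: "is_line l \<Longrightarrow> is_line l' \<Longrightarrow> l \<subseteq> l' \<Longrightarrow> l = l'"
  unfolding is_line_def using hyp_subset_imp_scale hyp_scale by metis

lemma line_form_lin:
  assumes "is_line l"
  obtains a where "a \<noteq> 0" "l = hyp a" "line_form l = lin a"
proof -
  have "\<exists>a. a \<noteq> 0 \<and> l = hyp a" using assms by (auto simp: is_line_def)
  from someI_ex[OF this] show thesis using that unfolding line_form_def by blast
qed

lemma zero_line_form: "is_line l \<Longrightarrow> zero_set (line_form l) = l"
  by (metis line_form_lin zero_set_lin)

lemma eval_line_form_iff: "is_line l \<Longrightarrow> eval_poly (line_form l) x = 0 \<longleftrightarrow> x \<in> l"
  using zero_line_form[of l] by (auto simp: zero_set_def)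

lemma linear_form_line_form: "is_line l \<Longrightarrow> linear_form (line_form l)"
  by (metis line_form_lin linear_form_lin)

lemma linear_form_eq_line_form:
  assumes "linear_form \<alpha>" "zero_set \<alpha> = l"
  shows "is_line l" "\<exists>c. c \<noteq> 0 \<and> \<alpha> = Const c * line_form l"
proof -
  obtain a where a: "a \<noteq> 0" "\<alpha> = lin a" using assms(1) by (rule linear_formE)
  then have l: "l = hyp a" using assms(2) by (simp add: zero_set_lin)
  then show il: "is_line l" using a by (auto simp: is_line_def)
  obtain b where b: "b \<noteq> 0" "l = hyp b" "line_form l = lin b" using il by (rule line_form_lin)
  obtain c where "c \<noteq> 0" "a = c *s b" using hyp_subset_imp_scale[of b a] a b l by auto
  then show "\<exists>c. c \<noteq> 0 \<and> \<alpha> = Const c * line_form l" using a b by (auto simp: lin_scale)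
qed

lemma line_zero_mem: "is_line l \<Longrightarrow> 0 \<in> l"
  by (auto simp: is_line_def hyp_def)

lemma line_form_not_unit: "is_line l \<Longrightarrow> \<not> line_form l dvd 1"
proof
  assume l: "is_line l" and "line_form l dvd 1"
  then obtain g where "1 = line_form l * g" by (auto simp: dvd_def)
  then have "eval_poly 1 (0 :: complex ^ 3) = eval_poly (line_form l) 0 * eval_poly g 0" by (metis eval_mult)
  moreover have "eval_poly (line_form l) 0 = 0"
    using l by (simp add: eval_line_form_iff line_zero_mem)
  ultimately show False by simp
qed

text \<open>A Nullstellensatz for lines: the substitution that reduces modulo the form sends every
  point into the line, so a polynomial that vanishes on the line has residue 0.\<close>

lemma line_form_dvd_iff:
  assumes "is_line l"
  shows "line_form l dvd f \<longleftrightarrow> l \<subseteq> zero_set f"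
proof
  assume "line_form l dvd f"
  then show "l \<subseteq> zero_set f"
    using eval_line_form_iff[OF assms] by (auto simp: dvd_def zero_set_def)
next
  assume l: "l \<subseteq> zero_set f"
  obtain a where a: "a \<noteq> 0" "l = hyp a" "line_form l = lin a" using assms by (rule line_form_lin)
  obtain \<sigma> :: "3 \<Rightarrow> 3 mpoly" where \<sigma>: "\<And>x. dot a (\<chi> i. eval_poly (\<sigma> i) x) = 0"
     "\<And>f. lin a dvd f \<longleftrightarrow> subst_poly \<sigma> f = 0" using lin_dvd_iff[OF a(1)] by blast
  have "eval_poly (subst_poly \<sigma> f) x = 0" for x
  proof -
    have "(\<chi> i. eval_poly (\<sigma> i) x) \<in> l" using \<sigma>(1) a(2) by (simp add: hyp_def)
    then have "(\<chi> i. eval_poly (\<sigma> i) x) \<in> zero_set f" using l by blast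
    then show ?thesis by (simp add: eval_subst zero_set_def)
  qed
  then show "line_form l dvd f" using \<sigma>(2) a(3) eval_eq_0_imp by metis
qed

lemma line_form_prime:
  assumes "is_line l" "line_form l dvd f * g"
  shows "line_form l dvd f \<or> line_form l dvd g"
  using assms lin_prime by (metis line_form_lin)

lemma line_form_neq_0: "is_line l \<Longrightarrow> line_form l \<noteq> 0"
  by (metis line_form_lin lin_eq_0_iff)

lemma Const_eq_0_iff [simp]: "Const c = (0 :: 3 mpoly) \<longleftrightarrow> c = 0"
  by (metis Const_0 eval_Const)

lemma Const_dvd_1: "c \<noteq> 0 \<Longrightarrow> (Const c :: 3 mpoly) dvd 1"
  by (metis Const_1 Const_mult dvd_triv_left right_inverse)

text \<open>Rescaling each chosen form to \<open>line_form\<close> moves all scalars into one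
  constant. The induction runs over sub-multisets of \<open>B\<close>, because the assumption on the
  forms concerns the members of \<open>B\<close>.\<close>

lemma splits_into_iff:
  "splits_into f B \<longleftrightarrow> (\<forall>l\<in>#B. is_line l) \<and> (\<exists>c. c \<noteq> 0 \<and> f = Const c * (\<Prod>l\<in>#B. line_form l))"
proof
  assume "splits_into f B"
  then obtain c \<alpha> where c: "c \<noteq> 0" and \<alpha>: "\<forall>l\<in>#B. linear_form (\<alpha> l) \<and> zero_set (\<alpha> l) = l"
    and f: "f = Const c * (\<Prod>l\<in>#B. \<alpha> l)"
    by (auto simp: splits_into_def)
  have "\<exists>c. c \<noteq> 0 \<and> (\<Prod>l\<in>#B'. \<alpha> l) = Const c * (\<Prod>l\<in>#B'. line_form l)" if "B' \<subseteq># B" for B'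
    using that
  proof (induction B')
    case empty
    show ?case by (rule exI[of _ 1]) simp
  next
    case (add l B')
    have l: "l \<in># B" using add.prems by (metis mset_subset_eqD union_single_eq_member)
    have "B' \<subseteq># B" using add.prems by (metis mset_subset_eq_insertD subset_mset.less_imp_le)
    then obtain c where c: "c \<noteq> 0" "(\<Prod>l\<in>#B'. \<alpha> l) = Const c * (\<Prod>l\<in>#B'. line_form l)"
      using add.IH by blast
    obtain c' where c': "c' \<noteq> 0" "\<alpha> l = Const c' * line_form l"
      using linear_form_eq_line_form(2)[of "\<alpha> l" l] \<alpha> l by blast
    show ?case
      by (rule exI[of _ "c' * c"]) (simp add: c c' Const_mult mult_ac)
  qed
  from this[of B] obtain c' where "c' \<noteq> 0" "(\<Prod>l\<in>#B. \<alpha> l) = Const c' * (\<Prod>l\<in>#B. line_form l)" by auto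
  then have "c * c' \<noteq> 0 \<and> f = Const (c * c') * (\<Prod>l\<in>#B. line_form l)"
    using c f by (simp add: Const_mult mult_ac)
  then show "(\<forall>l\<in>#B. is_line l) \<and> (\<exists>c. c \<noteq> 0 \<and> f = Const c * (\<Prod>l\<in>#B. line_form l))"
    using linear_form_eq_line_form(1) \<alpha> by blast
next
  assume "(\<forall>l\<in>#B. is_line l) \<and> (\<exists>c. c \<noteq> 0 \<and> f = Const c * (\<Prod>l\<in>#B. line_form l))"
  then show "splits_into f B"
    unfolding splits_into_def using linear_form_line_form zero_line_form by blast
qed

text \<open>On each ray the two factors are univariate polynomials with a nonzero constant product,
  hence of degree 0, so the first factor has the same value at \<open>x\<close> and at 0.\<close>

lemma mult_const_imp_const:
  fixes f g :: "3 mpoly"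
  assumes "f * g = Const c" "c \<noteq> 0"
  shows "\<exists>a. a \<noteq> 0 \<and> f = Const a"
proof -
  have e: "eval_poly f x * eval_poly g x = c" for x
    using assms(1) by (metis eval_Const eval_mult)
  have "eval_poly f x = eval_poly f 0" for x
  proof -
    obtain p where p: "\<And>t. eval_poly f (t *s x) = poly p t" using eval_on_ray by metis
    obtain q where q: "\<And>t. eval_poly g (t *s x) = poly q t" using eval_on_ray by metis
    have "poly (p * q) = poly [:c:]" using e p q by (auto simp flip: p q)
    then have pq: "p * q = [:c:]" by (simp add: poly_eq_poly_eq_iff)
    then have "p \<noteq> 0" "q \<noteq> 0" using assms(2) by auto
    then have "degree p + degree q = degree [:c:]" using pq degree_mult_eq by metis
    then have "degree p = 0" by simp
    then obtain a where "p = [:a:]" by (metis degree_eq_zeroE)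
    then have "poly p 1 = poly p 0" by simp
    then show ?thesis using p[of 1] p[of 0] by simp
  qed
  then have "f = Const (eval_poly f 0)" by (intro mpoly_eqI) (simp)
  moreover have "eval_poly f 0 \<noteq> 0" using e[of 0] assms(2) by auto
  ultimately show ?thesis by blast
qed

text \<open>This is the portion of unique factorization on which the proof rests: each line form of
  the product is prime, divides one of the two factors and is cancelled there, until a constant
  remains.\<close>

lemma splits_into_mult_iff:
  assumes "splits_into (f * g) B"
  shows "\<exists>B1 B2. B = B1 + B2 \<and> splits_into f B1 \<and> splits_into g B2"
proof -
  obtain c where "\<forall>l\<in>#B. is_line l" "c \<noteq> 0" "f * g = Const c * (\<Prod>l\<in>#B. line_form l)"
    using assms by (auto simp: splits_into_iff)
  then show ?thesis
  proof (induction B arbitrary: f g)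
    case empty
    then obtain a b where "a \<noteq> 0" "f = Const a" "b \<noteq> 0" "g = Const b"
      using mult_const_imp_const[of f g c] mult_const_imp_const[of g f c] by (auto simp: mult.commute)
    then have "splits_into f {#}" "splits_into g {#}" by (auto simp: splits_into_iff)
    then show ?case by force
  next
    case (add l B)
    then have l: "is_line l" by simp
    let ?P = "Const c * (\<Prod>l\<in>#B. line_form l)"
    have fg: "f * g = line_form l * ?P" using add.prems by (simp add: mult_ac)
    consider f' where "f = line_form l * f'" | g' where "g = line_form l * g'"
      using line_form_prime[OF l, of f g] fg by (metis dvdE dvd_triv_left)
    then show ?case
    proof cases
      case 1
      then have "line_form l * (f' * g) = line_form l * ?P" using fg by (simp add: mult_ac)
      then have "f' * g = ?P" using line_form_neq_0[OF l] by (metis mult_left_cancel)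
      then obtain B1 B2 where B: "B = B1 + B2" "splits_into f' B1" "splits_into g B2"
        using add by force
      have "splits_into f (add_mset l B1)"
        using B(2) l unfolding 1 splits_into_iff by (auto simp: mult_ac)
      then show ?thesis using B by (metis union_mset_add_mset_left)
    next
      case 2
      then have "line_form l * (f * g') = line_form l * ?P" using fg by (simp add: mult_ac)
      then have "f * g' = ?P" using line_form_neq_0[OF l] by (metis mult_left_cancel)
      then obtain B1 B2 where B: "B = B1 + B2" "splits_into f B1" "splits_into g' B2"
        using add by force
      have "splits_into g (add_mset l B2)"
        using B(3) l unfolding 2 splits_into_iff by (auto simp: mult_ac)
      then show ?thesis using B by (metis union_mset_add_mset_right)
    qed
  qed
qed

section \<open>Multiplicativity, zero sets and uniqueness of the splitting\<close>

lemma splits_into_mult: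
  assumes "splits_into f B" "splits_into g B'"
  shows "splits_into (f * g) (B + B')"
proof -
  obtain c d where c: "c \<noteq> 0" "f = Const c * (\<Prod>l\<in>#B. line_form l)"
    and d: "d \<noteq> 0" "g = Const d * (\<Prod>l\<in>#B'. line_form l)"
    using assms by (auto simp: splits_into_iff)
  have "f * g = Const (c * d) * (\<Prod>l\<in>#B + B'. line_form l)"
    unfolding c d by (simp add: Const_mult mult_ac)
  moreover have "c * d \<noteq> 0" "\<forall>l\<in>#B + B'. is_line l" using assms c d by (auto simp: splits_into_iff)
  ultimately show ?thesis unfolding splits_into_iff by blast
qed

lemma splits_into_zero_set:
  assumes "splits_into f B"
  shows "eval_poly f x = 0 \<longleftrightarrow> (\<exists>l\<in>#B. x \<in> l)"
proof -
  obtain c where c: "c \<noteq> 0" "f = Const c * (\<Prod>l\<in>#B. line_form l)" "\<forall>l\<in>#B. is_line l"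
    using assms by (auto simp: splits_into_iff)
  have "eval_poly (\<Prod>l\<in>#B. line_form l) x = 0 \<longleftrightarrow> (\<exists>l\<in>#B. x \<in> l)"
    using c(3) by (induction B) (auto simp: eval_line_form_iff)
  then show ?thesis using c by simp
qed

text \<open>Primality reduces the question to one line form dividing another, which means inclusion
  of the lines and therefore equality.\<close>

lemma line_form_dvd_splits:
  assumes "splits_into f B" "is_line l"
  shows "line_form l dvd f \<longleftrightarrow> l \<in># B"
proof
  assume dvd: "line_form l dvd f"
  obtain c where c: "c \<noteq> 0" "f = Const c * (\<Prod>l\<in>#B. line_form l)" "\<forall>l\<in>#B. is_line l"
    using assms by (auto simp: splits_into_iff)
  have nc: "\<not> line_form l dvd Const c"
    using line_form_not_unit[OF assms(2)] Const_dvd_1[OF c(1)] dvd_trans by blast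
  have "l \<in># B" if "line_form l dvd (\<Prod>l\<in>#B. line_form l)"
    using that c(3)
  proof (induction B)
    case empty
    then show ?case using line_form_not_unit[OF assms(2)] by simp
  next
    case (add k B)
    consider "line_form l dvd line_form k" | "line_form l dvd (\<Prod>l\<in>#B. line_form l)"
      using line_form_prime[OF assms(2)] add.prems by auto
    then show ?case
    proof cases
      case 1
      then have "l \<subseteq> k" using add.prems zero_line_form[of k] line_form_dvd_iff[OF assms(2)] by auto
      then show ?thesis using line_subset_eq[of l k] assms(2) add.prems by auto
    qed (use add in auto)
  qed
  then show "l \<in># B" using line_form_prime[OF assms(2)] dvd nc c(2) by blast
next
  assume "l \<in># B"
  then show "line_form l dvd f"
    using assms by (auto simp: splits_into_iff dest!: multi_member_split)
qed

lemma splits_into_unique: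
  assumes "splits_into f B" "splits_into f B'"
  shows "B = B'"
  using assms
proof (induction B arbitrary: f B')
  case empty
  have "B' = {#}"
  proof (rule ccontr)
    assume "B' \<noteq> {#}"
    then obtain l where l: "l \<in># B'" by blast
    then have "is_line l" using empty by (auto simp: splits_into_iff)
    then show False using l line_form_dvd_splits[OF empty(1)] line_form_dvd_splits[OF empty(2)] by simp
  qed
  then show ?case by simp
next
  case (add l B)
  have il: "is_line l" using add.prems by (auto simp: splits_into_iff)
  have "l \<in># B'" using line_form_dvd_splits[OF add.prems(1) il] line_form_dvd_splits[OF add.prems(2) il] by simp
  then obtain C where C: "B' = add_mset l C" by (metis multi_member_split)
  obtain c where c: "c \<noteq> 0" "f = line_form l * (Const c * (\<Prod>l\<in>#B. line_form l))"
    using add.prems(1) by (auto simp: splits_into_iff mult_ac)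
  obtain d where d: "d \<noteq> 0" "f = line_form l * (Const d * (\<Prod>l\<in>#C. line_form l))"
    using add.prems(2) by (auto simp: splits_into_iff mult_ac C)
  have e: "Const c * (\<Prod>l\<in>#B. line_form l) = Const d * (\<Prod>l\<in>#C. line_form l)"
    using c d line_form_neq_0[OF il] by (metis mult_left_cancel)
  have "splits_into (Const c * (\<Prod>l\<in>#B. line_form l)) B" using add.prems c by (auto simp: splits_into_iff)
  moreover have "splits_into (Const c * (\<Prod>l\<in>#B. line_form l)) C"
    unfolding e using add.prems(2) d C by (auto simp: splits_into_iff)
  ultimately show ?case using add.IH C by blast
qed

lemma block_of_eq: "splits_into f B \<Longrightarrow> block_of f = B"
  unfolding block_of_def using splits_into_unique by blast

lemma splits_into_lin: "a \<noteq> 0 \<Longrightarrow> splits_into (lin a) {#hyp a#}"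
  unfolding splits_into_def
  by (rule exI[of _ 1], rule exI[of _ "\<lambda>_. lin a"]) (simp add: linear_form_lin zero_set_lin)

lemma splits_into_one: "splits_into 1 {#}"
  unfolding splits_into_iff by (auto intro!: exI[of _ 1])

lemma splits_into_prod:
  assumes "finite S" "\<And>i. i \<in> S \<Longrightarrow> splits_into (f i) (B i)"
  shows "splits_into (prod f S) (\<Sum>i\<in>S. B i)"
  using assms by (induction S) (auto simp: splits_into_one splits_into_mult)

lemma splits_into_power: "splits_into f B \<Longrightarrow> splits_into (f ^ n) (repeat_mset n B)"
  by (induction n) (auto simp: splits_into_one splits_into_mult)

text \<open>Comparing the values at \<open>x\<close> and \<open>2 x\<close> for a point with
  \<open>f(x) \<noteq> 0\<close> equates two powers of 2. Taking norms moves the equation to the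
  reals, where the exponents can be compared.\<close>

lemma degree_splits_into:
  assumes "splits_into f B" "homogeneous d f"
  shows "size B = d"
proof -
  obtain c where c: "c \<noteq> 0" "f = Const c * (\<Prod>l\<in>#B. line_form l)" "\<forall>l\<in>#B. is_line l"
    using assms by (auto simp: splits_into_iff)
  have "f \<noteq> 0" using c line_form_neq_0 by (auto simp: prod_mset_zero_iff)
  then obtain x where x: "eval_poly f x \<noteq> 0" using eval_eq_0_imp by blast
  have "homogeneous (size B) (\<Prod>l\<in>#B. line_form l)" using c(3)
  proof (induction B)
    case empty
    then show ?case using homogeneous_Const[of 1] by simp
  next
    case (add l B)
    then show ?case
      using homogeneous_mult[of 1 "line_form l" "size B" "\<Prod>l\<in>#B. line_form l"] linear_form_line_form[of l]
      by (simp add: linear_form_def)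
  qed
  then have "homogeneous (size B) f"
    using homogeneous_mult[OF homogeneous_Const] c(2) by fastforce
  then have "2 ^ size B * eval_poly f x = 2 ^ d * eval_poly f x"
    using assms(2) eval_homogeneous by metis
  then have "(2::complex) ^ size B = 2 ^ d" using x by simp
  then have "norm ((2::complex) ^ size B) = norm ((2::complex) ^ d)" by simp
  then have "(2::real) ^ size B = 2 ^ d" by (simp add: norm_power)
  then show ?thesis by simp
qed

section \<open>Points\<close>

definition pt :: "complex ^ 3 \<Rightarrow> ppoint" where
  "pt x = {c *s x | c. True}"

lemma pt_eq_span: "pt x = vec.span {x}"
  by (auto simp: pt_def vec.span_singleton)

lemma is_point_pt: "x \<noteq> 0 \<Longrightarrow> is_point (pt x)"
  unfolding is_point_def pt_eq_span by (simp add: vec.subspace_span)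

lemma is_pointE:
  assumes "is_point p"
  obtains x where "x \<noteq> 0" "p = pt x"
proof -
  have "vec.subspace p" "vec.dim p = 1" using assms by (auto simp: is_point_def)
  then obtain b where b: "b \<subseteq> p" "vec.independent b" "p \<subseteq> vec.span b" "card b = 1"
    by (metis vec.basis_exists)
  then obtain x where x: "b = {x}" by (metis card_1_singletonE)
  then have "p = pt x" unfolding pt_eq_span
    using b \<open>vec.subspace p\<close> vec.span_minimal by blast
  moreover have "x \<noteq> 0" using b x vec.dependent_zero by blast
  ultimately show thesis using that by blast
qed

lemma mem_pt_self: "x \<in> pt x"
  unfolding pt_def by (rule CollectI, rule exI[of _ 1]) simp

lemma pt_subset_line: "is_line l \<Longrightarrow> pt x \<subseteq> l \<longleftrightarrow> x \<in> l"
  using mem_pt_self[of x] by (auto simp: is_line_def hyp_def pt_def)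

lemma pt_eq_iff: "x \<noteq> 0 \<Longrightarrow> pt x = pt y \<longleftrightarrow> (\<exists>c. c \<noteq> 0 \<and> y = c *s x)"
proof
  assume "x \<noteq> 0" "pt x = pt y"
  then obtain c where c: "x = c *s y" using mem_pt_self[of x] by (auto simp: pt_def)
  then have "c \<noteq> 0" using \<open>x \<noteq> 0\<close> by auto
  then have "y = (1 / c) *s x" using c by (simp add: vector_smult_assoc)
  then show "\<exists>c. c \<noteq> 0 \<and> y = c *s x" using \<open>c \<noteq> 0\<close> by (metis divide_eq_0_iff one_neq_zero)
next
  assume "\<exists>c. c \<noteq> 0 \<and> y = c *s x"
  then obtain c where c: "c \<noteq> 0" "y = c *s x" by blast
  then have x: "x = (1 / c) *s y" by (simp add: vector_smult_assoc)
  show "pt x = pt y"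
  proof
    show "pt x \<subseteq> pt y" unfolding pt_def by (subst x) (auto simp: vector_smult_assoc)
    show "pt y \<subseteq> pt x" unfolding pt_def c(2) by (auto simp: vector_smult_assoc)
  qed
qed

text \<open>If two lines shared two independent vectors \<open>x\<close> and \<open>y\<close>, both
  normal vectors would be multiples of the cross product of \<open>x\<close> and \<open>y\<close>,
  whose entries are the minors \<open>m i j\<close>, and the lines would coincide.\<close>

lemma lines_meet:
  assumes "is_line l" "is_line l'" "l \<noteq> l'" "x \<noteq> 0" "x \<in> l" "x \<in> l'"
  shows "l \<inter> l' = pt x"
proof -
  obtain a b where a: "a \<noteq> 0" "l = hyp a" and b: "b \<noteq> 0" "l' = hyp b" using assms by (auto simp: is_line_def)
  have sub: "vec.subspace (l \<inter> l')"
    unfolding vec.subspace_def a b hyp_def by (auto simp: dot_add_right)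
  have "y \<in> pt x" if y: "y \<in> l \<inter> l'" for y
  proof (rule ccontr)
    assume ny: "y \<notin> pt x"
    have ax: "dot a x = 0" "dot a y = 0" "dot b x = 0" "dot b y = 0"
      using assms y a b by (auto simp: hyp_def)
    define m where "m i j = x $ i * y $ j - x $ j * y $ i" for i j
    have exm: "m 2 3 \<noteq> 0 \<or> m 3 1 \<noteq> 0 \<or> m 1 2 \<noteq> 0"
    proof (rule ccontr)
      assume "\<not> ?thesis"
      then have m0: "x $ i * y $ j = x $ j * y $ i" for i j
        using exhaust_3[of i] exhaust_3[of j] unfolding m_def by (auto simp: mult.commute)
      obtain i where i: "x $ i \<noteq> 0" using assms(4) by (metis vec_eq_iff zero_index)
      have "y = (y $ i / x $ i) *s x" using i m0[of i] by (simp add: vec_eq_iff field_simps)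
      then show False using ny by (auto simp: pt_def)
    qed
    have par: "c $ i * m k i = c $ j * m j k"
      if "c $ i * x $ i + c $ j * x $ j + c $ k * x $ k = 0" "c $ i * y $ i + c $ j * y $ j + c $ k * y $ k = 0"
      for c :: "complex ^ 3" and i j k
    proof -
      have "c $ i * m k i - c $ j * m j k = x $ k * (c $ i * y $ i + c $ j * y $ j + c $ k * y $ k)
         - y $ k * (c $ i * x $ i + c $ j * x $ j + c $ k * x $ k)"
        by (simp add: m_def algebra_simps)
      then show ?thesis using that by simp
    qed
    let ?m = "vector [m 2 3, m 3 1, m 1 2] :: complex ^ 3"
    have m0: "?m \<noteq> 0" using exm by (metis vector_3 zero_index)
    have "\<exists>k. c = k *s ?m" if c: "dot c x = 0" "dot c y = 0" for c
    proof -
      have e: "c $ 1 * m 3 1 = c $ 2 * m 2 3" "c $ 2 * m 1 2 = c $ 3 * m 3 1" "c $ 3 * m 2 3 = c $ 1 * m 1 2"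
        using par[of c 1 2 3] par[of c 2 3 1] par[of c 3 1 2] c by (auto simp: dot_def sum_3 add_ac)
      consider "m 2 3 \<noteq> 0" | "m 3 1 \<noteq> 0" | "m 1 2 \<noteq> 0" using exm by blast
      then show ?thesis
      proof cases
        case 1
        then show ?thesis using e by (intro exI[of _ "c $ 1 / m 2 3"]) (simp add: vec_eq_iff forall_3 vector_3 field_simps)
      next
        case 2
        then show ?thesis using e by (intro exI[of _ "c $ 2 / m 3 1"]) (simp add: vec_eq_iff forall_3 vector_3 field_simps)
      next
        case 3
        then show ?thesis using e by (intro exI[of _ "c $ 3 / m 1 2"]) (simp add: vec_eq_iff forall_3 vector_3 field_simps)
      qed
    qed
    then obtain k k' where "a = k *s ?m" "b = k' *s ?m" using ax by meson
    then have "hyp a = hyp ?m" "hyp b = hyp ?m" using a(1) b(1) hyp_scale vector_smult_lzero by metis+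
    then show False using assms(3) a b by simp
  qed
  moreover have "pt x \<subseteq> l \<inter> l'" using pt_subset_line assms by auto
  ultimately show ?thesis by blast
qed

text \<open>The cross product of the normal vectors lies on both lines. If it vanishes, the normal
  vectors are proportional and any nonzero vector of the first line serves.\<close>

lemma lines_meet_exists:
  assumes "is_line l" "is_line l'"
  obtains x where "x \<noteq> 0" "x \<in> l" "x \<in> l'"
proof -
  obtain a b where a: "a \<noteq> 0" "l = hyp a" and b: "b \<noteq> 0" "l' = hyp b" using assms by (auto simp: is_line_def)
  let ?c = "vector [a$2*b$3-a$3*b$2, a$3*b$1-a$1*b$3, a$1*b$2-a$2*b$1] :: complex ^ 3"
  have c: "dot a ?c = 0" "dot b ?c = 0" by (simp_all add: dot_def sum_3 vector_3 algebra_simps)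
  show thesis
  proof (cases "?c = 0")
    case False
    then show ?thesis using that c a b by (auto simp: hyp_def)
  next
    case True
    have z: "a$2*b$3 = a$3*b$2" "a$3*b$1 = a$1*b$3" "a$1*b$2 = a$2*b$1"
      using arg_cong[OF True, of "\<lambda>v. v$1"] arg_cong[OF True, of "\<lambda>v. v$2"] arg_cong[OF True, of "\<lambda>v. v$3"]
      by (simp_all add: vector_3)
    have propo: "a $ i * b $ j = a $ j * b $ i" for i j
      using exhaust_3[of i] exhaust_3[of j] z by (auto simp: mult.commute)
    obtain i where i: "a $ i \<noteq> 0" using a by (metis vec_eq_iff zero_index)
    obtain j :: "3" where j: "j \<noteq> i" using exhaust_3[of i] by (metis one_neq_zero zero_neq_one)
    let ?y = "axis j (a $ i) - axis i (a $ j)"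
    have "?y $ j \<noteq> 0" using i j by (simp add: axis_def)
    then have "?y \<noteq> 0" by (metis zero_index)
    moreover have "dot a ?y = 0" "dot b ?y = 0"
      using propo[of i j] by (simp_all add: dot_diff_right dot_axis mult.commute)
    ultimately show ?thesis using that[of ?y] a b by (auto simp: hyp_def)
  qed
qed

lemma lines_meet_point:
  assumes "is_line l" "is_line l'" "l \<noteq> l'"
  shows "is_point (l \<inter> l')"
  by (metis assms is_point_pt lines_meet lines_meet_exists)

section \<open>The combinatorics of multinets\<close>

lemma base_mult_eq: "base_mult A p = size {#l \<in># hd A. p \<subseteq> l#}"
proof -
  have s: "size {#l \<in># B. p \<subseteq> l#} = (\<Sum>l\<in>{l \<in> set_mset B. p \<subseteq> l}. count B l)" for B :: "pline multiset"
    unfolding size_multiset_overloaded_eq by (rule sum.cong) auto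
  show ?thesis unfolding base_mult_def s ..
qed

text \<open>A presentation of the multinet by generators of the pencil and chosen fibers. The last
  clause says that any two of these fibers generate the pencil again, so that any two blocks
  determine the base.\<close>

definition fibration :: "3 mpoly set \<Rightarrow> nat \<Rightarrow> nat \<Rightarrow> arrangement \<Rightarrow> 3 mpoly \<Rightarrow> 3 mpoly \<Rightarrow> (nat \<Rightarrow> 3 mpoly) \<Rightarrow> bool" where
  "fibration W k d A f g F \<longleftrightarrow>
    homogeneous d f \<and> homogeneous d g \<and> W = {Const a * f + Const b * g | a b. True} \<and>
    (\<forall>i<k. F i \<in> W \<and> splits_into (F i) (A ! i)) \<and>
    (\<forall>i<k. \<forall>j<k. i \<noteq> j \<longrightarrow> (\<exists>a b a' b'. f = Const a * F i + Const b * F j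
       \<and> g = Const a' * F i + Const b' * F j))"

locale multinet =
  fixes W k d A
  assumes multinet: "multinet_of_pencil W k d A"
begin

lemma length_A: "length A = k" and k_ge_3: "k \<ge> 3"
  using multinet by (auto simp: multinet_of_pencil_def)

lemma fibers:
  "\<exists>f g F. fibration W k d A f g F"
proof -
  obtain f g where fg: "homogeneous d f" "homogeneous d g"
    "W = {Const a * f + Const b * g | a b. True}"
    using multinet by (auto simp: multinet_of_pencil_def is_pencil_def)
  obtain F where F: "\<And>i. i < k \<Longrightarrow> F i \<in> W" "\<And>i. i < k \<Longrightarrow> splits_into (F i) (A ! i)"
    "\<And>i j. i < k \<Longrightarrow> j < k \<Longrightarrow> i \<noteq> j \<Longrightarrow> \<not> (\<exists>c. F i = Const c * F j)"
    using multinet unfolding multinet_of_pencil_def by metis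
  have "\<exists>a b a' b'. f = Const a * F i + Const b * F j \<and> g = Const a' * F i + Const b' * F j"
    if ij: "i < k" "j < k" "i \<noteq> j" for i j
  proof -
    obtain a b where i: "F i = Const a * f + Const b * g" using F(1)[OF ij(1)] fg by auto
    obtain a' b' where j: "F j = Const a' * f + Const b' * g" using F(1)[OF ij(2)] fg by auto
    \<comment> \<open>The determinant of the two fibers in terms of \<open>f\<close> and
      \<open>g\<close>. It is nonzero because the fibers are not proportional, and Cramer's rule
      then recovers \<open>f\<close> and \<open>g\<close>.\<close>
    define D where "D = a * b' - a' * b"
    have D: "D \<noteq> 0"
    proof
      assume "D = 0"
      then have D0: "a * b' = a' * b" by (simp add: D_def)
      consider "a' \<noteq> 0" | "a' = 0" "b' \<noteq> 0" | "a' = 0" "b' = 0" by blast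
      then show False
      proof cases
        case 1
        have "F i = Const (a / a') * F j"
          by (rule mpoly_eqI) (use 1 D0 in \<open>simp add: i j field_simps\<close>)
        then show False using F(3)[OF ij] by blast
      next
        case 2
        have "F i = Const (b / b') * F j"
          by (rule mpoly_eqI) (use 2 D0 in \<open>simp add: i j field_simps\<close>)
        then show False using F(3)[OF ij] by blast
      next
        case 3
        then have "F j = Const 0 * F i" using j by simp
        then show False using F(3)[of j i] ij by blast
      qed
    qed
    have "f = Const (b' / D) * F i + Const (- b / D) * F j"
    proof (rule mpoly_eqI)
      fix x
      let ?f = "eval_poly f x" and ?g = "eval_poly g x"
      have "b' * (a * ?f + b * ?g) - b * (a' * ?f + b' * ?g) = D * ?f"
        by (simp add: D_def algebra_simps)
      then show "?f = eval_poly (Const (b' / D) * F i + Const (- b / D) * F j) x"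
        using D by (simp add: i j field_simps)
    qed
    moreover have "g = Const (- a' / D) * F i + Const (a / D) * F j"
    proof (rule mpoly_eqI)
      fix x
      let ?f = "eval_poly f x" and ?g = "eval_poly g x"
      have "a * (a' * ?f + b' * ?g) - a' * (a * ?f + b * ?g) = D * ?g"
        by (simp add: D_def algebra_simps)
      then show "?g = eval_poly (Const (- a' / D) * F i + Const (a / D) * F j) x"
        using D by (simp add: i j field_simps)
    qed
    ultimately show ?thesis by blast
  qed
  then have "fibration W k d A f g F" unfolding fibration_def using fg F by blast
  then show ?thesis by blast
qed

lemma is_line_block: "i < k \<Longrightarrow> l \<in># A ! i \<Longrightarrow> is_line l"
  using fibers unfolding fibration_def splits_into_iff by blast

lemma size_block: "i < k \<Longrightarrow> size (A ! i) = d"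
proof -
  assume i: "i < k"
  obtain f g F where "fibration W k d A f g F" using fibers by blast
  then have fg: "homogeneous d f" "homogeneous d g"
    "W = {Const a * f + Const b * g | a b. True}" and F: "F i \<in> W" "splits_into (F i) (A ! i)"
    using i by (auto simp: fibration_def)
  have "homogeneous d (Const a * h)" if "homogeneous d h" for a and h :: "3 mpoly"
    using homogeneous_mult[OF homogeneous_Const that] by simp
  moreover obtain a b where "F i = Const a * f + Const b * g" using F(1) fg by auto
  ultimately have "homogeneous d (F i)" using fg homogeneous_add[of d "Const a * f" "Const b * g"] by metis
  then show ?thesis using degree_splits_into F(2) by blast
qed

text \<open>A line shared by two fibers divides both generators and would be a fixed
  component.\<close>

lemma blocks_disjoint:
  assumes "i < k" "j < k" "i \<noteq> j"
  shows "set_mset (A ! i) \<inter> set_mset (A ! j) = {}"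
proof (rule ccontr)
  assume "\<not> ?thesis"
  then obtain l where l: "l \<in># A ! i" "l \<in># A ! j" by blast
  obtain f g F where "fibration W k d A f g F" using fibers by blast
  then have W: "W = {Const a * f + Const b * g | a b. True}"
    and F: "\<And>i. i < k \<Longrightarrow> splits_into (F i) (A ! i)"
    and fgF: "\<exists>a b a' b'. f = Const a * F i + Const b * F j \<and> g = Const a' * F i + Const b' * F j"
    using assms unfolding fibration_def by blast+
  have il: "is_line l" using is_line_block l assms by blast
  have "line_form l dvd F i" "line_form l dvd F j" using F assms l il line_form_dvd_splits by blast+
  then have "line_form l dvd f" "line_form l dvd g" using fgF by auto
  then have "\<forall>h\<in>W. line_form l dvd h" using W by auto
  moreover have "no_fixed_component W" using multinet by (simp add: multinet_of_pencil_def)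
  ultimately show False using line_form_not_unit[OF il] by (auto simp: no_fixed_component_def)
qed

lemma base_locus_eq:
  assumes "i < k" "j < k" "i \<noteq> j"
  shows "base_locus W = {p. is_point p \<and> (\<exists>l\<in>#A ! i. p \<subseteq> l) \<and> (\<exists>l\<in>#A ! j. p \<subseteq> l)}"
proof -
  obtain f g F where "fibration W k d A f g F" using fibers by blast
  then have W: "W = {Const a * f + Const b * g | a b. True}"
    and FW: "\<And>i. i < k \<Longrightarrow> F i \<in> W"
    and F: "\<And>i. i < k \<Longrightarrow> splits_into (F i) (A ! i)"
    and fgF: "\<exists>a b a' b'. f = Const a * F i + Const b * F j \<and> g = Const a' * F i + Const b' * F j"
    using assms unfolding fibration_def by blast+
  have z: "p \<subseteq> zero_set (F m) \<longleftrightarrow> (\<exists>l\<in>#A ! m. p \<subseteq> l)" if p: "is_point p" and m: "m < k" for p m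
  proof -
    obtain x where x: "p = pt x" using p by (rule is_pointE)
    show ?thesis
    proof
      assume "p \<subseteq> zero_set (F m)"
      then have "eval_poly (F m) x = 0" using mem_pt_self x by (auto simp: zero_set_def)
      then obtain l where "l \<in># A ! m" "x \<in> l" using splits_into_zero_set[OF F[OF m]] by blast
      then show "\<exists>l\<in>#A ! m. p \<subseteq> l" using x pt_subset_line is_line_block[OF m] by blast
    next
      assume "\<exists>l\<in>#A ! m. p \<subseteq> l"
      then show "p \<subseteq> zero_set (F m)" using splits_into_zero_set[OF F[OF m]] by (auto simp: zero_set_def)
    qed
  qed
  have Wz: "(\<forall>h\<in>W. p \<subseteq> zero_set h) \<longleftrightarrow> p \<subseteq> zero_set (F i) \<and> p \<subseteq> zero_set (F j)" for p
  proof
    assume "p \<subseteq> zero_set (F i) \<and> p \<subseteq> zero_set (F j)"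
    then have "p \<subseteq> zero_set f" "p \<subseteq> zero_set g" using fgF by (auto simp: zero_set_def subset_eq)
    then show "\<forall>h\<in>W. p \<subseteq> zero_set h" using W by (auto simp: zero_set_def subset_eq)
  qed (use FW assms in blast)
  show ?thesis unfolding base_locus_def by (rule Collect_cong) (metis Wz z assms(1,2))
qed

lemma finite_base_locus: "finite (base_locus W)"
proof -
  have k: "0 < k" "1 < k" using k_ge_3 by auto
  have "base_locus W \<subseteq> (\<lambda>(l, l'). l \<inter> l') ` (set_mset (A ! 0) \<times> set_mset (A ! 1))"
  proof
    fix p assume "p \<in> base_locus W"
    then obtain l l' where p: "is_point p" "l \<in># A ! 0" "p \<subseteq> l" "l' \<in># A ! 1" "p \<subseteq> l'"
      using base_locus_eq[OF k] by auto
    obtain x where x: "x \<noteq> 0" "p = pt x" using p(1) by (rule is_pointE)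
    have "l \<noteq> l'" using p blocks_disjoint[OF k] by auto
    then have "l \<inter> l' = p"
      using lines_meet[of l l' x] x p is_line_block k mem_pt_self by blast
    then show "p \<in> (\<lambda>(l, l'). l \<inter> l') ` (set_mset (A ! 0) \<times> set_mset (A ! 1))" using p by force
  qed
  then show ?thesis by (rule finite_subset) auto
qed

text \<open>Counting the pairs of lines of two blocks by their intersection points replaces Bezout's theorem.\<close>

lemma bezout:
  "(\<Sum>p\<in>base_locus W. size {#l \<in># A ! 0. p \<subseteq> l#} * size {#l \<in># A ! 1. p \<subseteq> l#}) = d\<^sup>2"
proof -
  have k: "0 < k" "1 < k" using k_ge_3 by auto
  let ?X = "base_locus W" and ?B = "A ! 0" and ?C = "A ! 1"
  have s: "size {#l \<in># B. p \<subseteq> l#} = (\<Sum>l\<in>set_mset B. count B l * of_bool (p \<subseteq> l))"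
    for B :: "pline multiset" and p
  proof -
    have "size {#l \<in># B. p \<subseteq> l#} = (\<Sum>l\<in>{l \<in> set_mset B. p \<subseteq> l}. count B l)"
      unfolding size_multiset_overloaded_eq by (rule sum.cong) auto
    also have "\<dots> = (\<Sum>l\<in>set_mset B. count B l * of_bool (p \<subseteq> l))"
      by (rule sum.mono_neutral_cong_left) auto
    finally show ?thesis .
  qed
  \<comment> \<open>Lines of different blocks are distinct and meet in exactly one point, which
    belongs to the base.\<close>
  have one: "(\<Sum>p\<in>?X. of_bool (p \<subseteq> l) * of_bool (p \<subseteq> l')) = (1::nat)"
    if l: "l \<in># ?B" and l': "l' \<in># ?C" for l l'
  proof -
    have il: "is_line l" "is_line l'" using l l' is_line_block k by blast+
    have ne: "l \<noteq> l'" using l l' blocks_disjoint[OF k] by auto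
    let ?q = "l \<inter> l'"
    have q: "is_point ?q" using lines_meet_point il ne by blast
    have "(of_bool (p \<subseteq> l) * of_bool (p \<subseteq> l') :: nat) = (if p = ?q then 1 else 0)" if p: "p \<in> ?X" for p
    proof -
      have "is_point p" using p by (auto simp: base_locus_def)
      then obtain x where x: "x \<noteq> 0" "p = pt x" by (rule is_pointE)
      have "p = ?q" if "p \<subseteq> l" "p \<subseteq> l'"
        using lines_meet[OF il ne x(1)] that x pt_subset_line il by auto
      then show ?thesis by (cases "p \<subseteq> l \<and> p \<subseteq> l'") auto
    qed
    then have "(\<Sum>p\<in>?X. of_bool (p \<subseteq> l) * of_bool (p \<subseteq> l')) = (\<Sum>p\<in>?X. if p = ?q then 1 else (0::nat))"
      by (rule sum.cong[OF refl])
    also have "\<dots> = 1" using finite_base_locus base_locus_eq[OF k] q l l' by auto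
    finally show ?thesis .
  qed
  have "(\<Sum>p\<in>?X. size {#l \<in># ?B. p \<subseteq> l#} * size {#l \<in># ?C. p \<subseteq> l#})
     = (\<Sum>p\<in>?X. \<Sum>l\<in>set_mset ?B. \<Sum>l'\<in>set_mset ?C.
          count ?B l * count ?C l' * (of_bool (p \<subseteq> l) * of_bool (p \<subseteq> l')))"
    unfolding s sum_product by (simp add: mult_ac)
  also have "\<dots> = (\<Sum>l\<in>set_mset ?B. \<Sum>l'\<in>set_mset ?C. \<Sum>p\<in>?X.
          count ?B l * count ?C l' * (of_bool (p \<subseteq> l) * of_bool (p \<subseteq> l')))"
    by (subst sum.swap, rule sum.cong[OF refl], subst sum.swap, rule refl)
  also have "\<dots> = (\<Sum>l\<in>set_mset ?B. \<Sum>l'\<in>set_mset ?C. count ?B l * count ?C l')"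
    by (intro sum.cong refl) (simp only: sum_distrib_left[symmetric] one mult_1_right)
  also have "\<dots> = size ?B * size ?C" by (simp add: size_multiset_overloaded_eq sum_product)
  finally show ?thesis using size_block k by (simp add: power2_eq_square)
qed

lemma finite_lines_of: "finite (lines_of A)"
  by (auto simp: lines_of_def)

lemma finite_other_points: "finite (other_points X A)"
proof -
  have "other_points X A \<subseteq> (\<lambda>(l, l'). l \<inter> l') ` (lines_of A \<times> lines_of A)"
    by (auto simp: other_points_def)
  then show ?thesis by (rule finite_subset) (simp add: finite_lines_of)
qed

text \<open>For \<open>k = 3\<close> the factor \<open>2 - k\<close> is -1, so the sum of the
  squares of the multiplicities cancels against the square of \<open>d\<close>. The number of base
  points is absorbed as the -1 in each summand \<open>n_p - 1\<close>.\<close>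

lemma complete_iff:
  assumes "k = 3"
    and eq: "\<And>p. p \<in> base_locus W \<Longrightarrow> size {#l \<in># A ! 1. p \<subseteq> l#} = size {#l \<in># A ! 0. p \<subseteq> l#}"
  shows "3 + int (card (base_locus W)) =
          (2 - int k) * (3 * int d - (int d)\<^sup>2
             + (\<Sum>p\<in>base_locus W. (int (base_mult A p))\<^sup>2 - int (base_mult A p)))
          + 2 * int (card (lines_of A))
          - (\<Sum>p\<in>other_points (base_locus W) A. int (num_lines_through A p) - 1)
    \<longleftrightarrow> 3 * int d + 3 + (\<Sum>p\<in>other_points (base_locus W) A. int (num_lines_through A p) - 1)
       = 2 * int (card (lines_of A)) + (\<Sum>p\<in>base_locus W. int (base_mult A p) - 1)"
proof -
  have "A ! 0 = hd A" using length_A k_ge_3 by (cases A) auto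
  then have n: "size {#l \<in># A ! 0. p \<subseteq> l#} = base_mult A p" for p by (simp add: base_mult_eq)
  have "(\<Sum>p\<in>base_locus W. (base_mult A p)\<^sup>2) = d\<^sup>2"
    using bezout eq by (simp add: power2_eq_square n)
  then have "(\<Sum>p\<in>base_locus W. (int (base_mult A p))\<^sup>2) = (int d)\<^sup>2"
    by (metis (mono_tags, lifting) of_nat_power of_nat_sum sum.cong)
  then show ?thesis using assms(1) by (auto simp: sum_subtractf)
qed

end

section \<open>Traces of the arrangement of planes\<close>

definition unity :: "nat \<Rightarrow> complex set" where
  "unity n = {z. z ^ n = 1}"

lemma finite_unity: "n \<ge> 1 \<Longrightarrow> finite (unity n)"
  and card_unity: "n \<ge> 1 \<Longrightarrow> card (unity n) = n"
  using finite_roots_unity[of n] card_roots_unity_eq[of n] by (auto simp: unity_def)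

lemma unity_nonzero: "n \<ge> 1 \<Longrightarrow> z \<in> unity n \<Longrightarrow> z \<noteq> 0"
  by (auto simp: unity_def power_0_left)

lemma one_in_unity: "1 \<in> unity n"
  by (simp add: unity_def)

lemma unity_mult: "z \<in> unity n \<Longrightarrow> w \<in> unity n \<Longrightarrow> z * w \<in> unity n"
  by (simp add: unity_def power_mult_distrib)

lemma unity_divide: "z \<in> unity n \<Longrightarrow> w \<in> unity n \<Longrightarrow> z / w \<in> unity n"
  by (simp add: unity_def power_divide)

lemma divide_in_unity: "u ^ n = v ^ n \<Longrightarrow> v \<noteq> 0 \<Longrightarrow> u / v \<in> unity n"
  by (simp add: unity_def power_divide)

text \<open>The homogenized factorization of \<open>X^n - 1\<close>: both sides are monic of degree
  \<open>n\<close> and agree at the \<open>n\<close> roots of unity. The case \<open>v = 0\<close>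
  is separate because dehomogenizing divides by \<open>v\<close>.\<close>

lemma power_diff_eq_prod_unity:
  fixes u v :: complex
  assumes n: "n \<ge> 1"
  shows "u ^ n - v ^ n = (\<Prod>z\<in>unity n. u - z * v)"
proof (cases "v = 0")
  case True
  then show ?thesis using n by (simp add: card_unity[OF n] power_0_left)
next
  case False
  let ?p = "monom 1 n - 1 :: complex poly" and ?q = "\<Prod>z\<in>unity n. [:- z, 1:] :: complex poly"
  have dq: "degree ?q = n"
    by (subst degree_prod_eq_sum_degree) (auto simp: card_unity[OF n])
  have "lead_coeff ?q = 1" by (simp add: lead_coeff_prod)
  then have lq: "poly.coeff ?q n = 1" using dq by simp
  have "?p = ?q"
  proof (rule poly_eqI_degree_lead_coeff)
    show "poly.coeff ?p n = poly.coeff ?q n" using n by (simp add: lq)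
    show "card (unity n) \<ge> n" by (simp add: card_unity[OF n])
    show "degree ?p \<le> n" by (rule degree_diff_le) (auto simp: degree_monom_le)
    show "degree ?q \<le> n" using dq by simp
    show "poly ?p z = poly ?q z" if "z \<in> unity n" for z
    proof -
      have "poly ?q z = 0" using that finite_unity[OF n] by (auto simp: poly_prod)
      then show ?thesis using that by (simp add: unity_def poly_monom)
    qed
  qed
  then have "poly ?p (u / v) = poly ?q (u / v)" by simp
  then have e: "(u / v) ^ n - 1 = (\<Prod>z\<in>unity n. u / v - z)"
    by (simp add: poly_monom poly_prod)
  have "u ^ n - v ^ n = v ^ n * ((u / v) ^ n - 1)"
    using False by (simp add: power_divide field_simps)
  also have "\<dots> = (\<Prod>z\<in>unity n. v * (u / v - z))"
    unfolding e prod.distrib by (simp add: card_unity[OF n])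
  also have "\<dots> = (\<Prod>z\<in>unity n. u - z * v)"
    using False by (intro prod.cong) (auto simp: field_simps)
  finally show ?thesis .
qed

section \<open>Points with four coordinates and the planes through them\<close>

lemma UNIV_eq4:
  fixes i j k l :: 4
  assumes "distinct [i, j, k, l]"
  shows "(UNIV :: 4 set) = {i, j, k, l}"
proof -
  have "{i, j, k, l} = (UNIV :: 4 set)"
    by (rule card_subset_eq) (use assms in auto)
  then show ?thesis by simp
qed

lemma cases4:
  fixes i j k l m :: 4
  assumes "distinct [i, j, k, l]"
  shows "m = i \<or> m = j \<or> m = k \<or> m = l"
  using UNIV_eq4[OF assms] by auto

lemma all4:
  assumes "distinct [i, j, k, l :: 4]"
  shows "(\<forall>m. Q m) \<longleftrightarrow> Q i \<and> Q j \<and> Q k \<and> Q l"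
  using cases4[OF assms] by metis

lemma dot4:
  assumes "distinct [i, j, k, l :: 4]"
  shows "dot a y = a $ i * y $ i + a $ j * y $ j + a $ k * y $ k + a $ l * y $ l"
  unfolding dot_def UNIV_eq4[OF assms] using assms by (simp add: add_ac)

definition vec4 :: "4 \<Rightarrow> 4 \<Rightarrow> 4 \<Rightarrow> complex \<Rightarrow> complex \<Rightarrow> complex \<Rightarrow> complex \<Rightarrow> complex ^ 4" where
  "vec4 i j k b c d e = (\<chi> m. if m = i then b else if m = j then c else if m = k then d else e)"

lemma vec4_nth:
  assumes "distinct [i, j, k, l]"
  shows "vec4 i j k b c d e $ i = b" "vec4 i j k b c d e $ j = c"
    "vec4 i j k b c d e $ k = d" "vec4 i j k b c d e $ l = e"
  using assms by (auto simp: vec4_def)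

lemma dot_vec4:
  assumes "distinct [i, j, k, l]"
  shows "dot a (vec4 i j k b c d e) = a $ i * b + a $ j * c + a $ k * d + a $ l * e"
  unfolding dot4[OF assms] vec4_nth[OF assms] ..

text \<open>The number of planes \<open>y_i = z y_j\<close>, with \<open>z\<close> an n-th root of
  unity, through the point: all \<open>n\<close> of them if both coordinates vanish, and otherwise
  at most one.\<close>

definition wt :: "nat \<Rightarrow> complex ^ 4 \<Rightarrow> 4 \<Rightarrow> 4 \<Rightarrow> nat" where
  "wt n y i j = (if y $ i ^ n = y $ j ^ n then if y $ j = 0 then n else 1 else 0)"

lemma card_wt:
  assumes n: "n \<ge> 1"
  shows "card {z \<in> unity n. y $ i = z * y $ j} = wt n y i j"
proof (cases "y $ j = 0")
  case True
  then show ?thesis using n card_unity[OF n] by (auto simp: wt_def power_0_left)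
next
  case False
  show ?thesis
  proof (cases "y $ i ^ n = y $ j ^ n")
    case True
    have "{z \<in> unity n. y $ i = z * y $ j} = {y $ i / y $ j}"
      using False divide_in_unity[OF True False] by (auto simp: field_simps)
    then show ?thesis using True False by (simp add: wt_def)
  next
    case ne: False
    then have "{z \<in> unity n. y $ i = z * y $ j} = {}"
      by (auto simp: unity_def power_mult_distrib)
    then have "card {z \<in> unity n. y $ i = z * y $ j} = 0" by (simp only: card.empty)
    then show ?thesis using ne by (simp add: wt_def)
  qed
qed

text \<open>A point lies on a plane of each of the three blocks if and only if three of the n-th powers of
  its coordinates agree.\<close>

definition tri :: "nat \<Rightarrow> complex ^ 4 \<Rightarrow> bool" where
  "tri n y \<longleftrightarrow> (\<exists>i j k. distinct [i, j, k] \<and> y $ i ^ n = y $ j ^ n \<and> y $ j ^ n = y $ k ^ n)"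

lemma tri_iff:
  assumes "distinct [i, j, k, l :: 4]"
  shows "tri n y \<longleftrightarrow> (y $ i ^ n = y $ j ^ n \<and> y $ j ^ n = y $ k ^ n) \<or> (y $ i ^ n = y $ j ^ n \<and> y $ j ^ n = y $ l ^ n)
    \<or> (y $ i ^ n = y $ k ^ n \<and> y $ k ^ n = y $ l ^ n) \<or> (y $ j ^ n = y $ k ^ n \<and> y $ k ^ n = y $ l ^ n)"
    (is "_ \<longleftrightarrow> ?R")
proof
  assume "tri n y"
  then obtain p q r where d: "p \<noteq> q" "q \<noteq> r" "p \<noteq> r" and e: "y $ p ^ n = y $ q ^ n" "y $ q ^ n = y $ r ^ n"
    by (auto simp: tri_def)
  then show ?R
    using cases4[OF assms, of p] cases4[OF assms, of q] cases4[OF assms, of r]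
    by (elim disjE; simp)
next
  assume ?R
  then show "tri n y"
  proof (elim disjE)
    assume "y $ i ^ n = y $ j ^ n \<and> y $ j ^ n = y $ k ^ n"
    then show ?thesis unfolding tri_def using assms by (intro exI[of _ i] exI[of _ j] exI[of _ k]) auto
  next
    assume "y $ i ^ n = y $ j ^ n \<and> y $ j ^ n = y $ l ^ n"
    then show ?thesis unfolding tri_def using assms by (intro exI[of _ i] exI[of _ j] exI[of _ l]) auto
  next
    assume "y $ i ^ n = y $ k ^ n \<and> y $ k ^ n = y $ l ^ n"
    then show ?thesis unfolding tri_def using assms by (intro exI[of _ i] exI[of _ k] exI[of _ l]) auto
  next
    assume "y $ j ^ n = y $ k ^ n \<and> y $ k ^ n = y $ l ^ n"
    then show ?thesis unfolding tri_def using assms by (intro exI[of _ j] exI[of _ k] exI[of _ l]) auto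
  qed
qed

text \<open>The blocks correspond to the three perfect matchings of four indices. One edge from each
  matching forms a triangle or a star, so the equalities of n-th powers connect at least three
  coordinates.\<close>

lemma wt_blocks_tri:
  assumes d: "distinct [i, j, k, l]" and n: "n \<ge> 1" and y: "y \<noteq> 0"
    and pos: "wt n y i j + wt n y k l > 0" "wt n y i k + wt n y j l > 0" "wt n y i l + wt n y j k > 0"
  shows "tri n y"
  unfolding tri_iff[OF d] using pos by (auto simp: wt_def split: if_splits)

text \<open>The multiplicity, the same in all three blocks, of a point in which three of the n-th powers agree.\<close>

definition tri_weight :: "nat \<Rightarrow> complex ^ 4 \<Rightarrow> nat" where
  "tri_weight n y = (if \<forall>i j. y $ i ^ n = y $ j ^ n then 2 else
     if \<exists>l. \<forall>i. i \<noteq> l \<longrightarrow> y $ i = 0 then n else 1)"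

text \<open>If all four powers agree, each pair of the block contributes one plane. If three
  coordinates vanish, one pair contributes \<open>n\<close> planes and the other none. In the
  remaining case exactly one pair contributes a single plane. \<open>tri_weight\<close> does not
  refer to the labelling, so the three blocks agree.\<close>

lemma wt_blocks_eq:
  assumes d: "distinct [i, j, k, l]" and n: "n \<ge> 1" and y: "y \<noteq> 0" and t: "tri n y"
  shows "wt n y i j + wt n y k l = tri_weight n y"
proof -
  have ex: "\<not> (y $ i = 0 \<and> y $ j = 0 \<and> y $ k = 0 \<and> y $ l = 0)"
    using y all4[OF d, of "\<lambda>m. y $ m = 0"] by (metis vec_eq_iff zero_index)
  have all: "(\<forall>i j. y $ i ^ n = y $ j ^ n) \<longleftrightarrow> (y $ i ^ n = y $ j ^ n \<and> y $ j ^ n = y $ k ^ n \<and> y $ k ^ n = y $ l ^ n)"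
    using all4[OF d, of "\<lambda>m. y $ m ^ n = y $ l ^ n"] by metis
  have one: "(\<exists>m. \<forall>i. i \<noteq> m \<longrightarrow> y $ i = 0) \<longleftrightarrow>
     (y $ j = 0 \<and> y $ k = 0 \<and> y $ l = 0) \<or> (y $ i = 0 \<and> y $ k = 0 \<and> y $ l = 0) \<or>
     (y $ i = 0 \<and> y $ j = 0 \<and> y $ l = 0) \<or> (y $ i = 0 \<and> y $ j = 0 \<and> y $ k = 0)" (is "?L \<longleftrightarrow> ?R")
  proof
    assume ?L
    then obtain m where "\<forall>i. i \<noteq> m \<longrightarrow> y $ i = 0" by blast
    then show ?R using cases4[OF d, of m] d by auto
  next
    assume ?R
    then show ?L using all4[OF d, of "\<lambda>m'. m' \<noteq> _ \<longrightarrow> y $ m' = 0"] by auto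
  qed
  have z: "x ^ n = 0 \<longleftrightarrow> x = 0" for x :: complex using n by simp
  show ?thesis
    using t ex n unfolding tri_weight_def all one tri_iff[OF d]
    by (cases "y $ i = 0"; cases "y $ j = 0"; cases "y $ k = 0"; cases "y $ l = 0")
      (auto simp: wt_def power_0_left)
qed

text \<open>A plane with equation \<open>a\<close> and parametrization \<open>P\<close>. The last
  assumption says that it is none of the planes \<open>y_i = z y_j\<close>, so that each of them
  cuts out a genuine line.\<close>

locale Q_trace =
  fixes n :: nat and P :: "complex ^ 3 ^ 4" and a :: "complex ^ 4"
  assumes n: "n \<ge> 1" and a_nz: "a \<noteq> 0" and inj_P: "inj ((*v) P)" and range_P: "range ((*v) P) = hyp a"
    and not_plane: "\<And>i j z. i \<noteq> j \<Longrightarrow> z \<in> unity n \<Longrightarrow> \<exists>y\<in>hyp a. y $ i \<noteq> z * y $ j"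
begin

definition ln :: "4 \<Rightarrow> 4 \<Rightarrow> complex \<Rightarrow> pline" where
  "ln i j z = hyp (P $ i - z *s P $ j)"

definition lift :: "complex ^ 4 \<Rightarrow> complex ^ 3" where
  "lift y = (SOME x. P *v x = y)"

definition ptH :: "complex ^ 4 \<Rightarrow> ppoint" where
  "ptH y = pt (lift y)"

definition blk :: "4 \<Rightarrow> 4 \<Rightarrow> 4 \<Rightarrow> 4 \<Rightarrow> pline multiset" where
  "blk i j k l = image_mset (ln i j) (mset_set (unity n)) + image_mset (ln k l) (mset_set (unity n))"

lemma P_nth: "(P *v x) $ i = dot (P $ i) x"
  by (simp add: matrix_vector_mult_def dot_def)

lemma mem_ln: "x \<in> ln i j z \<longleftrightarrow> (P *v x) $ i = z * (P *v x) $ j"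
  by (simp add: ln_def hyp_def P_nth dot_diff_left)

lemma P_lift: "y \<in> hyp a \<Longrightarrow> P *v lift y = y"
proof -
  assume "y \<in> hyp a"
  then have "\<exists>x. P *v x = y" unfolding range_P[symmetric] by blast
  then show ?thesis unfolding lift_def by (rule someI_ex)
qed

lemma lift_P: "lift (P *v x) = x"
  using P_lift[of "P *v x"] range_P inj_P by (metis injD rangeI)

lemma P_in_hyp: "P *v x \<in> hyp a"
  using range_P by blast

lemma P_zero_iff: "P *v x = 0 \<longleftrightarrow> x = 0"
  using inj_P by (metis injD matrix_vector_mult_0_right)

lemma is_line_ln: "i \<noteq> j \<Longrightarrow> z \<in> unity n \<Longrightarrow> is_line (ln i j z)"
proof -
  assume "i \<noteq> j" "z \<in> unity n"
  then obtain y where y: "y \<in> hyp a" "y $ i \<noteq> z * y $ j" using not_plane by blast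
  then have "lift y \<notin> ln i j z" by (simp add: mem_ln P_lift)
  then have "P $ i - z *s P $ j \<noteq> 0" by (auto simp: ln_def hyp_def)
  then show ?thesis unfolding ln_def by (rule is_line_hyp)
qed

lemma lift_nonzero: "y \<in> hyp a \<Longrightarrow> y \<noteq> 0 \<Longrightarrow> lift y \<noteq> 0"
  using P_lift P_zero_iff by metis

lemma is_point_ptH: "y \<in> hyp a \<Longrightarrow> y \<noteq> 0 \<Longrightarrow> is_point (ptH y)"
  unfolding ptH_def by (rule is_point_pt) (rule lift_nonzero)

lemma is_point_ptHE:
  assumes "is_point p"
  obtains y where "y \<in> hyp a" "y \<noteq> 0" "p = ptH y"
proof -
  obtain x where "x \<noteq> 0" "p = pt x" using assms by (rule is_pointE)
  then show thesis using that[of "P *v x"] P_in_hyp by (simp add: P_zero_iff ptH_def lift_P)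
qed

lemma ptH_eqD:
  assumes "y \<in> hyp a" "y' \<in> hyp a" "y \<noteq> 0" "ptH y = ptH y'"
  shows "\<exists>c. c \<noteq> 0 \<and> y' = c *s y"
proof -
  obtain c where "c \<noteq> 0" "lift y' = c *s lift y"
    using assms pt_eq_iff[OF lift_nonzero[OF assms(1,3)]] unfolding ptH_def by blast
  then have "P *v lift y' = c *s (P *v lift y)" by (simp add: vec.scale)
  then show ?thesis using assms P_lift \<open>c \<noteq> 0\<close> by auto
qed

lemma ptH_scale: "y \<in> hyp a \<Longrightarrow> y \<noteq> 0 \<Longrightarrow> c \<noteq> 0 \<Longrightarrow> ptH (c *s y) = ptH y"
proof -
  assume y: "y \<in> hyp a" "y \<noteq> 0" "c \<noteq> 0"
  have "lift (c *s y) = c *s lift y"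
    using lift_P[of "c *s lift y"] y by (simp add: vec.scale P_lift)
  then show ?thesis
    unfolding ptH_def using pt_eq_iff[OF lift_nonzero[OF y(1,2)]] y(3) by metis
qed

lemma ptH_ln: "y \<in> hyp a \<Longrightarrow> i \<noteq> j \<Longrightarrow> z \<in> unity n \<Longrightarrow> ptH y \<subseteq> ln i j z \<longleftrightarrow> y $ i = z * y $ j"
  unfolding ptH_def by (simp add: pt_subset_line is_line_ln mem_ln P_lift)

lemma ln_swap: "z \<in> unity n \<Longrightarrow> ln i j z = ln j i (1 / z)"
  using unity_nonzero[OF n] by (auto simp: mem_ln field_simps)

text \<open>Exchanging the two coordinates replaces \<open>z\<close> by its inverse, and inversion
  permutes the roots of unity.\<close>

lemma ln_image_swap: "image_mset (ln i j) (mset_set (unity n)) = image_mset (ln j i) (mset_set (unity n))"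
proof -
  have inj: "inj_on (\<lambda>z. 1 / z) (unity n)" by (auto simp: inj_on_def)
  have im: "(\<lambda>z. 1 / z) ` unity n = unity n"
  proof
    show "(\<lambda>z. 1 / z) ` unity n \<subseteq> unity n" by (auto simp: unity_def power_divide)
    show "unity n \<subseteq> (\<lambda>z. 1 / z) ` unity n"
    proof
      fix z assume "z \<in> unity n"
      then have "1 / z \<in> unity n" "z = 1 / (1 / z)" by (auto simp: unity_def power_divide)
      then show "z \<in> (\<lambda>z. 1 / z) ` unity n" by blast
    qed
  qed
  have "image_mset (ln j i) (mset_set (unity n)) = image_mset (ln j i) (image_mset (\<lambda>z. 1 / z) (mset_set (unity n)))"
    by (simp add: image_mset_mset_set[OF inj] im)
  also have "\<dots> = image_mset (\<lambda>z. ln j i (1 / z)) (mset_set (unity n))"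
    by (simp add: multiset.map_comp o_def)
  also have "\<dots> = image_mset (ln i j) (mset_set (unity n))"
    by (rule image_mset_cong) (use ln_swap finite_unity[OF n] in auto)
  finally show ?thesis by simp
qed

lemma blk_swap: "blk i j k l = blk j i k l" "blk i j k l = blk i j l k" "blk i j k l = blk k l i j"
  unfolding blk_def using ln_image_swap by (auto simp: add.commute)

definition blocks :: "pline multiset list" where
  "blocks = [blk 0 1 2 3, blk 0 2 1 3, blk 0 3 1 2]"

text \<open>Since the blocks are perfect matchings, every permutation of the coordinates permutes
  them; \<open>s1\<close>, \<open>s2\<close>, \<open>s3\<close> are the adjacent transpositions.
  Later arguments can therefore name the indices according to the vanishing coefficients of
  \<open>a\<close>.\<close>

lemma mset_blocks:
  assumes "distinct [i, j, k, l]"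
  shows "mset blocks = {#blk i j k l, blk i k j l, blk i l j k#}"
proof -
  define M where "M i j k l = {#blk i j k l, blk i k j l, blk i l j k#}" for i j k l
  have s1: "M i j k l = M j i k l" for i j k l
    unfolding M_def using blk_swap by (metis add_mset_commute)
  have s2: "M i j k l = M i k j l" for i j k l
    unfolding M_def using blk_swap by (metis add_mset_commute)
  have s3: "M i j k l = M i j l k" for i j k l
    unfolding M_def using blk_swap by (metis add_mset_commute)
  have s12: "M i j k l = M k j i l" for i j k l using s1 s2 by metis
  have s13: "M i j k l = M l j k i" for i j k l using s12 s3 by metis
  have s23: "M i j k l = M i l k j" for i j k l using s2 s3 by metis
  have d: "distinct [0, 1, 2, 3 :: 4]" by simp
  have "\<exists>j' k' l'. M i j k l = M 0 j' k' l' \<and> distinct [0, j', k', l']"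
    using cases4[OF assms, of 0] assms
  proof (elim disjE)
    assume "0 = i" then show ?thesis using assms by blast
  next
    assume "0 = j" then show ?thesis using assms s1[of i j k l] by (intro exI[of _ i] exI[of _ k] exI[of _ l]) auto
  next
    assume "0 = k" then show ?thesis using assms s12[of i j k l] by (intro exI[of _ j] exI[of _ i] exI[of _ l]) auto
  next
    assume "0 = l" then show ?thesis using assms s13[of i j k l] by (intro exI[of _ j] exI[of _ k] exI[of _ i]) auto
  qed
  then obtain j' k' l' where 1: "M i j k l = M 0 j' k' l'" "distinct [0, j', k', l']" by blast
  have "\<exists>k'' l''. M 0 j' k' l' = M 0 1 k'' l'' \<and> distinct [0, 1, k'', l'']"
    using cases4[OF 1(2), of 1]
  proof (elim disjE)
    assume "1 = (0 :: 4)" then show ?thesis by simp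
  next
    assume "1 = j'" then show ?thesis using 1(2) by blast
  next
    assume "1 = k'" then show ?thesis using 1(2) s2[of 0 j' k' l'] by (intro exI[of _ j'] exI[of _ l']) auto
  next
    assume "1 = l'" then show ?thesis using 1(2) s23[of 0 j' k' l'] by (intro exI[of _ k'] exI[of _ j']) auto
  qed
  then obtain k'' l'' where 2: "M 0 j' k' l' = M 0 1 k'' l''" "distinct [0, 1, k'', l'']" by blast
  have "(k'' = 2 \<and> l'' = 3) \<or> (k'' = 3 \<and> l'' = 2)"
    using cases4[OF d, of k''] cases4[OF d, of l''] 2(2) by auto
  then have "M 0 1 k'' l'' = M 0 1 2 3" using s3 by metis
  then show ?thesis using 1 2 by (simp add: M_def blocks_def)
qed

lemma thr_blk:
  assumes y: "y \<in> hyp a" and d: "i \<noteq> j" "k \<noteq> l"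
  shows "size {#L \<in># blk i j k l. ptH y \<subseteq> L#} = wt n y i j + wt n y k l"
proof -
  have "size {#L \<in># image_mset (ln i j) (mset_set (unity n)). ptH y \<subseteq> L#} = wt n y i j" if "i \<noteq> j" for i j
  proof -
    have "size {#L \<in># image_mset (ln i j) (mset_set (unity n)). ptH y \<subseteq> L#}
       = card {z \<in> unity n. ptH y \<subseteq> ln i j z}"
      by (simp add: filter_mset_image_mset finite_unity[OF n])
    also have "{z \<in> unity n. ptH y \<subseteq> ln i j z} = {z \<in> unity n. y $ i = z * y $ j}"
      using ptH_ln[OF y that] by blast
    finally show ?thesis using card_wt[OF n] by simp
  qed
  then show ?thesis using d by (simp add: blk_def)
qed

lemma size_blk: "size (blk i j k l) = 2 * n"
  by (simp add: blk_def card_unity[OF n])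

lemma set_blk: "set_mset (blk i j k l) = ln i j ` unity n \<union> ln k l ` unity n"
  by (simp add: blk_def finite_unity[OF n])

text \<open>When only \<open>a_i\<close> and \<open>a_j\<close> can be nonzero, the relation
  \<open>a_i z + a_j = 0\<close> would make the plane equal to \<open>y_i = z y_j\<close>.\<close>

lemma support2:
  assumes d: "distinct [i, j, k, l]" and z: "z \<in> unity n" and a: "a $ k = 0" "a $ l = 0"
  shows "a $ i * z + a $ j \<noteq> 0"
proof
  assume e: "a $ i * z + a $ j = 0"
  obtain y where y: "y \<in> hyp a" "y $ i \<noteq> z * y $ j" using not_plane[of i j z] d z by auto
  have "a $ i * y $ i + a $ j * y $ j = 0" using y(1) a by (simp add: hyp_def dot4[OF d])
  moreover have "a $ j = - (a $ i * z)" using e by (simp add: eq_neg_iff_add_eq_0 add.commute)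
  ultimately have "a $ i * (y $ i - z * y $ j) = 0" by (simp add: algebra_simps)
  then have "a $ i = 0" using y(2) by simp
  then have "a = 0" using e a all4[OF d, of "\<lambda>m. a $ m = 0"] by (auto simp: vec_eq_iff)
  then show False using a_nz by simp
qed

end

section \<open>Counting tools and types of points\<close>

lemma card_set_mset_le_size: "card (set_mset M) \<le> size M"
  by (induction M) (auto simp: card_insert_if)

lemma ex_unity_ne_1:
  assumes "n \<ge> 2"
  shows "\<exists>z\<in>unity n. z \<noteq> 1"
proof (rule ccontr)
  assume "\<not> ?thesis"
  then have "unity n \<subseteq> {1}" by blast
  then have "card (unity n) \<le> card {1 :: complex}" by (intro card_mono) auto
  then show False using card_unity[of n] assms by simp
qed

lemma ex_other_two:
  assumes "i \<noteq> (j :: 4)"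
  shows "\<exists>k l. distinct [i, j, k, l]"
proof -
  have "card (UNIV - {i, j}) = 2" using assms by (simp add: card_Diff_subset)
  then obtain k l where "UNIV - {i, j} = {k, l}" "k \<noteq> l" by (meson card_2_iff)
  then have "distinct [i, j, k, l]" using assms by auto
  then show ?thesis by blast
qed

lemma sum_disjoint_families_le:
  fixes f :: "'a \<Rightarrow> int"
  assumes "finite S" "\<And>p. p \<in> S \<Longrightarrow> f p \<ge> 0" "\<And>T. T \<in> set Ts \<Longrightarrow> T \<subseteq> S"
    "sorted_wrt (\<lambda>T T'. T \<inter> T' = {}) Ts"
  shows "(\<Sum>T\<leftarrow>Ts. sum f T) \<le> sum f S"
proof -
  have "(\<Sum>T\<leftarrow>Ts. sum f T) = sum f (\<Union>(set Ts))"
    using assms(3,4)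
  proof (induction Ts)
    case Nil
    then show ?case by simp
  next
    case (Cons T Ts)
    have "finite T" "finite (\<Union>(set Ts))"
      using Cons.prems(1) assms(1) by (meson finite_subset Sup_le_iff list.set_intros)+
    moreover have "T \<inter> \<Union>(set Ts) = {}" using Cons.prems(2) by auto
    ultimately have "sum f (T \<union> \<Union>(set Ts)) = sum f T + sum f (\<Union>(set Ts))"
      by (rule sum.union_disjoint)
    then show ?case using Cons by simp
  qed
  also have "\<dots> \<le> sum f S" by (rule sum_mono2) (use assms in auto)
  finally show ?thesis .
qed

definition homog_pred :: "(complex ^ 4 \<Rightarrow> bool) \<Rightarrow> bool" where
  "homog_pred \<Phi> \<longleftrightarrow> (\<forall>c y. c \<noteq> 0 \<longrightarrow> \<Phi> y \<longrightarrow> \<Phi> (c *s y))"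

definition all_eq :: "nat \<Rightarrow> complex ^ 4 \<Rightarrow> bool" where
  "all_eq n y \<longleftrightarrow> (\<forall>i j. y $ i ^ n = y $ j ^ n)"

lemma all_eq_nonzero:
  assumes n: "n \<ge> 1" and y: "y \<noteq> 0" "all_eq n y"
  shows "y $ m \<noteq> 0"
proof
  assume "y $ m = 0"
  then have "\<forall>m'. y $ m' ^ n = 0" using y(2) n by (metis all_eq_def power_0_left not_one_le_zero)
  then have "y = 0" using n by (simp add: vec_eq_iff)
  then show False using y(1) by simp
qed

text \<open>The intersection points of the lines \<open>y i = z (y j)\<close> and \<open>y k = w (y l)\<close> of one block that lie
  outside the base.\<close>

definition grid_pred :: "nat \<Rightarrow> 4 \<Rightarrow> 4 \<Rightarrow> 4 \<Rightarrow> 4 \<Rightarrow> complex ^ 4 \<Rightarrow> bool" where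
  "grid_pred n i j k l y \<longleftrightarrow> y $ i ^ n = y $ j ^ n \<and> y $ k ^ n = y $ l ^ n \<and> y $ i ^ n \<noteq> y $ k ^ n
     \<and> y $ i \<noteq> 0 \<and> y $ j \<noteq> 0 \<and> y $ k \<noteq> 0 \<and> y $ l \<noteq> 0"

definition centre_pred :: "4 \<Rightarrow> 4 \<Rightarrow> 4 \<Rightarrow> 4 \<Rightarrow> complex ^ 4 \<Rightarrow> bool" where
  "centre_pred i j k l y \<longleftrightarrow> y $ i = 0 \<and> y $ j = 0 \<and> y $ k \<noteq> 0 \<and> y $ l \<noteq> 0"

lemma homog_pred_grid: "homog_pred (grid_pred n i j k l)"
  and homog_pred_centre: "homog_pred (centre_pred i j k l)"
  by (auto simp: homog_pred_def grid_pred_def centre_pred_def power_mult_distrib)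

text \<open>\<open>G\<close> is the multiset of lines of the common factor. It is the same for the
  three blocks, and removing it from the trace leaves the multinet.\<close>

locale induced = Q_trace n P a + multinet W 3 d A
  for n P a W d A +
  fixes G :: "pline multiset"
  assumes blocks_eq: "\<And>b. b < 3 \<Longrightarrow> blocks ! b = A ! b + G"
begin

lemma blocks_nth:
  assumes "b < 3"
  shows "\<exists>i j k l. distinct [i, j, k, l] \<and> blocks ! b = blk i j k l"
proof -
  have "distinct [0, 1, 2, 3 :: 4]" "distinct [0, 2, 1, 3 :: 4]" "distinct [0, 3, 1, 2 :: 4]" by auto
  moreover have "blocks ! b \<in> {blk 0 1 2 3, blk 0 2 1 3, blk 0 3 1 2}"
    using assms by (auto simp: blocks_def less_Suc_eq numeral_3_eq_3)
  ultimately show ?thesis by blast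
qed

lemma blk_in_blocks:
  assumes "distinct [i, j, k, l]"
  shows "\<exists>b<3. blocks ! b = blk i j k l"
proof -
  have "blk i j k l \<in># mset blocks" using mset_blocks[OF assms] by simp
  then have "blk i j k l \<in> set blocks" by simp
  moreover have "length blocks = 3" by (simp add: blocks_def)
  ultimately show ?thesis by (metis in_set_conv_nth)
qed

lemma G_subset_blk: "distinct [i, j, k, l] \<Longrightarrow> L \<in># G \<Longrightarrow> L \<in># blk i j k l"
  using blk_in_blocks[of i j k l] blocks_eq by (metis union_iff)

lemma size_G: "size G + d = 2 * n"
proof -
  have "size (blocks ! 0) = size (A ! 0) + size G" using blocks_eq[of 0] by simp
  then show ?thesis using size_blk size_block[of 0] by (simp add: blocks_def)
qed

lemma tri_of_all_blocks:
  assumes y: "y \<in> hyp a" "y \<noteq> 0" and b: "\<And>b. b < 3 \<Longrightarrow> \<exists>L\<in>#blocks ! b. ptH y \<subseteq> L"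
  shows "tri n y"
proof -
  have pos: "wt n y i j + wt n y k l > 0" if d: "distinct [i, j, k, l]" for i j k l
  proof -
    obtain L where "L \<in># blk i j k l" "ptH y \<subseteq> L" using blk_in_blocks[OF d] b by metis
    then have "L \<in># {#L \<in># blk i j k l. ptH y \<subseteq> L#}" by simp
    then have "size {#L \<in># blk i j k l. ptH y \<subseteq> L#} > 0"
      by (metis empty_not_add_mset multi_member_split nonempty_has_size)
    then show ?thesis using thr_blk[OF y(1)] d by simp
  qed
  have d: "distinct [0, 1, 2, 3 :: 4]" by simp
  show ?thesis using wt_blocks_tri[OF d n y(2)] pos[of 0 1 2 3] pos[of 0 2 1 3] pos[of 0 3 1 2] by simp
qed

text \<open>A line of the common factor occurs in all three blocks of the trace, so each point on it
  lies on planes of all three.\<close>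

lemma G_tri:
  assumes "L \<in># G" "y \<in> hyp a" "y \<noteq> 0" "ptH y \<subseteq> L"
  shows "tri n y"
  by (rule tri_of_all_blocks[OF assms(2,3)]) (use assms blocks_eq in auto)

lemma base_locus_line:
  assumes "p \<in> base_locus W" "b < 3"
  shows "\<exists>L\<in>#A ! b. p \<subseteq> L"
proof -
  obtain c where "c < (3 :: nat)" "c \<noteq> b" by (metis less_numeral_extra(1) numeral_3_eq_3 zero_less_Suc one_neq_zero One_nat_def Suc_less_eq)
  then show ?thesis using base_locus_eq[of b c] assms by auto
qed

lemma base_locus_tri:
  assumes "y \<in> hyp a" "y \<noteq> 0" "ptH y \<in> base_locus W"
  shows "tri n y"
proof (rule tri_of_all_blocks[OF assms(1,2)])
  fix b :: nat assume "b < 3"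
  then show "\<exists>L\<in>#blocks ! b. ptH y \<subseteq> L"
    using base_locus_line[OF assms(3)] blocks_eq by (metis union_iff)
qed

lemma thr_base:
  assumes y: "y \<in> hyp a" "y \<noteq> 0" "tri n y" and b: "b < 3"
  shows "size {#L \<in># A ! b. ptH y \<subseteq> L#} + size {#L \<in># G. ptH y \<subseteq> L#} = tri_weight n y"
proof -
  obtain i j k l where d: "distinct [i, j, k, l]" "blocks ! b = blk i j k l" using blocks_nth[OF b] by blast
  have "size {#L \<in># blocks ! b. ptH y \<subseteq> L#} = tri_weight n y"
    using thr_blk[OF y(1), of i j k l] wt_blocks_eq[OF d(1) n y(2,3)] d by simp
  then show ?thesis using blocks_eq[OF b] by simp
qed

lemma thr_base_eq:
  assumes "p \<in> base_locus W"
  shows "size {#L \<in># A ! 1. p \<subseteq> L#} = size {#L \<in># A ! 0. p \<subseteq> L#}"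
proof -
  have "is_point p" using assms by (auto simp: base_locus_def)
  then obtain y where y: "y \<in> hyp a" "y \<noteq> 0" "p = ptH y" by (rule is_point_ptHE)
  then have "tri n y" using base_locus_tri assms by blast
  then show ?thesis using thr_base[OF y(1,2), of 0] thr_base[OF y(1,2), of 1] y(3) by simp
qed

lemma base_mult_tri:
  assumes "y \<in> hyp a" "y \<noteq> 0" "ptH y \<in> base_locus W"
  shows "base_mult A (ptH y) + size {#L \<in># G. ptH y \<subseteq> L#} = tri_weight n y"
proof -
  have "A ! 0 = hd A" using length_A by (cases A) auto
  then show ?thesis using thr_base[OF assms(1,2) base_locus_tri[OF assms], of 0] by (simp add: base_mult_eq)
qed

lemma base_mult_pos: "p \<in> base_locus W \<Longrightarrow> base_mult A p \<ge> 1"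
proof -
  assume "p \<in> base_locus W"
  then obtain L where L: "L \<in># A ! 0" "p \<subseteq> L" using base_locus_line[of p 0] by auto
  have "A ! 0 = hd A" using length_A by (cases A) auto
  then have "L \<in># {#L \<in># hd A. p \<subseteq> L#}" using L by simp
  then have "size {#L \<in># hd A. p \<subseteq> L#} > 0"
    by (metis empty_not_add_mset multi_member_split nonempty_has_size)
  then show ?thesis by (simp add: base_mult_eq)
qed

section \<open>Lines of the trace and intersection points off the base\<close>

definition trace_lines :: "pline set" where
  "trace_lines = {ln i j z | i j z. i \<noteq> j \<and> z \<in> unity n}"

lemma trace_linesI: "i \<noteq> j \<Longrightarrow> z \<in> unity n \<Longrightarrow> ln i j z \<in> trace_lines"
  by (auto simp: trace_lines_def)

lemma trace_line_is_line: "L \<in> trace_lines \<Longrightarrow> is_line L"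
  by (auto simp: trace_lines_def is_line_ln)

lemma lines_of_trace_lines: "lines_of A \<subseteq> trace_lines"
proof
  fix L assume "L \<in> lines_of A"
  then obtain b where b: "b < 3" "L \<in># A ! b"
    unfolding lines_of_def using length_A by (metis UN_E in_set_conv_nth)
  then have "L \<in># blocks ! b" using blocks_eq by simp
  then show "L \<in> trace_lines" using blocks_nth[OF b(1)] by (auto simp: set_blk intro: trace_linesI)
qed

text \<open>At a point that is not \<open>tri\<close> no line is lost when the common factor is
  divided out. Lower bounds for the number of lines through such points can thus be read off from
  the trace.\<close>

lemma trace_line_in_A:
  assumes "L \<in> trace_lines" "y \<in> hyp a" "y \<noteq> 0" "ptH y \<subseteq> L" "\<not> tri n y"
  shows "L \<in> lines_of A"
proof -
  obtain i j z where L: "L = ln i j z" "i \<noteq> j" "z \<in> unity n" using assms(1) by (auto simp: trace_lines_def)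
  obtain k l where "distinct [i, j, k, l]" using ex_other_two[OF L(2)] by blast
  then obtain b where b: "b < 3" "blocks ! b = blk i j k l" using blk_in_blocks by blast
  then have "L \<in># blocks ! b" using L by (simp add: set_blk)
  moreover have "L \<notin># G" using G_tri assms by blast
  ultimately have "L \<in># A ! b" using blocks_eq[OF b(1)] by simp
  then show ?thesis unfolding lines_of_def using b(1) length_A by (metis UN_I nth_mem)
qed

lemma num_lines_lower:
  assumes y: "y \<in> hyp a" "y \<noteq> 0" "\<not> tri n y" and S: "S \<subseteq> trace_lines" "\<And>L. L \<in> S \<Longrightarrow> ptH y \<subseteq> L"
  shows "card S \<le> num_lines_through A (ptH y)"
  unfolding num_lines_through_def
proof (rule card_mono)
  show "finite {l \<in> lines_of A. ptH y \<subseteq> l}" using finite_lines_of by simp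
  show "S \<subseteq> {l \<in> lines_of A. ptH y \<subseteq> l}" using trace_line_in_A[OF _ y(1,2) _ y(3)] S by blast
qed

lemma other_pointsI:
  assumes y: "y \<in> hyp a" "y \<noteq> 0" "\<not> tri n y" and L: "L \<in> trace_lines" "L' \<in> trace_lines" "L \<noteq> L'"
    "ptH y \<subseteq> L" "ptH y \<subseteq> L'"
  shows "ptH y \<in> other_points (base_locus W) A"
proof -
  have "lift y \<in> L" "lift y \<in> L'" using L(4,5) mem_pt_self[of "lift y"] unfolding ptH_def by blast+
  then have "L \<inter> L' = pt (lift y)"
    using lines_meet[OF trace_line_is_line[OF L(1)] trace_line_is_line[OF L(2)] L(3) lift_nonzero[OF y(1,2)]] by blast
  then have "ptH y = L \<inter> L'" by (simp add: ptH_def)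
  moreover have "L \<in> lines_of A" "L' \<in> lines_of A" using trace_line_in_A y L by blast+
  moreover have "ptH y \<notin> base_locus W" using base_locus_tri y by blast
  ultimately show ?thesis unfolding other_points_def using L(3) by blast
qed

lemma num_lines_ge_2:
  assumes "p \<in> other_points X A"
  shows "num_lines_through A p \<ge> 2"
proof -
  obtain L L' where L: "L \<in> lines_of A" "L' \<in> lines_of A" "L \<noteq> L'" "p = L \<inter> L'"
    using assms by (auto simp: other_points_def)
  have "card {L, L'} \<le> num_lines_through A p"
    unfolding num_lines_through_def by (rule card_mono) (use L finite_lines_of in auto)
  then show ?thesis using L(3) by simp
qed

text \<open>The sum over the intersection points outside the base in the completeness condition is bounded
  from below by sums over disjoint families of such points.\<close>

definition family :: "(complex ^ 4 \<Rightarrow> bool) \<Rightarrow> ppoint set" where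
  "family \<Phi> = {p \<in> other_points (base_locus W) A. \<exists>y\<in>hyp a. y \<noteq> 0 \<and> p = ptH y \<and> \<Phi> y}"

definition excess :: "(complex ^ 4 \<Rightarrow> bool) \<Rightarrow> int" where
  "excess \<Phi> = (\<Sum>p\<in>family \<Phi>. int (num_lines_through A p) - 1)"

lemma finite_family: "finite (family \<Phi>)"
  by (rule finite_subset[OF _ finite_other_points]) (auto simp: family_def)

lemma card_family_le_excess: "int (card (family \<Phi>)) \<le> excess \<Phi>"
proof -
  have "(\<Sum>p\<in>family \<Phi>. 1) \<le> excess \<Phi>"
    unfolding excess_def by (rule sum_mono) (use num_lines_ge_2 in \<open>fastforce simp: family_def\<close>)
  then show ?thesis by simp
qed

text \<open>Homogeneity makes a predicate independent of the representative of a point, so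
  predicates that exclude each other on vectors define disjoint families of points.\<close>

lemma excess_list_le:
  assumes hp: "\<And>\<Phi>. \<Phi> \<in> set \<Phi>s \<Longrightarrow> homog_pred \<Phi>" and dis: "sorted_wrt (\<lambda>\<Phi> \<Psi>. \<forall>y. \<not> (\<Phi> y \<and> \<Psi> y)) \<Phi>s"
  shows "(\<Sum>\<Phi>\<leftarrow>\<Phi>s. excess \<Phi>) \<le> (\<Sum>p\<in>other_points (base_locus W) A. int (num_lines_through A p) - 1)"
proof -
  have disj: "family \<Phi> \<inter> family \<Psi> = {}" if "homog_pred \<Phi>" "\<forall>y. \<not> (\<Phi> y \<and> \<Psi> y)" for \<Phi> \<Psi>
  proof (rule ccontr)
    assume "family \<Phi> \<inter> family \<Psi> \<noteq> {}"
    then obtain y y' where y: "y \<in> hyp a" "y \<noteq> 0" "\<Phi> y" "y' \<in> hyp a" "\<Psi> y'" "ptH y = ptH y'"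
      by (auto simp: family_def)
    then obtain c where "c \<noteq> 0" "y' = c *s y" using ptH_eqD by blast
    then show False using that y by (auto simp: homog_pred_def)
  qed
  have "sorted_wrt (\<lambda>T T'. T \<inter> T' = {}) (map family \<Phi>s)"
    unfolding sorted_wrt_map using dis by (rule sorted_wrt_mono_rel[rotated]) (use disj hp in auto)
  then have "(\<Sum>T\<leftarrow>map family \<Phi>s. \<Sum>p\<in>T. int (num_lines_through A p) - 1)
     \<le> (\<Sum>p\<in>other_points (base_locus W) A. int (num_lines_through A p) - 1)"
    by (intro sum_disjoint_families_le finite_other_points) (use num_lines_ge_2 in \<open>fastforce simp: family_def\<close>)+
  then show ?thesis by (simp add: o_def excess_def)
qed

text \<open>If \<open>a_i\<close> and \<open>a_j\<close> are not both 0, this says that the line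
  \<open>y_i = z y_j\<close> contains the point \<open>y_k = y_l = 0\<close> of the plane, the
  centre of the opposite pencil.\<close>

definition coef_zero :: "4 \<Rightarrow> 4 \<Rightarrow> complex \<Rightarrow> bool" where
  "coef_zero i j z \<longleftrightarrow> a $ i * z + a $ j = 0"

definition num_coef :: "4 \<Rightarrow> 4 \<Rightarrow> nat" where
  "num_coef i j = card {z \<in> unity n. a $ i * z + a $ j \<noteq> 0}"

text \<open>The pairs for which the two lines meet in a base point.\<close>

definition bad_pairs :: "4 \<Rightarrow> 4 \<Rightarrow> 4 \<Rightarrow> 4 \<Rightarrow> (complex \<times> complex) set" where
  "bad_pairs i j k l = {(z, w). z \<in> unity n \<and> w \<in> unity n \<and> a $ i * z + a $ j \<noteq> 0 \<and> a $ k * w + a $ l \<noteq> 0 \<and>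
     (a $ k * w + a $ l) ^ n = (- (a $ i * z + a $ j)) ^ n}"

lemma ln_neq_opposite:
  assumes d: "distinct [i, j, k, l]" and z: "z \<in> unity n" "w \<in> unity n" and c: "a $ i * z + a $ j \<noteq> 0"
  shows "ln i j z \<noteq> ln k l w"
proof
  assume e: "ln i j z = ln k l w"
  \<comment> \<open>This vector satisfies \<open>y_k = y_l = 0\<close> and therefore lies on every
    line of the opposite pencil.\<close>
  define y where "y = vec4 i j k (a $ j) (- a $ i) 0 0"
  have y: "y \<in> hyp a" by (simp add: y_def hyp_def dot_vec4[OF d])
  have "lift y \<in> ln k l w" using y by (simp add: mem_ln P_lift) (simp add: y_def vec4_nth[OF d])
  then have "lift y \<in> ln i j z" using e by simp
  then have "a $ j = z * (- a $ i)" using y by (simp add: mem_ln P_lift) (simp add: y_def vec4_nth[OF d])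
  then show False using c by simp
qed

text \<open>Points with \<open>y_i = z y_j\<close> and \<open>y_k = w y_l\<close> have the form
  \<open>(z v, v, w u, u)\<close>, and the equation of the plane becomes
  \<open>(a_i z + a_j) v + (a_k w + a_l) u = 0\<close>. The definition takes the solution
  \<open>v = a_k w + a_l\<close>, \<open>u = - (a_i z + a_j)\<close>.\<close>

definition grid_point :: "4 \<Rightarrow> 4 \<Rightarrow> 4 \<Rightarrow> 4 \<Rightarrow> complex \<times> complex \<Rightarrow> complex ^ 4" where
  "grid_point i j k l = (\<lambda>(z, w). vec4 i j k (z * (a $ k * w + a $ l)) (a $ k * w + a $ l)
      (- (w * (a $ i * z + a $ j))) (- (a $ i * z + a $ j)))"

lemma grid_point_nth:
  assumes d: "distinct [i, j, k, l]"
  shows "grid_point i j k l (z, w) $ i = z * (a $ k * w + a $ l)" "grid_point i j k l (z, w) $ j = a $ k * w + a $ l"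
    "grid_point i j k l (z, w) $ k = - (w * (a $ i * z + a $ j))" "grid_point i j k l (z, w) $ l = - (a $ i * z + a $ j)"
  by (simp_all add: grid_point_def vec4_nth[OF d])

lemma grid_point_hyp:
  assumes d: "distinct [i, j, k, l]"
  shows "grid_point i j k l (z, w) \<in> hyp a"
  by (simp add: grid_point_def hyp_def dot_vec4[OF d] algebra_simps)

lemma grid_point_inj:
  assumes d: "distinct [i, j, k, l]"
  shows "inj_on (\<lambda>q. ptH (grid_point i j k l q))
    {(z, w). a $ i * z + a $ j \<noteq> 0 \<and> a $ k * w + a $ l \<noteq> 0}"
proof (rule inj_onI, clarify)
  fix z w z' w'
  let ?y = "grid_point i j k l (z, w)" and ?y' = "grid_point i j k l (z', w')"
  assume nz: "a $ i * z + a $ j \<noteq> 0" "a $ k * w + a $ l \<noteq> 0" "a $ i * z' + a $ j \<noteq> 0" "a $ k * w' + a $ l \<noteq> 0"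
    and e: "ptH ?y = ptH ?y'"
  have "?y $ j \<noteq> 0" using nz by (simp add: grid_point_nth[OF d])
  then have "?y \<noteq> 0" by auto
  then obtain c where c: "c \<noteq> 0" "?y' = c *s ?y" using ptH_eqD grid_point_hyp[OF d] e by blast
  have s: "?y' $ m = c * ?y $ m" for m using c by simp
  have "z' * (a $ k * w' + a $ l) = c * (z * (a $ k * w + a $ l))" "a $ k * w' + a $ l = c * (a $ k * w + a $ l)"
    using s[of i] s[of j] by (simp_all only: grid_point_nth[OF d])
  moreover have "w' * (a $ i * z' + a $ j) = c * (w * (a $ i * z + a $ j))" "a $ i * z' + a $ j = c * (a $ i * z + a $ j)"
    using s[of k] s[of l] by (simp_all only: grid_point_nth[OF d] mult_minus_right neg_equal_iff_equal)
  ultimately have "z' * (c * (a $ k * w + a $ l)) = z * (c * (a $ k * w + a $ l))"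
     "w' * (c * (a $ i * z + a $ j)) = w * (c * (a $ i * z + a $ j))"
    by (simp_all add: mult_ac)
  then have "z' = z" "w' = w" using nz c(1) by (simp_all)
  then show "z = z' \<and> w = w'" by simp
qed

text \<open>A pair with both coefficients nonzero yields an intersection point without zero
  coordinates, and different pairs yield different points. Such a point is off the base unless all
  four n-th powers agree, which is what \<open>bad_pairs\<close> records; each remaining point
  contributes at least 1.\<close>

lemma grid_excess:
  assumes d: "distinct [i, j, k, l]"
  shows "int (num_coef i j) * int (num_coef k l) - int (card (bad_pairs i j k l)) \<le> excess (grid_pred n i j k l)"
proof -
  let ?all = "{z \<in> unity n. a $ i * z + a $ j \<noteq> 0} \<times> {w \<in> unity n. a $ k * w + a $ l \<noteq> 0}"
  let ?good = "?all - bad_pairs i j k l"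
  have fin: "finite ?all" using finite_unity[OF n] by auto
  have sub: "bad_pairs i j k l \<subseteq> ?all" by (auto simp: bad_pairs_def)
  have "card ?good = card ?all - card (bad_pairs i j k l)"
    by (rule card_Diff_subset) (use sub fin finite_subset in auto)
  moreover have "card (bad_pairs i j k l) \<le> card ?all" using sub fin by (rule card_mono[rotated])
  ultimately have c: "int (num_coef i j) * int (num_coef k l) - int (card (bad_pairs i j k l)) = int (card ?good)"
    by (simp add: num_coef_def card_cartesian_product)
  have "(\<lambda>q. ptH (grid_point i j k l q)) ` ?good \<subseteq> family (grid_pred n i j k l)"
  proof clarify
    fix z w assume z: "z \<in> unity n" "a $ i * z + a $ j \<noteq> 0" and w: "w \<in> unity n" "a $ k * w + a $ l \<noteq> 0"
      and nb: "(z, w) \<notin> bad_pairs i j k l"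
    let ?y = "grid_point i j k l (z, w)"
    have y: "?y \<in> hyp a" by (rule grid_point_hyp[OF d])
    have nz: "?y $ i \<noteq> 0" "?y $ j \<noteq> 0" "?y $ k \<noteq> 0" "?y $ l \<noteq> 0"
      unfolding grid_point_nth[OF d] neg_equal_0_iff_equal mult_eq_0_iff
      using z w unity_nonzero[OF n z(1)] unity_nonzero[OF n w(1)] by blast+
    have y0: "?y \<noteq> 0" using nz by auto
    have e: "?y $ i = z * ?y $ j" "?y $ k = w * ?y $ l"
      unfolding grid_point_nth[OF d] by (simp_all only: mult_minus_right)
    have p: "?y $ i ^ n = ?y $ j ^ n" "?y $ k ^ n = ?y $ l ^ n"
      unfolding e using z w by (simp_all add: power_mult_distrib unity_def)
    have ne: "?y $ j ^ n \<noteq> ?y $ l ^ n" using nb z w by (auto simp: bad_pairs_def grid_point_nth[OF d])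
    have gp: "grid_pred n i j k l ?y" using p ne nz by (simp add: grid_pred_def)
    have nt: "\<not> tri n ?y" unfolding tri_iff[OF d] using p ne by auto
    have "ptH ?y \<in> other_points (base_locus W) A"
    proof (rule other_pointsI[OF y y0 nt])
      show "ln i j z \<noteq> ln k l w" by (rule ln_neq_opposite[OF d z(1) w(1) z(2)])
    qed (use d z w y e in \<open>simp_all add: trace_linesI ptH_ln\<close>)
    then show "ptH ?y \<in> family (grid_pred n i j k l)" using y y0 gp by (auto simp: family_def)
  qed
  moreover have "inj_on (\<lambda>q. ptH (grid_point i j k l q)) ?good"
    by (rule inj_on_subset[OF grid_point_inj[OF d]]) auto
  ultimately have "card ?good \<le> card (family (grid_pred n i j k l))"
    using card_inj_on_le finite_family by blast
  then show ?thesis using c card_family_le_excess[of "grid_pred n i j k l"] by linarith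
qed

lemma ln_neq_same:
  assumes d: "distinct [i, j, k, l]" and z: "z \<noteq> w" and c: "a $ k \<noteq> 0 \<or> a $ l \<noteq> 0"
  shows "ln i j z \<noteq> ln i j w"
proof
  assume e: "ln i j z = ln i j w"
  define y where "y = (if a $ k \<noteq> 0 then vec4 i j k z 1 (- (a $ i * z + a $ j) / a $ k) 0
      else vec4 i j k z 1 0 (- (a $ i * z + a $ j) / a $ l))"
  have y: "y \<in> hyp a" using c by (simp add: y_def hyp_def dot_vec4[OF d])
  have v: "y $ i = z" "y $ j = 1" by (simp_all add: y_def vec4_nth[OF d])
  have "lift y \<in> ln i j z" using y by (simp add: mem_ln P_lift v)
  then have "lift y \<in> ln i j w" using e by simp
  then show False using z y by (simp add: mem_ln P_lift v)
qed

text \<open>The centre of the pencil \<open>y_i = z y_j\<close> carries the \<open>n\<close> lines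
  of the pencil, and one more if a line of the opposite pencil passes through it. The condition on
  the pair \<open>i, j\<close> ensures that this extra line is not itself a line of the
  pencil.\<close>

lemma centre_excess:
  assumes d: "distinct [i, j, k, l]" and n2: "n \<ge> 2" and a: "a $ k \<noteq> 0" "a $ l \<noteq> 0"
  shows "int n - 1 + of_bool ((\<exists>w\<in>unity n. coef_zero k l w) \<and> \<not> (\<exists>z\<in>unity n. coef_zero i j z))
    \<le> excess (centre_pred i j k l)"
proof -
  define y where "y = vec4 i j k 0 0 (a $ l) (- a $ k)"
  have y: "y \<in> hyp a" by (simp add: y_def hyp_def dot_vec4[OF d])
  have v: "y $ i = 0" "y $ j = 0" "y $ k = a $ l" "y $ l = - a $ k" by (simp_all add: y_def vec4_nth[OF d])
  have y0: "y \<noteq> 0" using v a by auto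
  have nt: "\<not> tri n y" unfolding tri_iff[OF d] v using a n by (auto simp: power_0_left)
  define S where "S = ln i j ` unity n \<union> {ln k l w | w. w \<in> unity n \<and> coef_zero k l w \<and> \<not> (\<exists>z\<in>unity n. coef_zero i j z)}"
  have inj: "inj_on (ln i j) (unity n)" using ln_neq_same[OF d] a by (auto simp: inj_on_def)
  then have c0: "card (ln i j ` unity n) = n" by (simp add: card_image card_unity[OF n])
  have S_tr: "S \<subseteq> trace_lines" using d by (auto simp: S_def trace_linesI)
  have S_y: "ptH y \<subseteq> L" if LS: "L \<in> S" for L
  proof -
    consider z where "z \<in> unity n" "L = ln i j z" | w where "w \<in> unity n" "L = ln k l w" "coef_zero k l w"
      using LS by (auto simp: S_def)
    then show ?thesis
    proof cases
      case 1
      then show ?thesis using ptH_ln[OF y, of i j z] d v by simp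
    next
      case 2
      have "a $ l = w * (- a $ k)" using 2(3) by (simp add: coef_zero_def add_eq_0_iff mult.commute)
      then show ?thesis using ptH_ln[OF y, of k l w] 2 d v by simp
    qed
  qed
  have "finite {ln k l w | w. w \<in> unity n \<and> coef_zero k l w \<and> \<not> (\<exists>z\<in>unity n. coef_zero i j z)}"
    by (rule finite_subset[of _ "ln k l ` unity n"]) (auto simp: finite_unity[OF n])
  then have fS: "finite S" by (simp add: S_def finite_unity[OF n])
  have cS: "int n + of_bool ((\<exists>w\<in>unity n. coef_zero k l w) \<and> \<not> (\<exists>z\<in>unity n. coef_zero i j z)) \<le> int (card S)"
  proof (cases "(\<exists>w\<in>unity n. coef_zero k l w) \<and> \<not> (\<exists>z\<in>unity n. coef_zero i j z)")
    case True
    then obtain w where w: "w \<in> unity n" "coef_zero k l w" by blast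
    have "ln k l w \<notin> ln i j ` unity n"
      using ln_neq_opposite[OF d _ w(1)] True by (force simp: coef_zero_def)
    then have "card (insert (ln k l w) (ln i j ` unity n)) = Suc n" using c0 finite_unity[OF n] by simp
    moreover have "insert (ln k l w) (ln i j ` unity n) \<subseteq> S" using True w by (auto simp: S_def)
    ultimately have "Suc n \<le> card S" using card_mono[OF fS] by metis
    then show ?thesis using True by simp
  next
    case False
    have "card (ln i j ` unity n) \<le> card S" by (rule card_mono[OF fS]) (auto simp: S_def)
    then show ?thesis using False c0 by auto
  qed
  have le: "card S \<le> num_lines_through A (ptH y)" by (rule num_lines_lower[OF y y0 nt S_tr S_y])
  \<comment> \<open>Two lines of the pencil are needed to make the centre an intersection point;
    here \<open>n \<ge> 2\<close> enters.\<close>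
  obtain z where z: "z \<in> unity n" "z \<noteq> 1" using ex_unity_ne_1[OF n2] by blast
  define L L' where "L = ln i j 1" and "L' = ln i j z"
  have L: "L \<in> S" "L' \<in> S" "L \<noteq> L'"
    using z one_in_unity inj by (auto simp: S_def L_def L'_def inj_on_def)
  have "ptH y \<in> other_points (base_locus W) A"
    by (rule other_pointsI[OF y y0 nt _ _ L(3)]) (use L S_tr S_y in auto)
  then have mem: "ptH y \<in> family (centre_pred i j k l)"
    using y y0 v a by (auto simp: family_def centre_pred_def)
  have "int (num_lines_through A (ptH y)) - 1 \<le> excess (centre_pred i j k l)"
    unfolding excess_def
    by (rule member_le_sum[OF mem]) (use num_lines_ge_2 finite_family in \<open>fastforce simp: family_def\<close>)+
  then show ?thesis using le cS by linarith
qed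

section \<open>Upper bounds for the multiplicities and the number of lines\<close>

definition common_points :: "ppoint set" where
  "common_points = {ptH y | y. y \<in> hyp a \<and> y \<noteq> 0 \<and> all_eq n y}"

definition gmult :: "ppoint \<Rightarrow> nat" where
  "gmult p = size {#L \<in># G. p \<subseteq> L#}"

definition coord_points :: "4 set" where
  "coord_points = {l. a $ l = 0 \<and> ptH (axis l 1) \<in> base_locus W}"

lemma axis_hyp: "axis l 1 \<in> hyp a \<longleftrightarrow> a $ l = 0"
  by (simp add: hyp_def dot_axis)

lemma axis1_nonzero: "axis l (1 :: complex) \<noteq> (0 :: complex ^ 4)"
  by (metis axis_nth zero_index zero_neq_one)

text \<open>At a base point the multiplicity is \<open>tri_weight\<close> minus the number of lines
  of \<open>G\<close> through it. The weight is 2 at points with four equal powers, \<open>n\<close>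
  at vertices of the tetrahedron and 1 elsewhere, and in the last case no line of \<open>G\<close>
  can pass through the point because the multiplicity is positive.\<close>

lemma sum_base_mult_le:
  "(\<Sum>p\<in>base_locus W. int (base_mult A p) - 1) \<le>
    (\<Sum>p\<in>base_locus W \<inter> common_points. 1 - int (gmult p)) +
    (\<Sum>l\<in>coord_points. int n - 1 - int (gmult (ptH (axis l 1))))"
proof -
  let ?X = "base_locus W" and ?e = "\<lambda>l. ptH (axis l 1)"
  have inj_e: "l = m" if lm: "l \<in> coord_points" "m \<in> coord_points" "?e l = ?e m" for l m
  proof -
    obtain c where c: "c \<noteq> 0" "axis m 1 = c *s (axis l 1 :: complex ^ 4)"
      using ptH_eqD[of "axis l 1" "axis m 1"] lm axis1_nonzero by (auto simp: coord_points_def axis_hyp)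
    have "(axis m 1 :: complex ^ 4) $ m = c * axis l 1 $ m" by (subst c(2)) simp
    then show ?thesis by (auto simp: axis_def split: if_splits)
  qed
  have pt: "int (base_mult A p) - 1 \<le> (if p \<in> common_points then 1 - int (gmult p) else 0) +
      (\<Sum>l\<in>coord_points. if p = ?e l then int n - 1 - int (gmult (?e l)) else 0)" (is "_ \<le> ?D + ?C") if p: "p \<in> ?X" for p
  proof -
    have "is_point p" using p by (auto simp: base_locus_def)
    then obtain y where y: "y \<in> hyp a" "y \<noteq> 0" "p = ptH y" by (rule is_point_ptHE)
    have b: "base_mult A p + gmult p = tri_weight n y" using base_mult_tri y p by (simp add: gmult_def)
    consider "all_eq n y" | "\<not> all_eq n y" "\<exists>l. \<forall>i. i \<noteq> l \<longrightarrow> y $ i = 0"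
      | "\<not> all_eq n y" "\<not> (\<exists>l. \<forall>i. i \<noteq> l \<longrightarrow> y $ i = 0)" by blast
    then show ?thesis
    proof cases
      case 1
      then have "p \<in> common_points" using y by (auto simp: common_points_def)
      moreover have "p \<noteq> ?e l" if l: "l \<in> coord_points" for l
      proof
        assume e: "p = ?e l"
        obtain c where c: "c \<noteq> 0" "y = c *s (axis l 1 :: complex ^ 4)"
          using ptH_eqD[of "axis l 1" y] l axis1_nonzero y e by (auto simp: coord_points_def axis_hyp)
        obtain m where "m \<noteq> l" by (metis zero_neq_one)
        then have "y $ l ^ n \<noteq> y $ m ^ n" using c n by (simp add: axis_def power_0_left)
        then show False using 1 by (auto simp: all_eq_def)
      qed
      then have "?C = 0" by (intro sum.neutral) auto
      moreover have "tri_weight n y = 2" using 1 by (simp add: tri_weight_def all_eq_def)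
      ultimately show ?thesis using b by simp
    next
      case 2
      then obtain l where l: "\<forall>i. i \<noteq> l \<longrightarrow> y $ i = 0" by blast
      have yl: "y $ l \<noteq> 0" using l y(2) by (metis vec_eq_iff zero_index)
      have ys: "axis l 1 = (1 / y $ l) *s y" using l yl by (simp add: vec_eq_iff axis_def)
      then have pe: "p = ?e l" using ptH_scale[OF y(1,2), of "1 / y $ l"] yl y(3) by simp
      have "axis l 1 \<in> hyp a" unfolding ys using y(1) by (simp add: hyp_def)
      then have lc: "l \<in> coord_points" using p pe by (simp add: coord_points_def axis_hyp)
      have "?C = (\<Sum>m\<in>coord_points. if m = l then int n - 1 - int (gmult (?e l)) else 0)"
        by (rule sum.cong) (use pe inj_e lc in auto)
      then have C: "?C = int n - 1 - int (gmult p)" using lc pe by simp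
      have "p \<notin> common_points"
      proof
        assume "p \<in> common_points"
        then obtain y' where y': "y' \<in> hyp a" "y' \<noteq> 0" "all_eq n y'" "p = ptH y'" by (auto simp: common_points_def)
        then obtain c where "c \<noteq> 0" "y' = c *s y" using ptH_eqD[OF y(1) y'(1) y(2)] y by blast
        then show False using y'(3) 2(1) by (auto simp: all_eq_def power_mult_distrib)
      qed
      moreover have "tri_weight n y = n" using 2 by (auto simp: tri_weight_def all_eq_def)
      ultimately show ?thesis using b C by simp
    next
      case 3
      then have "tri_weight n y = 1" by (auto simp: tri_weight_def all_eq_def)
      then have g: "gmult p = 0" "base_mult A p = 1" using b base_mult_pos[OF p] by auto
      have "0 \<le> ?C" using g n by (intro sum_nonneg) auto
      moreover have "0 \<le> ?D" using g by simp
      ultimately show ?thesis using g by simp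
    qed
  qed
  have "(\<Sum>p\<in>?X. int (base_mult A p) - 1) \<le> (\<Sum>p\<in>?X. (if p \<in> common_points then 1 - int (gmult p) else 0) +
      (\<Sum>l\<in>coord_points. if p = ?e l then int n - 1 - int (gmult (?e l)) else 0))"
    by (rule sum_mono) (rule pt)
  also have "\<dots> = (\<Sum>p\<in>?X \<inter> common_points. 1 - int (gmult p)) +
     (\<Sum>l\<in>coord_points. \<Sum>p\<in>?X. if p = ?e l then int n - 1 - int (gmult (?e l)) else 0)"
    unfolding sum.distrib sum.swap[of _ coord_points ?X] using finite_base_locus
    by (simp add: sum.inter_restrict)
  also have "(\<Sum>l\<in>coord_points. \<Sum>p\<in>?X. if p = ?e l then int n - 1 - int (gmult (?e l)) else 0)
     = (\<Sum>l\<in>coord_points. int n - 1 - int (gmult (?e l)))"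
    by (rule sum.cong[OF refl]) (use finite_base_locus in \<open>auto simp: coord_points_def\<close>)
  finally show ?thesis .
qed

lemma card_lines_of_le: "card (lines_of A) \<le> card (set_mset (A ! 0)) + card (set_mset (A ! 1)) + card (set_mset (A ! 2))"
proof -
  obtain x y z where "A = [x, y, z]"
    using length_A by (auto simp: numeral_3_eq_3 length_Suc_conv)
  then have "set A = {A ! 0, A ! 1, A ! 2}" by simp
  then have "lines_of A = set_mset (A ! 0) \<union> set_mset (A ! 1) \<union> set_mset (A ! 2)"
    by (auto simp: lines_of_def)
  then have "card (lines_of A) \<le> card (set_mset (A ! 0) \<union> set_mset (A ! 1)) + card (set_mset (A ! 2))"
    using card_Un_le by metis
  then show ?thesis using card_Un_le[of "set_mset (A ! 0)" "set_mset (A ! 1)"] by linarith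
qed

lemma card_lines_of_le_blk:
  assumes d: "distinct [i, j, k, l]"
  shows "card (lines_of A) \<le> card (set_mset (blk i j k l)) + card (set_mset (blk i k j l)) + card (set_mset (blk i l j k))"
proof -
  have le: "card (set_mset (A ! b)) \<le> card (set_mset (blocks ! b))" if "b < 3" for b
    using blocks_eq[OF that] by (intro card_mono) auto
  have "(\<Sum>B\<in>#mset blocks. card (set_mset B)) = card (set_mset (blk i j k l)) + card (set_mset (blk i k j l)) + card (set_mset (blk i l j k))"
    unfolding mset_blocks[OF d] by simp
  moreover have "(\<Sum>B\<in>#mset blocks. card (set_mset B)) = card (set_mset (blocks ! 0)) + card (set_mset (blocks ! 1)) + card (set_mset (blocks ! 2))"
    by (simp add: blocks_def)
  ultimately show ?thesis using card_lines_of_le le[of 0] le[of 1] le[of 2] by linarith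
qed

text \<open>Counting by the degree takes the removal of \<open>G\<close> into account, which the
  bound by the blocks of the trace does not.\<close>

lemma card_lines_of_le_degree: "card (lines_of A) \<le> 3 * d"
proof -
  have le: "card (set_mset (A ! b)) \<le> d" if "b < 3" for b
    using size_block[OF that] card_set_mset_le_size by metis
  then show ?thesis using card_lines_of_le le[of 0] le[of 1] le[of 2] by linarith
qed

end

section \<open>Roots of unity on a circle\<close>

lemma two_not_unity: "n \<ge> 1 \<Longrightarrow> (2 :: complex) ^ n \<noteq> 1"
proof
  assume n: "n \<ge> 1" and e: "(2 :: complex) ^ n = 1"
  have "norm ((2 :: complex) ^ n) = 1" using e by simp
  then have "(2 :: real) ^ n = 1" by (simp add: norm_power)
  then show False using n one_less_power[of "2 :: real" n] by simp
qed

definition sols :: "nat \<Rightarrow> complex \<Rightarrow> complex \<Rightarrow> complex \<Rightarrow> complex set" where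
  "sols n a b c = {z \<in> unity n. (a * z + b) ^ n = c ^ n}"

lemma finite_sols: "n \<ge> 1 \<Longrightarrow> finite (sols n a b c)"
  using finite_unity by (simp add: sols_def)

lemma norm_eq_of_power_eq: "n \<ge> 1 \<Longrightarrow> x ^ n = y ^ n \<Longrightarrow> norm (x :: complex) = norm y"
  by (metis le_numeral_extra(4) norm_ge_zero norm_power not_one_le_zero power_eq_imp_eq_base gr0I)

text \<open>The solutions lie on the unit circle and on the circle with centre - b / a and radius
  |c / a|.\<close>

lemma card_sols_le_2:
  assumes n: "n \<ge> 1" and ab: "a \<noteq> 0" "b \<noteq> 0"
  shows "card (sols n a b c) \<le> 2"
proof -
  \<comment> \<open>On the unit circle \<open>cnj z\<close> is the inverse of \<open>z\<close>;
    multiplying the equation of the second circle by \<open>z\<close> gives this quadratic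
    polynomial.\<close>
  let ?p = "[:cnj a * b, a * cnj a + b * cnj b - c * cnj c, a * cnj b:]"
  have p0: "?p \<noteq> 0" using ab by simp
  have "sols n a b c \<subseteq> {z. poly ?p z = 0}"
  proof
    fix z assume "z \<in> sols n a b c"
    then have z: "z ^ n = 1" "(a * z + b) ^ n = c ^ n" by (auto simp: sols_def unity_def)
    have "norm z = 1" using norm_eq_of_power_eq[OF n, of z 1] z by simp
    then have zc: "z * cnj z = 1" by (simp add: complex_norm_square[symmetric])
    have "norm (a * z + b) = norm c" using norm_eq_of_power_eq[OF n] z by blast
    then have "complex_of_real ((norm (a * z + b))\<^sup>2) = complex_of_real ((norm c)\<^sup>2)" by simp
    then have e: "(a * z + b) * cnj (a * z + b) = c * cnj c"
      unfolding complex_norm_square .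
    have "z * ((a * z + b) * (cnj a * cnj z + cnj b)) =
      z * (a * cnj a * (z * cnj z)) + a * cnj b * z * z + b * cnj a * (z * cnj z) + z * b * cnj b"
      by (simp add: algebra_simps)
    then have "z * (c * cnj c) = z * a * cnj a + a * cnj b * z * z + b * cnj a + z * b * cnj b"
      using e zc by (simp add: mult_ac)
    then show "z \<in> {z. poly ?p z = 0}" by (simp add: algebra_simps)
  qed
  then have "card (sols n a b c) \<le> card {z. poly ?p z = 0}"
    using poly_roots_finite[OF p0] by (intro card_mono) auto
  also have "\<dots> \<le> degree ?p" by (rule card_poly_roots_bound[OF p0])
  also have "\<dots> \<le> 2" by simp
  finally show ?thesis .
qed

text \<open>For \<open>n = 2\<close> two different solutions would be \<open>z\<close> and
  \<open>- z\<close>, but the two squares differ by \<open>4 a b z\<close>. The saving over the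
  circle bound is needed in the tight estimates for \<open>n = 2\<close>.\<close>

lemma card_sols_2_le_1:
  assumes ab: "a \<noteq> 0" "b \<noteq> 0"
  shows "card (sols 2 a b c) \<le> 1"
proof -
  have "z = w" if z: "z \<in> sols 2 a b c" and w: "w \<in> sols 2 a b c" for z w
  proof (rule ccontr)
    assume ne: "z \<noteq> w"
    have "z\<^sup>2 = w\<^sup>2" "z\<^sup>2 = 1" using z w by (auto simp: sols_def unity_def)
    then have "z = - w" "z \<noteq> 0" using ne power2_eq_iff[of z w] by auto
    then have zw: "w = - z" "z \<noteq> 0" by simp_all
    have "(a * z + b)\<^sup>2 = (a * w + b)\<^sup>2" using z w by (simp add: sols_def)
    then have "4 * (a * b * z) = 0" unfolding zw by (simp add: power2_eq_square algebra_simps)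
    then show False using zw ab by simp
  qed
  then show ?thesis by (simp add: card_le_Suc0_iff_eq finite_sols)
qed

text \<open>Different cube roots of unity satisfy \<open>x^2 + x y + y^2 = 0\<close>; equivalently,
  \<open>- (x + y)\<close> is the third root. The last identity converts differences into
  sums.\<close>

lemma cube_roots_sum_prod:
  assumes "x ^ 3 = 1" "y ^ 3 = 1" "x \<noteq> (y :: complex)"
  shows "x * y = (x + y)\<^sup>2" "(x + y) ^ 3 = - 1" "(x - y)\<^sup>2 = - 3 * (x + y)\<^sup>2"
proof -
  have "(x - y) * (x\<^sup>2 + x * y + y\<^sup>2) = x ^ 3 - y ^ 3"
    by (simp add: power2_eq_square power3_eq_cube algebra_simps)
  then have z: "x\<^sup>2 + x * y + y\<^sup>2 = 0" using assms by simp
  then show 1: "x * y = (x + y)\<^sup>2" by (simp add: power2_eq_square algebra_simps)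
  show "(x - y)\<^sup>2 = - 3 * (x + y)\<^sup>2"
  proof -
    have "(x - y)\<^sup>2 + 3 * (x + y)\<^sup>2 = 4 * (x\<^sup>2 + x * y + y\<^sup>2)"
      by (simp add: power2_eq_square algebra_simps)
    then show ?thesis using z by (simp add: eq_neg_iff_add_eq_0)
  qed
  have "(x + y) ^ 3 + 1 = (x ^ 3 - 1) * (- 1) + (2 * x + y) * (x\<^sup>2 + x * y + y\<^sup>2) - (1 - 1)"
    by (simp add: power2_eq_square power3_eq_cube algebra_simps)
  then show "(x + y) ^ 3 = - 1" using z assms by (simp add: eq_neg_iff_add_eq_0)
qed

text \<open>Two solutions \<open>x\<close>, \<open>y\<close> give cube roots of unity
  \<open>t\<close>, \<open>u\<close> with \<open>a x + b = c t\<close> and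
  \<open>a y + b = c u\<close> when \<open>c\<close> is nonzero. Squaring the difference of these
  equations gives \<open>a (x + y) = c (t + u)\<close> up to sign. The plus sign would force
  \<open>b = 0\<close>; the minus sign gives \<open>b = c (t + u)\<close>, and the cube of
  \<open>t + u\<close> is -1.\<close>

lemma card_sols_3_eq_2:
  assumes ab: "a \<noteq> 0" "b \<noteq> 0" and c: "card (sols 3 a b c) = 2"
  shows "(- c) ^ 3 = b ^ 3"
proof -
  obtain x y where xy: "sols 3 a b c = {x, y}" "x \<noteq> y" using c by (meson card_2_iff)
  then have x: "x ^ 3 = 1" "(a * x + b) ^ 3 = c ^ 3" and y: "y ^ 3 = 1" "(a * y + b) ^ 3 = c ^ 3"
    by (auto simp: sols_def unity_def)
  show ?thesis
  proof (cases "c = 0")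
    case True
    then have "a * x + b = 0" "a * y + b = 0" using x y by auto
    then have "a * x = a * y" by (metis add_right_cancel)
    then show ?thesis using ab xy by simp
  next
    case False
    define t u where "t = (a * x + b) / c" and "u = (a * y + b) / c"
    have t: "t ^ 3 = 1" "u ^ 3 = 1" using x y False by (simp_all add: t_def u_def power_divide)
    have e: "a * x + b = c * t" "a * y + b = c * u" using False by (simp_all add: t_def u_def)
    have tu: "t \<noteq> u"
    proof
      assume "t = u"
      then have "a * x = a * y" using e by (metis add_right_cancel)
      then show False using ab xy by simp
    qed
    have "a * (x - y) = (a * x + b) - (a * y + b)" by (simp add: algebra_simps)
    also have "\<dots> = c * (t - u)" unfolding e by (simp add: algebra_simps)
    finally have d: "a * (x - y) = c * (t - u)" .
    have "a * (x + y) + 2 * b = (a * x + b) + (a * y + b)" by (simp add: algebra_simps)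
    also have "\<dots> = c * (t + u)" unfolding e by (simp add: algebra_simps)
    finally have s: "a * (x + y) + 2 * b = c * (t + u)" .
    have "(a * (x - y))\<^sup>2 = (c * (t - u))\<^sup>2" using d by simp
    then have "a\<^sup>2 * (- 3 * (x + y)\<^sup>2) = c\<^sup>2 * (- 3 * (t + u)\<^sup>2)"
      by (simp only: power_mult_distrib cube_roots_sum_prod(3)[OF x(1) y(1) xy(2)] cube_roots_sum_prod(3)[OF t tu])
    then have "(a * (x + y))\<^sup>2 = (c * (t + u))\<^sup>2" by (simp add: power_mult_distrib)
    then have "a * (x + y) = c * (t + u) \<or> a * (x + y) = - (c * (t + u))" by (simp only: power2_eq_iff)
    then have "b = c * (t + u)" using s ab by auto
    then have "b ^ 3 = c ^ 3 * (t + u) ^ 3" by (simp add: power_mult_distrib)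
    then show ?thesis using cube_roots_sum_prod(2)[OF t tu] by simp
  qed
qed

section \<open>Fixed components\<close>

context induced
begin

text \<open>The first two powers are 1, and any three of the four coordinates include one of the
  first two and one of the last two.\<close>

lemma tri_vec4:
  assumes d: "distinct [i, j, k, l]" and z: "z \<in> unity n" and t: "tri n (vec4 i j k z 1 u v)"
  shows "u ^ n = 1 \<or> v ^ n = 1"
  using t z unfolding tri_iff[OF d] vec4_nth[OF d] by (auto simp: unity_def)

lemma G_line_tri:
  assumes d: "distinct [i, j, k, l]" and z: "z \<in> unity n" and L: "ln i j z \<in># G"
    and y: "y \<in> hyp a" "y \<noteq> 0" "y $ i = z * y $ j"
  shows "tri n y"
  using G_tri[OF L y(1,2)] ptH_ln[OF y(1), of i j z] d z y(3) by simp

text \<open>The last coordinate 2 of the test point is chosen such that its n-th power is not 1.\<close>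

lemma G_line_one_zero:
  assumes d: "distinct [i, j, k, l]" and z: "z \<in> unity n" and L: "ln i j z \<in># G"
    and ak: "a $ k \<noteq> 0" and al: "a $ l = 0"
  shows "(a $ i * z + a $ j) ^ n = (- a $ k) ^ n"
proof -
  let ?u = "- (a $ i * z + a $ j) / a $ k"
  let ?y = "vec4 i j k z 1 ?u 2"
  have "?y \<in> hyp a" using ak al by (simp add: hyp_def dot_vec4[OF d])
  moreover have "?y $ j \<noteq> 0" "?y $ i = z * ?y $ j" by (simp_all add: vec4_nth[OF d])
  moreover from this have "?y \<noteq> 0" by auto
  ultimately have "tri n ?y" using G_line_tri[OF d z L] by blast
  then have "?u ^ n = 1" using tri_vec4[OF d z] two_not_unity[OF n] by blast
  then have "(- (a $ i * z + a $ j)) ^ n = a $ k ^ n" using ak by (simp add: power_divide)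
  then show ?thesis by (metis minus_minus power_minus power_mult_distrib)
qed

text \<open>All points of a line \<open>y_i = z y_j\<close> of \<open>G\<close> are
  \<open>tri\<close>. If \<open>a_k\<close> and \<open>a_l\<close> are both nonzero, a generic point
  of the line violates this; if both vanish, \<open>(0, 0, 1, 1)\<close> does. So exactly one of
  them vanishes, and then \<open>a_i\<close> and \<open>a_j\<close> are nonzero, since otherwise the
  plane would belong to the arrangement.\<close>

lemma G_imp_one_zero:
  assumes "L \<in># G"
  shows "\<exists>s. a $ s = 0 \<and> (\<forall>m. m \<noteq> s \<longrightarrow> a $ m \<noteq> 0)"
proof -
  have d0: "distinct [0, 1, 2, 3 :: 4]" by simp
  have "L \<in># blk 0 1 2 3" using G_subset_blk[OF d0 assms] .
  then obtain i j z where L: "L = ln i j z" and ij: "i \<noteq> j" and z: "z \<in> unity n"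
    by (auto simp: set_blk)
  obtain k l where d: "distinct [i, j, k, l]" using ex_other_two[OF ij] by blast
  have LG: "ln i j z \<in># G" using assms L by simp
  have main: "\<exists>s. a $ s = 0 \<and> (\<forall>m. m \<noteq> s \<longrightarrow> a $ m \<noteq> 0)"
    if d: "distinct [i, j, k, l]" and ak: "a $ k \<noteq> 0" and al: "a $ l = 0" for k l
  proof -
    have e: "(a $ i * z + a $ j) ^ n = (- a $ k) ^ n" by (rule G_line_one_zero[OF d z LG ak al])
    \<comment> \<open>A root of unity by the power relation \<open>e\<close>; on the line it is the
      ratio of \<open>y_k\<close> to \<open>y_j\<close>.\<close>
    define w where "w = - (a $ i * z + a $ j) / a $ k"
    have w: "w \<in> unity n" "a $ k * w = - (a $ i * z + a $ j)"
      using e ak by (auto simp: w_def unity_def power_divide) (metis minus_minus power_minus power_mult_distrib minus_add_distrib add.commute uminus_add_conv_diff)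
    have "a $ i \<noteq> 0"
    proof
      assume "a $ i = 0"
      then show False using support2[of k j i l w] d w al by auto
    qed
    moreover have "a $ j \<noteq> 0"
    proof
      assume aj: "a $ j = 0"
      have "a $ k * (w / z) + a $ i = 0" using w(2) aj unity_nonzero[OF n z] by (simp add: field_simps)
      then show False using support2[of k i j l "w / z"] d unity_divide[OF w(1) z] al aj by auto
    qed
    ultimately have "\<forall>m. m \<noteq> l \<longrightarrow> a $ m \<noteq> 0" using ak all4[OF d, of "\<lambda>m. m \<noteq> l \<longrightarrow> a $ m \<noteq> 0"] by auto
    then show ?thesis using al by blast
  qed
  consider "a $ k \<noteq> 0" "a $ l = 0" | "a $ k = 0" "a $ l \<noteq> 0" | "a $ k = 0" "a $ l = 0" | "a $ k \<noteq> 0" "a $ l \<noteq> 0"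
    by blast
  then show ?thesis
  proof cases
    case 1
    then show ?thesis using main[OF d] by blast
  next
    case 2
    then show ?thesis using main[of l k] d by auto
  next
    case 3
    let ?y = "vec4 i j k 0 0 1 1"
    have "?y \<in> hyp a" using 3 by (simp add: hyp_def dot_vec4[OF d])
    moreover have "?y $ k \<noteq> 0" "?y $ i = z * ?y $ j" by (simp_all add: vec4_nth[OF d])
    moreover from this have "?y \<noteq> 0" by auto
    ultimately have "tri n ?y" using G_line_tri[OF d z LG] by blast
    then show ?thesis using n unfolding tri_iff[OF d] vec4_nth[OF d] by (simp add: power_0_left)
  next
    case 4
    let ?v = "\<lambda>t. - (a $ i * z + a $ j + a $ k * t) / a $ l"
    \<comment> \<open>The parameter \<open>t\<close> must avoid the roots of unity and also the
      finitely many values for which the fourth coordinate \<open>?v t\<close> is a root of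
      unity.\<close>
    have "finite (unity n \<union> (\<lambda>u. (- (a $ l * u) - (a $ i * z + a $ j)) / a $ k) ` unity n)"
      using finite_unity[OF n] by simp
    then obtain t where t: "t \<notin> unity n" "t \<notin> (\<lambda>u. (- (a $ l * u) - (a $ i * z + a $ j)) / a $ k) ` unity n"
      using ex_new_if_finite[OF infinite_UNIV_char_0[where 'a = complex]] by (metis UnCI)
    have "?v t \<notin> unity n"
    proof
      assume v: "?v t \<in> unity n"
      have "t = (- (a $ l * ?v t) - (a $ i * z + a $ j)) / a $ k" using 4 by (simp add: field_simps)
      then show False using t(2) v by blast
    qed
    moreover have "tri n (vec4 i j k z 1 t (?v t))"
    proof (rule G_line_tri[OF d z LG])
      show "vec4 i j k z 1 t (?v t) \<in> hyp a" using 4 by (simp add: hyp_def dot_vec4[OF d])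
      have "vec4 i j k z 1 t (?v t) $ j \<noteq> 0" by (simp add: vec4_nth[OF d])
      then show "vec4 i j k z 1 t (?v t) \<noteq> 0" by auto
    qed (simp add: vec4_nth[OF d])
    ultimately show ?thesis using tri_vec4[OF d z] t(1) by (auto simp: unity_def)
  qed
qed

text \<open>The point \<open>(a_j, - a_i, 0, 0)\<close> lies on every line of the pencil
  \<open>y_k = w y_l\<close> and is not \<open>tri\<close>, so \<open>G\<close> contains no line of
  that pencil.\<close>

lemma G_subset_ln:
  assumes d: "distinct [i, j, k, l]" and al: "a $ l = 0" and nz: "a $ i \<noteq> 0" "a $ j \<noteq> 0" and L: "L \<in># G"
  shows "L \<notin> ln k l ` unity n" "\<exists>z\<in>unity n. L = ln i j z"
proof -
  show 1: "L \<notin> ln k l ` unity n"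
  proof
    assume "L \<in> ln k l ` unity n"
    then obtain w where w: "L = ln k l w" "w \<in> unity n" by blast
    let ?y = "vec4 i j k (a $ j) (- a $ i) 0 0"
    have d': "distinct [k, l, i, j]" using d by auto
    have "?y \<in> hyp a" by (simp add: hyp_def dot_vec4[OF d])
    moreover have "?y $ i \<noteq> 0" "?y $ k = w * ?y $ l" using nz by (simp_all add: vec4_nth[OF d])
    moreover from this have "?y \<noteq> 0" by auto
    ultimately have "tri n ?y" using G_line_tri[OF d' w(2)] L w(1) by blast
    then show False using n nz unfolding tri_iff[OF d] vec4_nth[OF d] by (auto simp: power_0_left)
  qed
  have "L \<in># blk i j k l" by (rule G_subset_blk[OF d L])
  then show "\<exists>z\<in>unity n. L = ln i j z" using 1 by (auto simp: set_blk)
qed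

text \<open>On the line the equation of the plane becomes \<open>y_k = u y_j\<close> with a root of
  unity \<open>u\<close>, so the line also has the equation \<open>y_i = (z / u) y_k\<close> and
  occurs in all three blocks of the trace. The blocks of the multinet being disjoint, it must belong
  to \<open>G\<close>.\<close>

lemma ln_in_G:
  assumes d: "distinct [i, j, k, l]" and al: "a $ l = 0" and ak: "a $ k \<noteq> 0"
    and z: "z \<in> sols n (a $ i) (a $ j) (- a $ k)"
  shows "ln i j z \<in># G"
proof -
  have zu: "z \<in> unity n" "(a $ i * z + a $ j) ^ n = (- a $ k) ^ n" using z by (auto simp: sols_def)
  define u where "u = (a $ i * z + a $ j) / (- a $ k)"
  have u: "u \<in> unity n" "a $ i * z + a $ j = - (a $ k * u)"
    using divide_in_unity[OF zu(2)] ak by (auto simp: u_def)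
  have u0: "u \<noteq> 0" using u unity_nonzero[OF n] by blast
  have sub: "ln i j z \<subseteq> {x. (P *v x) $ k = u * (P *v x) $ j}"
  proof
    fix x assume "x \<in> ln i j z"
    then have e: "(P *v x) $ i = z * (P *v x) $ j" by (simp add: mem_ln)
    have "dot a (P *v x) = 0" using P_in_hyp by (simp add: hyp_def)
    then have "(a $ i * z + a $ j) * (P *v x) $ j + a $ k * (P *v x) $ k = 0"
      by (simp add: dot4[OF d] e al algebra_simps)
    then have "a $ k * ((P *v x) $ k - u * (P *v x) $ j) = 0"
      unfolding u(2) by (simp add: algebra_simps)
    then show "x \<in> {x. (P *v x) $ k = u * (P *v x) $ j}" using ak by simp
  qed
  have "ln i j z = ln k j u"
    by (rule line_subset_eq) (use sub d zu(1) u(1) in \<open>auto simp: mem_ln intro!: is_line_ln\<close>)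
  moreover have zu': "z / u \<in> unity n" by (rule unity_divide[OF zu(1) u(1)])
  have "ln i j z \<subseteq> ln i k (z / u)"
    using sub u0 by (auto simp: mem_ln)
  then have "ln i j z = ln i k (z / u)"
    by (rule line_subset_eq[rotated 2]) (use d zu(1) zu' in \<open>auto intro!: is_line_ln\<close>)
  moreover have "ln k j u \<in># blk i l j k"
    unfolding blk_swap(2)[of i l j k] using u by (simp add: set_blk)
  moreover have "ln i j z \<in># blk i j k l" "ln i k (z / u) \<in># blk i k j l"
    using zu(1) zu' by (simp_all add: set_blk)
  ultimately have m: "ln i j z \<in># blk i j k l" "ln i j z \<in># blk i k j l" "ln i j z \<in># blk i l j k"
    by metis+
  have "ln i j z \<in># A ! b + G" if b: "b < 3" for b
  proof -
    have "length blocks = 3" by (simp add: blocks_def)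
    then have "blocks ! b \<in># mset blocks" using nth_mem b by (metis set_mset_mset)
    then have "ln i j z \<in># blocks ! b" unfolding mset_blocks[OF d] using m by auto
    then show ?thesis using blocks_eq[OF b] by simp
  qed
  from this[of 0] this[of 1] have "ln i j z \<in># A ! 0 + G" "ln i j z \<in># A ! 1 + G" by simp_all
  then show ?thesis using blocks_disjoint[of 0 1] by auto
qed

text \<open>The lines of \<open>G\<close> are those of the pencil \<open>y_i = z y_j\<close> with
  \<open>z\<close> a solution. They have multiplicity 1 because that pencil consists of
  \<open>n\<close> different lines and the other pencil of the block contributes none of
  them.\<close>

lemma size_G_eq_card_sols:
  assumes d: "distinct [i, j, k, l]" and al: "a $ l = 0" and nz: "a $ i \<noteq> 0" "a $ j \<noteq> 0" "a $ k \<noteq> 0"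
  shows "size G = card (sols n (a $ i) (a $ j) (- a $ k))"
proof -
  let ?S = "sols n (a $ i) (a $ j) (- a $ k)"
  have inj: "inj_on (ln i j) (unity n)" using ln_neq_same[OF d] nz by (auto simp: inj_on_def)
  have set: "set_mset G = ln i j ` ?S"
  proof
    show "set_mset G \<subseteq> ln i j ` ?S"
    proof
      fix L assume L: "L \<in># G"
      then obtain z where z: "z \<in> unity n" "L = ln i j z" using G_subset_ln(2)[OF d al nz(1,2)] by blast
      then have "z \<in> ?S" using G_line_one_zero[OF d z(1) _ nz(3) al] L by (simp add: sols_def)
      then show "L \<in> ln i j ` ?S" using z by blast
    qed
    show "ln i j ` ?S \<subseteq> set_mset G" using ln_in_G[OF d al nz(3)] by blast
  qed
  have "count G L = 1" if L: "L \<in># G" for L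
  proof -
    obtain b where b: "b < 3" "blocks ! b = blk i j k l" using blk_in_blocks[OF d] by blast
    have "count G L \<le> count (blk i j k l) L" using blocks_eq[OF b(1)] b(2) by simp
    also have "\<dots> = count (mset_set (ln i j ` unity n)) L"
      using G_subset_ln(1)[OF d al nz(1,2) L]
      by (simp add: blk_def image_mset_mset_set[OF inj] count_eq_zero_iff finite_unity[OF n])
    also have "\<dots> \<le> 1" by (simp add: count_mset_set')
    finally have "count G L \<le> 1" .
    moreover have "count G L > 0" using L by simp
    ultimately show ?thesis by linarith
  qed
  then have "size G = card (set_mset G)" by (simp add: size_multiset_overloaded_eq)
  also have "\<dots> = card ?S"
    unfolding set by (rule card_image) (rule inj_on_subset[OF inj], auto simp: sols_def)
  finally show ?thesis .
qed

end

section \<open>The case of two vanishing coefficients\<close>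

locale complete_induced = induced n P a W d A G
  for n P a W d A G +
  assumes n2: "n \<ge> 2"
    and complete: "3 * int d + 3 + (\<Sum>p\<in>other_points (base_locus W) A. int (num_lines_through A p) - 1)
       = 2 * int (card (lines_of A)) + (\<Sum>p\<in>base_locus W. int (base_mult A p) - 1)"
begin

lemma main_inequality:
  assumes "\<And>\<Phi>. \<Phi> \<in> set \<Phi>s \<Longrightarrow> homog_pred \<Phi>" "sorted_wrt (\<lambda>\<Phi> \<Psi>. \<forall>y. \<not> (\<Phi> y \<and> \<Psi> y)) \<Phi>s"
  shows "3 * int d + 3 + (\<Sum>\<Phi>\<leftarrow>\<Phi>s. excess \<Phi>) \<le> 2 * int (card (lines_of A)) +
    (\<Sum>p\<in>base_locus W \<inter> common_points. 1 - int (gmult p)) +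
    (\<Sum>l\<in>coord_points. int n - 1 - int (gmult (ptH (axis l 1))))"
  using excess_list_le[OF assms] complete sum_base_mult_le by linarith

definition has_coef_zero :: "4 \<Rightarrow> 4 \<Rightarrow> bool" where
  "has_coef_zero i j \<longleftrightarrow> (\<exists>z\<in>unity n. coef_zero i j z)"

text \<open>The expression \<open>a_i z + a_j\<close> is affine and nonconstant in \<open>z\<close>,
  so at most one root of unity is lost.\<close>

lemma num_coef_eq:
  assumes "a $ i \<noteq> 0"
  shows "int (num_coef i j) = int n - of_bool (has_coef_zero i j)"
proof (cases "has_coef_zero i j")
  case True
  then obtain z where z: "z \<in> unity n" "coef_zero i j z" by (auto simp: has_coef_zero_def)
  have u: "w = z" if "a $ i * w + a $ j = 0" for w
  proof -
    have "a $ i * w = a $ i * z" using that z by (metis coef_zero_def add_right_cancel)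
    then show ?thesis using assms by simp
  qed
  have "{w \<in> unity n. a $ i * w + a $ j \<noteq> 0} = unity n - {z}"
  proof (rule set_eqI)
    fix w
    have "a $ i * w + a $ j = 0 \<longleftrightarrow> w = z" using u[of w] z(2) by (auto simp: coef_zero_def)
    then show "w \<in> {w \<in> unity n. a $ i * w + a $ j \<noteq> 0} \<longleftrightarrow> w \<in> unity n - {z}" by simp
  qed
  then have "num_coef i j = n - 1" using z finite_unity[OF n] card_unity[OF n] by (simp add: num_coef_def)
  then show ?thesis using True n by simp
next
  case False
  then have "{w \<in> unity n. a $ i * w + a $ j \<noteq> 0} = unity n"
    by (auto simp: has_coef_zero_def coef_zero_def)
  then show ?thesis using False card_unity[OF n] by (simp add: num_coef_def)
qed

lemma has_coef_zero_power:
  assumes "has_coef_zero i j"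
  shows "a $ i ^ n = (- a $ j) ^ n"
proof -
  obtain z where z: "z \<in> unity n" "a $ i * z + a $ j = 0"
    using assms by (auto simp: has_coef_zero_def coef_zero_def)
  then have "a $ i * z = - a $ j" by (simp add: eq_neg_iff_add_eq_0)
  then have "(a $ i * z) ^ n = (- a $ j) ^ n" by simp
  then show ?thesis using z(1) by (simp add: power_mult_distrib unity_def)
qed

text \<open>Nothing is divided out here, so \<open>d = 2 n\<close>. The blocks \<open>ik|jl\<close>
  and \<open>il|jk\<close> have full grids of \<open>n^2\<close> points. In the block
  \<open>ij|kl\<close> the pencil of \<open>i, j\<close> collapses to the single line
  \<open>y_i = y_j = 0\<close>, which carries \<open>n\<close> further points. The estimate becomes
  \<open>2 n^2 \<le> 5 n - 3\<close>, that is \<open>(2 n - 3) (n - 1) \<le> 0\<close>.\<close>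

lemma not_two_zeros:
  assumes d4: "distinct [i, j, k, l]" and a0: "a $ k = 0" "a $ l = 0" and nz: "a $ i \<noteq> 0" "a $ j \<noteq> 0"
  shows False
proof -
  have G0: "G = {#}" using G_imp_one_zero a0 d4 by (metis multiset_nonemptyE distinct_length_2_or_more)
  have dn: "d = 2 * n" using size_G G0 by simp
  have ap: "a $ j ^ n \<noteq> (- a $ i) ^ n"
  proof
    assume "a $ j ^ n = (- a $ i) ^ n"
    then have "a $ j / (- a $ i) \<in> unity n" by (rule divide_in_unity) (use nz in simp)
    then show False using support2[OF d4 _ a0] nz by force
  qed
  have bad: "bad_pairs i p j q = {}" if pq: "a $ p = 0" "a $ q = 0" for p q
  proof (rule ccontr)
    assume "bad_pairs i p j q \<noteq> {}"
    then obtain z w where zw: "z \<in> unity n" "w \<in> unity n" "(a $ j * w) ^ n = ((- a $ i) * z) ^ n"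
      using pq by (auto simp: bad_pairs_def)
    then have "a $ j ^ n = (- a $ i) ^ n" unfolding power_mult_distrib by (simp add: unity_def)
    then show False using ap by simp
  qed
  have nc: "num_coef i p = n" "num_coef j p = n" if "a $ p = 0" for p
  proof -
    have "{z \<in> unity n. a $ i * z + a $ p \<noteq> 0} = unity n" "{z \<in> unity n. a $ j * z + a $ p \<noteq> 0} = unity n"
      using that nz unity_nonzero[OF n] by auto
    then show "num_coef i p = n" "num_coef j p = n" using card_unity[OF n] by (simp_all add: num_coef_def)
  qed
  have e1: "int n * int n \<le> excess (grid_pred n i k j l)"
    using grid_excess[of i k j l] bad[of k l] nc a0 d4 by auto
  have e2: "int n * int n \<le> excess (grid_pred n i l j k)"
    using grid_excess[of i l j k] bad[of l k] nc a0 d4 by auto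
  \<comment> \<open>The points \<open>(0, 0, z, 1)\<close>, where the collapsed line meets the lines
    \<open>y_k = z y_l\<close>.\<close>
  let ?\<Phi> = "\<lambda>y :: complex ^ 4. y $ i = 0 \<and> y $ j = 0 \<and> y $ k \<noteq> 0 \<and> y $ l \<noteq> 0"
  let ?pt = "\<lambda>z. vec4 i j k 0 0 z 1"
  have pts: "(\<lambda>z. ptH (?pt z)) ` unity n \<subseteq> family ?\<Phi>"
  proof clarify
    fix z assume z: "z \<in> unity n"
    have z0: "z \<noteq> 0" using z unity_nonzero[OF n] by blast
    have y: "?pt z \<in> hyp a" using a0 by (simp add: hyp_def dot_vec4[OF d4])
    have "?pt z $ l \<noteq> 0" by (simp add: vec4_nth[OF d4])
    then have y0: "?pt z \<noteq> 0" by auto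
    have nt: "\<not> tri n (?pt z)" unfolding tri_iff[OF d4] vec4_nth[OF d4] using z0 n by (auto simp: power_0_left)
    have ne: "ln i j 1 \<noteq> ln k l z"
      by (rule ln_neq_opposite[OF d4 one_in_unity z]) (rule support2[OF d4 one_in_unity a0])
    have "ptH (?pt z) \<in> other_points (base_locus W) A"
    proof (rule other_pointsI[OF y y0 nt _ _ ne])
      show "ptH (?pt z) \<subseteq> ln i j 1" using ptH_ln[OF y, of i j 1] d4 one_in_unity by (simp add: vec4_nth[OF d4])
      show "ptH (?pt z) \<subseteq> ln k l z" using ptH_ln[OF y, of k l z] d4 z by (simp add: vec4_nth[OF d4])
    qed (use d4 z one_in_unity in \<open>auto intro: trace_linesI\<close>)
    then show "ptH (?pt z) \<in> family ?\<Phi>"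
      using y y0 z0 by (auto simp: family_def vec4_nth[OF d4])
  qed
  have "inj_on (\<lambda>z. ptH (?pt z)) (unity n)"
  proof (rule inj_onI)
    fix z w assume zw: "z \<in> unity n" "w \<in> unity n" "ptH (?pt z) = ptH (?pt w)"
    have h: "?pt z \<in> hyp a" "?pt w \<in> hyp a" using a0 by (simp_all add: hyp_def dot_vec4[OF d4])
    have "?pt z $ l \<noteq> 0" by (simp add: vec4_nth[OF d4])
    then have "?pt z \<noteq> 0" by auto
    then obtain c where c: "?pt w = c *s ?pt z" using ptH_eqD[OF h] zw by blast
    have s: "?pt w $ m = c * ?pt z $ m" for m unfolding c by simp
    show "z = w" using s[of k] s[of l] by (simp add: vec4_nth[OF d4])
  qed
  then have "n \<le> card (family ?\<Phi>)"
    using card_inj_on_le[OF _ pts finite_family] card_unity[OF n] by simp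
  then have e3: "int n \<le> excess ?\<Phi>" using card_family_le_excess[of ?\<Phi>] by linarith
  have main: "3 * int d + 3 + (\<Sum>\<Phi>\<leftarrow>[grid_pred n i k j l, grid_pred n i l j k, ?\<Phi>]. excess \<Phi>) \<le> 2 * int (card (lines_of A)) +
    (\<Sum>p\<in>base_locus W \<inter> common_points. 1 - int (gmult p)) +
    (\<Sum>l\<in>coord_points. int n - 1 - int (gmult (ptH (axis l 1))))"
  proof (rule main_inequality)
    show "homog_pred \<Phi>" if "\<Phi> \<in> set [grid_pred n i k j l, grid_pred n i l j k, ?\<Phi>]" for \<Phi>
      using that homog_pred_grid by (auto simp: homog_pred_def)
    show "sorted_wrt (\<lambda>\<Phi> \<Psi>. \<forall>y. \<not> (\<Phi> y \<and> \<Psi> y)) [grid_pred n i k j l, grid_pred n i l j k, ?\<Phi>]"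
      by (auto simp: grid_pred_def)
  qed
  have "common_points = {}"
  proof (rule ccontr)
    assume "common_points \<noteq> {}"
    then obtain y where y: "y \<in> hyp a" "y \<noteq> 0" "all_eq n y" by (auto simp: common_points_def)
    have "a $ i * y $ i + a $ j * y $ j = 0" using y(1) a0 by (simp add: hyp_def dot4[OF d4])
    then have "a $ j * y $ j = (- a $ i) * y $ i" by (simp add: eq_neg_iff_add_eq_0 add.commute)
    then have "a $ j ^ n * y $ j ^ n = (- a $ i) ^ n * y $ i ^ n" by (metis power_mult_distrib)
    moreover have "y $ i ^ n = y $ j ^ n" using y(3) by (simp add: all_eq_def)
    ultimately have "y $ j = 0" using ap n by simp
    then show False using all_eq_nonzero[OF n y(2,3)] by blast
  qed
  then have D0: "(\<Sum>p\<in>base_locus W \<inter> common_points. 1 - int (gmult p)) = 0" by simp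
  have "coord_points \<subseteq> {k, l}" using nz all4[OF d4, of "\<lambda>m. m \<in> coord_points \<longrightarrow> m \<in> {k, l}"]
    by (auto simp: coord_points_def)
  then have "card coord_points \<le> 2" using card_mono[of "{k, l}" coord_points] card_insert_le_m1[of 2 "{l}" k] by (simp add: card_insert_if split: if_splits)
  then have "int (card coord_points) * (int n - 1) \<le> 2 * (int n - 1)"
    using n by (intro mult_right_mono) auto
  moreover have "gmult p = 0" for p by (subst gmult_def, subst G0) simp
  ultimately have C0: "(\<Sum>l\<in>coord_points. int n - 1 - int (gmult (ptH (axis l 1)))) \<le> 2 * (int n - 1)"
    by simp
  have "ln i j ` unity n \<subseteq> {ln i j 1}"
  proof clarify
    fix z assume z: "z \<in> unity n"
    have "ln i j w = {x. (P *v x) $ i = 0 \<and> (P *v x) $ j = 0}" if w: "w \<in> unity n" for w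
    proof -
      have "(P *v x) $ j = 0" if "(P *v x) $ i = w * (P *v x) $ j" for x
      proof -
        have "dot a (P *v x) = 0" using P_in_hyp by (simp add: hyp_def)
        then have "(a $ i * w + a $ j) * (P *v x) $ j = 0"
          by (simp add: dot4[OF d4] that a0 algebra_simps)
        then show ?thesis using support2[OF d4 w a0] by simp
      qed
      then show ?thesis by (auto simp: mem_ln)
    qed
    then show "ln i j z = ln i j 1" using z one_in_unity by simp
  qed
  then have "set_mset (blk i j k l) \<subseteq> insert (ln i j 1) (ln k l ` unity n)" by (auto simp: set_blk)
  then have "card (set_mset (blk i j k l)) \<le> card (insert (ln i j 1) (ln k l ` unity n))"
    using finite_unity[OF n] by (intro card_mono) auto
  also have "\<dots> \<le> Suc n"
    using card_insert_le_m1[of "Suc n" "ln k l ` unity n" "ln i j 1"] card_image_le[OF finite_unity[OF n], of "ln k l"] card_unity[OF n] by simp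
  finally have c1: "card (set_mset (blk i j k l)) \<le> Suc n" .
  have c: "card (set_mset (blk p q r s)) \<le> 2 * n" for p q r s
    using card_set_mset_le_size[of "blk p q r s"] size_blk by simp
  have L: "card (lines_of A) \<le> 5 * n + 1"
    using card_lines_of_le_blk[OF d4] c1 c[of i k j l] c[of i l j k] by linarith
  have "6 * int n + 3 + (int n * int n + int n * int n + int n) \<le> 2 * (5 * int n + 1) + 2 * (int n - 1)"
    using main e1 e2 e3 D0 C0 L dn by simp
  then have q: "2 * (int n * int n) \<le> 5 * int n - 3" by presburger
  show False
  proof (cases "n = 2")
    case True
    then show ?thesis using q by simp
  next
    case False
    then have "3 * int n \<le> int n * int n" using n2 by (intro mult_right_mono) auto
    then show ?thesis using q n2 by presburger
  qed
qed

section \<open>The case of one vanishing coefficient\<close>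

text \<open>Let \<open>g\<close> be the size of \<open>G\<close> and \<open>Q\<close> the number of
  pairs among \<open>i, j, k\<close> with a line through the opposite centre. The estimate
  \<open>ineq\<close> contradicts \<open>g \<le> 2\<close> and \<open>Q \<le> 3\<close> for
  \<open>n \<ge> 4\<close>. It leaves only \<open>g = 2, Q = 3\<close> for \<open>n = 3\<close>,
  with equality, and \<open>g = 1, Q = 3\<close> for \<open>n = 2\<close>, where
  \<open>g \<le> 1\<close>. Both are incompatible with the coefficients.\<close>

lemma not_one_zero:
  assumes d4: "distinct [i, j, k, l]" and al: "a $ l = 0" and nz: "a $ i \<noteq> 0" "a $ j \<noteq> 0" "a $ k \<noteq> 0"
  shows False
proof -
  define g where "g = int (size G)"
  have dg: "int d = 2 * int n - g" using size_G by (simp add: g_def)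
  define q where "q i j = (of_bool (has_coef_zero i j) :: int)" for i j
  have grid: "(int n - q i j) * int n - g * int n \<le> excess (grid_pred n i j k l)"
    and centre: "int n - 1 + q i j \<le> excess (centre_pred k l i j)"
    if d4: "distinct [i, j, k, l]" and nz: "a $ i \<noteq> 0" "a $ j \<noteq> 0" "a $ k \<noteq> 0" for i j k
  proof -
    let ?S = "sols n (a $ i) (a $ j) (- a $ k)"
    have nk: "int (num_coef k l) = int n"
    proof -
      have "{z \<in> unity n. a $ k * z + a $ l \<noteq> 0} = unity n" using al nz unity_nonzero[OF n] by auto
      then show ?thesis by (simp add: num_coef_def card_unity[OF n])
    qed
    \<comment> \<open>As \<open>a_l = 0\<close>, the root \<open>w\<close> drops out of the
      condition. The remaining condition on \<open>z\<close> is the one that describes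
      \<open>G\<close>, so at most \<open>g n\<close> pairs are lost.\<close>
    have "bad_pairs i j k l \<subseteq> ?S \<times> unity n"
    proof clarify
      fix z w assume "(z, w) \<in> bad_pairs i j k l"
      then have b: "z \<in> unity n" "w \<in> unity n" "(a $ k * w) ^ n = (- (a $ i * z + a $ j)) ^ n"
        using al by (auto simp: bad_pairs_def)
      then have "a $ k ^ n = (- (a $ i * z + a $ j)) ^ n" by (simp add: power_mult_distrib unity_def)
      then have "(a $ i * z + a $ j) ^ n = (- a $ k) ^ n" by (metis minus_minus power_minus power_mult_distrib)
      then show "z \<in> ?S \<and> w \<in> unity n" using b by (simp add: sols_def)
    qed
    then have "card (bad_pairs i j k l) \<le> card (?S \<times> unity n)"
      using finite_sols[OF n] finite_unity[OF n] by (intro card_mono) auto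
    also have "\<dots> = size G * n"
      using size_G_eq_card_sols[OF d4 al nz] by (simp add: card_cartesian_product card_unity[OF n])
    finally have "int (card (bad_pairs i j k l)) \<le> g * int n" by (simp add: g_def flip: of_nat_mult)
    then show "(int n - q i j) * int n - g * int n \<le> excess (grid_pred n i j k l)"
      using grid_excess[OF d4] num_coef_eq[OF nz(1), of j] nk by (simp add: q_def)
    have d': "distinct [k, l, i, j]" using d4 by auto
    have "\<not> (\<exists>z\<in>unity n. coef_zero k l z)"
      using nz al unity_nonzero[OF n] by (auto simp: coef_zero_def)
    then show "int n - 1 + q i j \<le> excess (centre_pred k l i j)"
      using centre_excess[OF d' n2 nz(1,2)] by (simp add: q_def has_coef_zero_def)
  qed
  have d5: "distinct [i, k, j, l]" "distinct [j, k, i, l]" using d4 by auto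
  let ?\<Phi>s = "[grid_pred n i j k l, grid_pred n i k j l, grid_pred n j k i l,
     centre_pred k l i j, centre_pred j l i k, centre_pred i l j k]"
  have main: "3 * int d + 3 + (\<Sum>\<Phi>\<leftarrow>?\<Phi>s. excess \<Phi>) \<le> 2 * int (card (lines_of A)) +
    (\<Sum>p\<in>base_locus W \<inter> common_points. 1 - int (gmult p)) +
    (\<Sum>l\<in>coord_points. int n - 1 - int (gmult (ptH (axis l 1))))"
  proof (rule main_inequality)
    show "homog_pred \<Phi>" if "\<Phi> \<in> set ?\<Phi>s" for \<Phi>
      using that homog_pred_grid homog_pred_centre by auto
    show "sorted_wrt (\<lambda>\<Phi> \<Psi>. \<forall>y. \<not> (\<Phi> y \<and> \<Psi> y)) ?\<Phi>s"
      by (auto simp: grid_pred_def centre_pred_def)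
  qed
  have L: "int (card (lines_of A)) \<le> 3 * int d" using card_lines_of_le_degree by linarith
  \<comment> \<open>A point with four equal powers lies on a line that was divided out, so its
    weight 2 drops to at most 1.\<close>
  have "1 - int (gmult p) \<le> 0" if p: "p \<in> common_points" for p
  proof -
    obtain y where y: "y \<in> hyp a" "y \<noteq> 0" "all_eq n y" "p = ptH y" using p by (auto simp: common_points_def)
    have nz_y: "y $ m \<noteq> 0" for m by (rule all_eq_nonzero[OF n y(2,3)])
    define z u where "z = y $ i / y $ j" and "u = y $ k / y $ j"
    have zu: "z \<in> unity n" "u \<in> unity n"
      using divide_in_unity[of "y $ i" n "y $ j"] divide_in_unity[of "y $ k" n "y $ j"] y(3) nz_y
      by (auto simp: all_eq_def z_def u_def)
    have "a $ i * y $ i + a $ j * y $ j + a $ k * y $ k = 0" using y(1) al by (simp add: hyp_def dot4[OF d4])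
    then have "a $ i * z + a $ j + a $ k * u = 0"
      using nz_y[of j] by (simp add: z_def u_def field_simps)
    then have "a $ i * z + a $ j = (- a $ k) * u" by (simp add: eq_neg_iff_add_eq_0)
    then have "(a $ i * z + a $ j) ^ n = (- a $ k) ^ n" using zu(2) by (simp only: power_mult_distrib) (simp add: unity_def)
    then have "ln i j z \<in># G" using ln_in_G[OF d4 al nz(3)] zu by (simp add: sols_def)
    moreover have "p \<subseteq> ln i j z"
      using ptH_ln[OF y(1), of i j z] d4 zu(1) nz_y[of j] y(4) by (simp add: z_def)
    ultimately have "ln i j z \<in># {#L \<in># G. p \<subseteq> L#}" by simp
    then have "gmult p > 0" unfolding gmult_def
      by (metis empty_not_add_mset multi_member_split nonempty_has_size)
    then show ?thesis by simp
  qed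
  then have D0: "(\<Sum>p\<in>base_locus W \<inter> common_points. 1 - int (gmult p)) \<le> 0"
    by (intro sum_nonpos) auto
  have g_card: "g = int (card (sols n (a $ i) (a $ j) (- a $ k)))"
    using size_G_eq_card_sols[OF d4 al nz] by (simp add: g_def)
  have g2: "0 \<le> g" "g \<le> 2" using card_sols_le_2[OF n nz(1,2), of "- a $ k"] g_card by simp_all
  have g1: "g \<le> 1" if "n = 2" using card_sols_2_le_1[OF nz(1,2), of "- a $ k"] g_card that by simp
  have cp: "coord_points \<subseteq> {l}" using nz all4[OF d4, of "\<lambda>m. m \<in> coord_points \<longrightarrow> m \<in> {l}"]
    by (auto simp: coord_points_def)
  \<comment> \<open>Each line of \<open>G\<close> has an equation in \<open>y_i\<close> and
    \<open>y_j\<close> alone and therefore contains the vertex of index \<open>l\<close>.\<close>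
  have ge: "int (gmult (ptH (axis l 1))) = g"
  proof -
    have "{#L \<in># G. ptH (axis l 1) \<subseteq> L#} = G"
    proof -
      have "ptH (axis l 1) \<subseteq> L" if L: "L \<in># G" for L
      proof -
        obtain z where z: "z \<in> unity n" "L = ln i j z" using G_subset_ln(2)[OF d4 al nz(1,2) L] by blast
        show ?thesis unfolding z(2) using ptH_ln[of "axis l 1" i j z] al d4 z(1)
          by (simp add: axis_hyp) (simp add: axis_def)
      qed
      then show ?thesis by (simp add: filter_mset_eq_conv)
    qed
    then show ?thesis by (simp add: gmult_def g_def)
  qed
  have ng: "g \<le> int n - 1" using g1 g2 n2 by (cases "n = 2") auto
  have C0: "(\<Sum>l\<in>coord_points. int n - 1 - int (gmult (ptH (axis l 1)))) \<le> int n - 1 - g"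
  proof -
    have "coord_points = {} \<or> coord_points = {l}" using cp by auto
    then show ?thesis using ge ng by auto
  qed
  define Q where "Q = q i j + q i k + q j k"
  have "3 * (2 * int n - g) + 3 + ((int n - q i j) * int n - g * int n + ((int n - q i k) * int n - g * int n) +
     ((int n - q j k) * int n - g * int n) + (int n - 1 + q i j) + (int n - 1 + q i k) + (int n - 1 + q j k))
     \<le> 6 * (2 * int n - g) + (int n - 1 - g)"
    using main grid[OF d4 nz] grid[OF d5(1)] grid[OF d5(2)] centre[OF d4 nz] centre[OF d5(1)] centre[OF d5(2)]
      nz L D0 C0 dg by simp
  then have ineq: "3 * (int n * int n) + Q + 1 + 4 * g \<le> 4 * int n + Q * int n + 3 * (g * int n)"
    by (simp add: Q_def algebra_simps)
  have q01: "0 \<le> q i j" "q i j \<le> 1" for i j by (simp_all add: q_def)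
  have Q: "0 \<le> Q" "Q \<le> 3" using q01[of i j] q01[of i k] q01[of j k] by (simp_all add: Q_def)
  have allq: "has_coef_zero i j \<and> has_coef_zero i k \<and> has_coef_zero j k" if "Q = 3"
    using that by (auto simp: Q_def q_def of_bool_def split: if_splits)
  consider "n = 2" | "n = 3" | "n \<ge> 4" using n2 by linarith
  then show False
  proof cases
    \<comment> \<open>The squares of \<open>a_i\<close>, \<open>a_j\<close>, \<open>a_k\<close>
      agree, so \<open>a_i z + a_j\<close> is 0 or \<open>2 a_j\<close>, and neither has the square
      of \<open>a_k\<close>.\<close>
    case 1
    then have "g = 1" "Q = 3" using ineq g1 g2 Q by auto
    then have h: "has_coef_zero i j" "has_coef_zero i k" "has_coef_zero j k" using allq by auto
    have p: "(a $ i)\<^sup>2 = (a $ j)\<^sup>2" "(a $ i)\<^sup>2 = (a $ k)\<^sup>2"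
      using has_coef_zero_power[OF h(1)] has_coef_zero_power[OF h(2)] 1 by simp_all
    obtain z where "z \<in> sols n (a $ i) (a $ j) (- a $ k)"
      using \<open>g = 1\<close> g_card by (metis card.empty equals0I of_nat_0 zero_neq_one)
    then have z: "z\<^sup>2 = 1" "(a $ i * z + a $ j)\<^sup>2 = (a $ k)\<^sup>2" using 1 by (auto simp: sols_def unity_def)
    have "(a $ i * z + a $ j)\<^sup>2 = (a $ i)\<^sup>2 * z\<^sup>2 + 2 * (a $ i * z * a $ j) + (a $ j)\<^sup>2"
      by (simp add: power2_eq_square algebra_simps)
    then have "2 * (a $ i * z * a $ j) + (a $ j)\<^sup>2 = 0" using z p by algebra
    then have "a $ j * (2 * (a $ i * z) + a $ j) = 0"
      by (simp add: power2_eq_square algebra_simps)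
    then have "2 * (a $ i * z) = - a $ j" using nz by (simp add: eq_neg_iff_add_eq_0)
    then have "(2 * (a $ i * z))\<^sup>2 = (a $ j)\<^sup>2" by simp
    then have "4 * (a $ i)\<^sup>2 = (a $ i)\<^sup>2" using z p by (simp add: power_mult_distrib)
    then show False using nz by simp
  next
    \<comment> \<open>\<open>Q = 3\<close> makes the cubes of \<open>a_i\<close>,
      \<open>a_j\<close>, \<open>a_k\<close> pairwise opposite, which is impossible for three
      nonzero numbers.\<close>
    case 2
    then have "Q = 3" using ineq g2 Q by auto
    then have h: "has_coef_zero i j" "has_coef_zero i k" "has_coef_zero j k" using allq by auto
    have "a $ i ^ 3 = - (a $ j ^ 3)" "a $ i ^ 3 = - (a $ k ^ 3)" "a $ j ^ 3 = - (a $ k ^ 3)"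
      using has_coef_zero_power[OF h(1)] has_coef_zero_power[OF h(2)] has_coef_zero_power[OF h(3)] 2 by simp_all
    then have "a $ i ^ 3 = - (a $ i ^ 3)" by simp
    then show False using nz by simp
  next
    case 3
    have "g * (3 * int n - 4) \<le> 2 * (3 * int n - 4)" using g2 3 by (intro mult_right_mono) auto
    moreover have "Q * (int n - 1) \<le> 3 * (int n - 1)" using Q 3 by (intro mult_right_mono) auto
    \<comment> \<open>The bounds on \<open>g\<close> and \<open>Q\<close> reduce the estimate to
      \<open>3 n^2 - 13 n + 12 \<le> 0\<close>, whose left side is this product plus 8.\<close>
    moreover have "0 \<le> (int n - 4) * (3 * int n - 1)" using 3 by (intro mult_nonneg_nonneg) auto
    ultimately show False using ineq 3 by (simp add: algebra_simps)
  qed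
qed

end

section \<open>The case of no vanishing coefficient\<close>

text \<open>Here s is the number of points whose coordinates have equal n-th powers. For each block, m and c
  tell whether at least one, respectively both, of its two pencils contain a line through the
  centre of the other.\<close>

lemma no_zero_arithmetic:
  fixes n s m1 m2 m3 c1 c2 c3 :: int
  assumes n: "n \<ge> 2" and m: "m1 \<in> {0, 1}" "m2 \<in> {0, 1}" "m3 \<in> {0, 1}"
    and c: "c1 \<in> {0, m1}" "c2 \<in> {0, m2}" "c3 \<in> {0, m3}"
    and main: "3 * (n * n) - (n - 1) * (m1 + m2 + m3) + 2 * (c1 + c2 + c3) - 3 \<le> 4 * s"
    and s: "s \<le> (if n = 2 then 1 else 2) * (n - m1) + (if n = 2 then 2 else n) * c1"
      "s \<le> (if n = 2 then 1 else 2) * (n - m2) + (if n = 2 then 2 else n) * c2"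
      "s \<le> (if n = 2 then 1 else 2) * (n - m3) + (if n = 2 then 2 else n) * c3"
    and s3: "n = 3 \<Longrightarrow> m1 = 0 \<Longrightarrow> s \<le> 5" "n = 3 \<Longrightarrow> m2 = 0 \<Longrightarrow> s \<le> 5" "n = 3 \<Longrightarrow> m3 = 0 \<Longrightarrow> s \<le> 5"
    and n3: "n = 3 \<Longrightarrow> c1 + c2 + c3 \<noteq> 3"
  shows "n = 2 \<and> c1 = 1 \<and> c2 = 1 \<and> c3 = 1"
proof -
  consider "n = 2" | "n = 3" | "n \<ge> 4" using n by linarith
  then show ?thesis
  proof cases
    case 1
    then show ?thesis using main s m c by auto
  next
    case 2
    \<comment> \<open>With all \<open>m\<close> equal to 0 the general bound
      \<open>s \<le> 6\<close> would give equality, and \<open>s \<le> 5\<close> excludes it. With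
      all \<open>c\<close> equal to 1 the estimate allows \<open>s = 6\<close> and
      \<open>s = 7\<close>, so this case rests on \<open>n3\<close>.\<close>
    then show ?thesis using main s s3 n3 m c by auto
  next
    case 3
    \<comment> \<open>If some \<open>c\<close> is 0 then \<open>s \<le> 2 n\<close>, and the first
      product gives the contradiction. If all \<open>c\<close> are 1 then
      \<open>s \<le> 3 n - 2\<close>, and the second one does.\<close>
    have p: "0 \<le> (n - 4) * (3 * n + 1)" "0 \<le> (n - 4) * (3 * n - 3)" using 3 by (auto intro!: mult_nonneg_nonneg)
    show ?thesis using main s m c 3 p by (auto simp: algebra_simps)
  qed
qed

context complete_induced
begin

definition coef_bool :: "4 \<Rightarrow> 4 \<Rightarrow> int" where
  "coef_bool i j = of_bool (has_coef_zero i j)"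

text \<open>Normalizing \<open>y_j = 1\<close> turns a point with four equal powers into roots of
  unity \<open>z, 1, u, v\<close> whose weighted sum vanishes; here \<open>z\<close> is
  fixed.\<close>

definition unit_sums :: "4 \<Rightarrow> 4 \<Rightarrow> 4 \<Rightarrow> 4 \<Rightarrow> complex \<Rightarrow> (complex \<times> complex) set" where
  "unit_sums i j k l z = {(u, v). u \<in> unity n \<and> v \<in> unity n \<and> a $ i * z + a $ j + a $ k * u + a $ l * v = 0}"

lemma coef_zero_unique: "a $ i \<noteq> 0 \<Longrightarrow> coef_zero i j z \<Longrightarrow> coef_zero i j w \<Longrightarrow> z = w"
  unfolding coef_zero_def by (metis add_right_cancel mult_left_cancel)

lemma finite_unit_sums: "finite (unit_sums i j k l z)"
  by (rule finite_subset[of _ "unity n \<times> unity n"]) (auto simp: unit_sums_def finite_unity[OF n])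

text \<open>In a vanishing sum \<open>u\<close> determines \<open>v\<close>, and the condition that
  \<open>v\<close> is a root of unity turns into the equation of \<open>sols\<close> for
  \<open>u\<close>.\<close>

lemma card_unit_sums_le_sols:
  assumes al: "a $ l \<noteq> 0"
  shows "card (unit_sums i j k l z) \<le> card (sols n (a $ k) (a $ i * z + a $ j) (- a $ l))"
proof (rule card_inj_on_le)
  show "inj_on fst (unit_sums i j k l z)"
  proof (rule inj_onI, clarify)
    fix u v u' v'
    assume "(u, v) \<in> unit_sums i j k l z" "(u', v') \<in> unit_sums i j k l z" and uu: "fst (u, v) = fst (u', v')"
    then have "a $ i * z + a $ j + a $ k * u + a $ l * v = a $ i * z + a $ j + a $ k * u + a $ l * v'"
      by (simp add: unit_sums_def)
    then show "u = u' \<and> v = v'" using al uu by simp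
  qed
  show "fst ` unit_sums i j k l z \<subseteq> sols n (a $ k) (a $ i * z + a $ j) (- a $ l)"
  proof clarify
    fix u v assume "(u, v) \<in> unit_sums i j k l z"
    then have uv: "u \<in> unity n" "v \<in> unity n" "a $ i * z + a $ j + a $ k * u + a $ l * v = 0"
      by (auto simp: unit_sums_def)
    have "a $ k * u + (a $ i * z + a $ j) = (- a $ l) * v"
      using uv(3) by (simp add: eq_neg_iff_add_eq_0 algebra_simps)
    then have "(a $ k * u + (a $ i * z + a $ j)) ^ n = (- a $ l) ^ n * v ^ n"
      by (metis power_mult_distrib)
    then show "fst (u, v) \<in> sols n (a $ k) (a $ i * z + a $ j) (- a $ l)"
      using uv by (simp add: sols_def unity_def)
  qed
qed (rule finite_sols[OF n])

text \<open>If the first two terms cancel, so do the last two. The ratio \<open>u / v\<close> is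
  then the root at which the coefficient of the pair \<open>k, l\<close> vanishes, and
  \<open>v\<close> determines \<open>u\<close>.\<close>

lemma card_unit_sums_zero:
  assumes ak: "a $ k \<noteq> 0" and z: "coef_zero i j z"
  shows "int (card (unit_sums i j k l z)) \<le> int n * coef_bool k l"
proof (cases "unit_sums i j k l z = {}")
  case True
  then show ?thesis by (simp add: coef_bool_def)
next
  case False
  have e: "a $ k * u + a $ l * v = 0" if "(u, v) \<in> unit_sums i j k l z" for u v
    using that z by (simp add: unit_sums_def coef_zero_def)
  obtain u v where uv: "(u, v) \<in> unit_sums i j k l z" using False by auto
  then have uv': "u \<in> unity n" "v \<in> unity n" "v \<noteq> 0" using unity_nonzero[OF n] by (auto simp: unit_sums_def)
  have "coef_zero k l (u / v)"
    using e[OF uv] uv'(3) by (simp add: coef_zero_def field_simps)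
  then have b: "coef_bool k l = 1" using unity_divide[OF uv'(1,2)] by (auto simp: coef_bool_def has_coef_zero_def)
  have "card (unit_sums i j k l z) \<le> card (unity n)"
  proof (rule card_inj_on_le)
    show "inj_on snd (unit_sums i j k l z)"
    proof (rule inj_onI, clarify)
      fix u v u' v'
      assume "(u, v) \<in> unit_sums i j k l z" "(u', v') \<in> unit_sums i j k l z" and "snd (u, v) = snd (u', v')"
      then have "a $ k * u + a $ l * v = 0" "a $ k * u' + a $ l * v = 0" "v = v'" using e by auto
      then show "u = u' \<and> v = v'" using ak by (metis add_right_cancel mult_left_cancel)
    qed
  qed (auto simp: unit_sums_def finite_unity[OF n])
  then show ?thesis using b card_unity[OF n] by simp
qed

lemma common_points_subset:
  assumes d4: "distinct [i, j, k, l]"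
  shows "common_points \<subseteq> (\<lambda>(z, u, v). ptH (vec4 i j k z 1 u v)) ` (SIGMA z:unity n. unit_sums i j k l z)"
proof
  fix p assume "p \<in> common_points"
  then obtain y where y: "y \<in> hyp a" "y \<noteq> 0" "all_eq n y" "p = ptH y" by (auto simp: common_points_def)
  have nz_y: "y $ m \<noteq> 0" for m by (rule all_eq_nonzero[OF n y(2,3)])
  define c where "c = 1 / y $ j"
  have c: "c \<noteq> 0" using nz_y by (simp add: c_def)
  have un: "c * y $ m \<in> unity n" for m
    using divide_in_unity[of "y $ m" n "y $ j"] y(3) nz_y by (auto simp: all_eq_def c_def)
  have e: "c *s y = vec4 i j k (c * y $ i) 1 (c * y $ k) (c * y $ l)"
    unfolding vec_eq_iff all4[OF d4] vec4_nth[OF d4] using nz_y[of j] by (simp add: c_def)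
  have "c *s y \<in> hyp a" using y(1) by (simp add: hyp_def)
  then have "a $ i * (c * y $ i) + a $ j + a $ k * (c * y $ k) + a $ l * (c * y $ l) = 0"
    unfolding e by (simp add: hyp_def dot_vec4[OF d4])
  then have mem: "(c * y $ i, c * y $ k, c * y $ l) \<in> (SIGMA z:unity n. unit_sums i j k l z)"
    using un by (simp add: unit_sums_def)
  have "p = ptH (vec4 i j k (c * y $ i) 1 (c * y $ k) (c * y $ l))"
    using ptH_scale[OF y(1,2) c] y(4) unfolding e by simp
  then show "p \<in> (\<lambda>(z, u, v). ptH (vec4 i j k z 1 u v)) ` (SIGMA z:unity n. unit_sums i j k l z)"
    using mem by (auto intro!: rev_image_eqI[OF mem])
qed

lemma finite_common_points: "finite common_points"
proof -
  have d4: "distinct [0, 1, 2, 3 :: 4]" by simp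
  show ?thesis
    by (rule finite_subset[OF common_points_subset[OF d4]])
      (intro finite_imageI finite_SigmaI finite_unity[OF n] finite_unit_sums)
qed

lemma card_common_points_le:
  assumes d4: "distinct [i, j, k, l]"
  shows "card common_points \<le> (\<Sum>z\<in>unity n. card (unit_sums i j k l z))"
proof -
  let ?S = "SIGMA z:unity n. unit_sums i j k l z"
  have f: "finite ?S" by (intro finite_SigmaI finite_unity[OF n] finite_unit_sums)
  have "card common_points \<le> card ((\<lambda>(z, u, v). ptH (vec4 i j k z 1 u v)) ` ?S)"
    using f by (intro card_mono common_points_subset[OF d4]) auto
  also have "\<dots> \<le> card ?S" by (rule card_image_le[OF f])
  also have "\<dots> = (\<Sum>z\<in>unity n. card (unit_sums i j k l z))"
    by (rule card_SigmaI) (use finite_unity[OF n] finite_unit_sums in auto)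
  finally show ?thesis .
qed

text \<open>Each \<open>z\<close> with \<open>a_i z + a_j \<noteq> 0\<close> admits at most 2
  vanishing sums, or 1 for \<open>n = 2\<close>. The single possible exception admits at most
  \<open>n\<close>, and none unless the opposite pair also has a vanishing coefficient.\<close>

lemma card_common_points_le_coef:
  assumes d4: "distinct [i, j, k, l]" and nz: "\<And>m. a $ m \<noteq> 0"
  shows "int (card common_points) \<le> (if n = 2 then 1 else 2) * (int n - coef_bool i j) + int n * (coef_bool i j * coef_bool k l)"
proof -
  define \<sigma> :: int where "\<sigma> = (if n = 2 then 1 else 2)"
  have b: "int (card (unit_sums i j k l z)) \<le> (if coef_zero i j z then int n * coef_bool k l else \<sigma>)" for z
  proof (cases "coef_zero i j z")
    case True
    then show ?thesis using card_unit_sums_zero nz by simp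
  next
    case False
    then have "a $ i * z + a $ j \<noteq> 0" by (simp add: coef_zero_def)
    then have "card (sols n (a $ k) (a $ i * z + a $ j) (- a $ l)) \<le> (if n = 2 then 1 else 2)"
      using card_sols_le_2[OF n nz, of _ k "- a $ l"] card_sols_2_le_1[OF nz, of _ k "- a $ l"] by simp
    then show ?thesis using card_unit_sums_le_sols[OF nz, of i j k l z] False by (auto simp: \<sigma>_def split: if_splits)
  qed
  have "int (card common_points) \<le> (\<Sum>z\<in>unity n. int (card (unit_sums i j k l z)))"
    using card_common_points_le[OF d4] by (simp flip: of_nat_sum)
  also have "\<dots> \<le> (\<Sum>z\<in>unity n. if coef_zero i j z then int n * coef_bool k l else \<sigma>)"
    by (rule sum_mono) (rule b)
  also have "\<dots> = \<sigma> * (int n - coef_bool i j) + int n * (coef_bool i j * coef_bool k l)"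
  proof (cases "has_coef_zero i j")
    case True
    then obtain z where z: "z \<in> unity n" "coef_zero i j z" by (auto simp: has_coef_zero_def)
    have "(\<Sum>w\<in>unity n. if coef_zero i j w then int n * coef_bool k l else \<sigma>)
       = int n * coef_bool k l + (\<Sum>w\<in>unity n - {z}. if coef_zero i j w then int n * coef_bool k l else \<sigma>)"
      using z finite_unity[OF n] by (simp add: sum.remove[of _ z])
    also have "(\<Sum>w\<in>unity n - {z}. if coef_zero i j w then int n * coef_bool k l else \<sigma>) = (\<Sum>w\<in>unity n - {z}. \<sigma>)"
      by (rule sum.cong) (use coef_zero_unique[OF nz z(2)] in auto)
    also have "\<dots> = \<sigma> * (int n - 1)" using z finite_unity[OF n] card_unity[OF n] n by (simp add: of_nat_diff)
    finally show ?thesis using True by (simp add: coef_bool_def)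
  next
    case False
    have "(\<Sum>w\<in>unity n. if coef_zero i j w then int n * coef_bool k l else \<sigma>) = (\<Sum>w\<in>unity n. \<sigma>)"
      by (rule sum.cong) (use False in \<open>auto simp: has_coef_zero_def\<close>)
    then show ?thesis using False card_unity[OF n] by (simp add: coef_bool_def)
  qed
  finally show ?thesis unfolding \<sigma>_def .
qed

text \<open>Six points would force two solutions for each of the three \<open>z\<close>, and the
  equality case for cube roots gives \<open>a_l^3 = (a_i z + a_j)^3\<close> for all of them.
  Expanding the cube makes \<open>z (a_i z + a_j)\<close> independent of \<open>z\<close>, whereas
  its sum over the cube roots of unity is 0.\<close>

lemma card_common_points_3:
  assumes d4: "distinct [i, j, k, l]" and nz: "\<And>m. a $ m \<noteq> 0" and n3: "n = 3" and h: "\<not> has_coef_zero i j"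
  shows "card common_points \<le> 5"
proof (rule ccontr)
  assume gt: "\<not> card common_points \<le> 5"
  have al: "a $ i * z + a $ j \<noteq> 0" if "z \<in> unity 3" for z
  proof -
    have "z \<in> unity n" using that n3 by simp
    then show ?thesis using h by (auto simp: has_coef_zero_def coef_zero_def)
  qed
  have le: "card (unit_sums i j k l z) \<le> 2" if "z \<in> unity 3" for z
    using card_unit_sums_le_sols[OF nz, of i j k l z] card_sols_le_2[OF n nz al[OF that], of k "- a $ l"] by linarith
  have "card (unit_sums i j k l z) = 2" if z: "z \<in> unity 3" for z
  proof (rule ccontr)
    assume ne: "card (unit_sums i j k l z) \<noteq> 2"
    have f: "finite (unity 3)" and c3: "card (unity 3) = 3" using finite_unity[of 3] card_unity[of 3] by auto
    have "(\<Sum>w\<in>unity 3. card (unit_sums i j k l w)) = card (unit_sums i j k l z) + (\<Sum>w\<in>unity 3 - {z}. card (unit_sums i j k l w))"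
      using z f by (simp add: sum.remove[of _ z])
    also have "\<dots> \<le> 1 + (\<Sum>w\<in>unity 3 - {z}. 2)"
      using le[OF z] ne by (intro add_mono sum_mono le) auto
    also have "\<dots> = 5" using z f c3 by simp
    finally show False using card_common_points_le[OF d4] gt n3 by simp
  qed
  then have two: "card (sols 3 (a $ k) (a $ i * z + a $ j) (- a $ l)) = 2" if "z \<in> unity 3" for z
    using card_unit_sums_le_sols[OF nz, of i j k l z] card_sols_le_2[OF n nz al[OF that], of k "- a $ l"] that n3 by force
  have cube: "a $ l ^ 3 = (a $ i * z + a $ j) ^ 3" if "z \<in> unity 3" for z
    using card_sols_3_eq_2[OF nz al[OF that] two[OF that]] by simp
  obtain w where w: "w \<in> unity 3" "w \<noteq> 1" using ex_unity_ne_1[of 3] by auto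
  have w3: "w ^ 3 = 1" using w by (simp add: unity_def)
  have "(w - 1) * (w\<^sup>2 + w + 1) = w ^ 3 - 1" by (simp add: power2_eq_square power3_eq_cube algebra_simps)
  then have w1: "w\<^sup>2 + w + 1 = 0" using w w3 by simp
  have w2: "w\<^sup>2 \<in> unity 3" unfolding power2_eq_square by (rule unity_mult[OF w(1) w(1)])
  let ?K = "\<lambda>z. z * (a $ i * z + a $ j)"
  have K: "3 * (a $ i * a $ j) * ?K z = a $ l ^ 3 - a $ i ^ 3 - a $ j ^ 3" if "z \<in> unity 3" for z
  proof -
    have z3: "z ^ 3 = 1" using that by (simp add: unity_def)
    have "(a $ i * z + a $ j) ^ 3 = a $ i ^ 3 * z ^ 3 + a $ j ^ 3 + 3 * (a $ i * a $ j) * ?K z"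
      by (simp add: power3_eq_cube algebra_simps)
    then show ?thesis using cube[OF that] z3 by simp
  qed
  have eqK: "?K z = ?K 1" if "z \<in> unity 3" for z
  proof -
    have "3 * (a $ i * a $ j) * ?K z = 3 * (a $ i * a $ j) * ?K 1"
      using K[OF that] K[OF one_in_unity] by simp
    then show ?thesis using nz[of i] nz[of j] by simp
  qed
  have w4: "w\<^sup>2 * w\<^sup>2 = w" using w3 by (simp add: power2_eq_square power3_eq_cube mult.assoc)
  have "3 * ?K 1 = ?K 1 + ?K w + ?K (w\<^sup>2)" using eqK[OF w(1)] eqK[OF w2] by simp
  also have "\<dots> = a $ i * (1 + w\<^sup>2 + w\<^sup>2 * w\<^sup>2) + a $ j * (w\<^sup>2 + w + 1)"
    by (simp add: power2_eq_square algebra_simps)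
  also have "\<dots> = 0" using w1 w4 by (simp add: add_ac)
  finally have "3 * ?K 1 = 0" .
  then show False using al[OF one_in_unity] by (metis mult_1 mult_eq_0_iff zero_neq_numeral)
qed

text \<open>Bad pairs give points with four equal powers for which
  \<open>a_i z + a_j \<noteq> 0\<close>. If both pairs have a vanishing coefficient, at
  \<open>z0\<close> and \<open>w0\<close>, the points \<open>(z0, 1, w0 t, t)\<close> are
  \<open>n\<close> further ones, distinguished by \<open>a_i z0 + a_j = 0\<close>.\<close>

lemma bad_pairs_common_points:
  assumes d4: "distinct [i, j, k, l]" and nz: "\<And>m. a $ m \<noteq> 0"
  shows "int (card (bad_pairs i j k l)) + int n * (coef_bool i j * coef_bool k l) \<le> int (card common_points)"
proof -
  let ?f = "\<lambda>q. ptH (grid_point i j k l q)"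
  have f_sub: "?f ` bad_pairs i j k l \<subseteq> common_points"
  proof clarify
    fix z w assume b: "(z, w) \<in> bad_pairs i j k l"
    let ?y = "grid_point i j k l (z, w)"
    have y: "?y \<in> hyp a" by (rule grid_point_hyp[OF d4])
    have "?y $ j \<noteq> 0" using b by (auto simp: bad_pairs_def grid_point_nth(2)[OF d4])
    then have y0: "?y \<noteq> 0" by auto
    have e: "?y $ i = z * ?y $ j" "?y $ k = w * ?y $ l"
      unfolding grid_point_nth[OF d4] by (simp_all only: mult_minus_right)
    have "?y $ i ^ n = ?y $ j ^ n" "?y $ k ^ n = ?y $ l ^ n"
      unfolding e power_mult_distrib using b by (auto simp: bad_pairs_def unity_def)
    moreover have "?y $ j ^ n = ?y $ l ^ n"
      unfolding grid_point_nth[OF d4] using b unfolding bad_pairs_def by blast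
    ultimately have "\<forall>m. ?y $ m ^ n = ?y $ l ^ n" using all4[OF d4, of "\<lambda>m. ?y $ m ^ n = ?y $ l ^ n"] by simp
    then have "all_eq n ?y" unfolding all_eq_def by metis
    then show "?f (z, w) \<in> common_points" using y y0 by (auto simp: common_points_def)
  qed
  have inj_f: "inj_on ?f (bad_pairs i j k l)"
    by (rule inj_on_subset[OF grid_point_inj[OF d4]]) (auto simp: bad_pairs_def)
  show ?thesis
  proof (cases "has_coef_zero i j \<and> has_coef_zero k l")
    case False
    then show ?thesis using card_inj_on_le[OF inj_f f_sub finite_common_points] by (auto simp: coef_bool_def)
  next
    case True
    then obtain z0 w0 where zw: "z0 \<in> unity n" "coef_zero i j z0" "w0 \<in> unity n" "coef_zero k l w0"
      by (auto simp: has_coef_zero_def)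
    let ?v = "\<lambda>t. vec4 i j k z0 1 (w0 * t) t" and ?g = "\<lambda>t. ptH (vec4 i j k z0 1 (w0 * t) t)"
    have v: "?v t \<in> hyp a" for t
    proof -
      have "a $ i * z0 + a $ j + a $ k * (w0 * t) + a $ l * t = (a $ i * z0 + a $ j) + (a $ k * w0 + a $ l) * t"
        by (simp add: algebra_simps)
      then show ?thesis using zw by (simp add: hyp_def dot_vec4[OF d4] coef_zero_def)
    qed
    have v0: "?v t \<noteq> 0" for t by (metis vec4_nth(2)[OF d4] zero_index zero_neq_one)
    have g_sub: "?g ` unity n \<subseteq> common_points"
    proof clarify
      fix t assume t: "t \<in> unity n"
      have "\<forall>m. ?v t $ m ^ n = 1"
        using all4[OF d4, of "\<lambda>m. ?v t $ m ^ n = 1"] zw t by (simp add: vec4_nth[OF d4] unity_def power_mult_distrib)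
      then have "all_eq n (?v t)" unfolding all_eq_def by metis
      then show "?g t \<in> common_points" using v[of t] v0[of t] by (auto simp: common_points_def)
    qed
    have inj_g: "inj_on ?g (unity n)"
    proof (rule inj_onI)
      fix t u assume "?g t = ?g u"
      then obtain c where c: "?v u = c *s ?v t" using ptH_eqD[OF v v v0] by blast
      have s: "?v u $ m = c * ?v t $ m" for m unfolding c by simp
      show "t = u" using s[of j] s[of l] by (simp add: vec4_nth[OF d4])
    qed
    have disj: "?f ` bad_pairs i j k l \<inter> ?g ` unity n = {}"
    proof (rule ccontr)
      assume "\<not> ?thesis"
      then obtain z w t where b: "(z, w) \<in> bad_pairs i j k l" "?f (z, w) = ?g t" by auto
      have "grid_point i j k l (z, w) $ j \<noteq> 0" using b(1) by (auto simp: bad_pairs_def grid_point_nth(2)[OF d4])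
      then have y0: "grid_point i j k l (z, w) \<noteq> 0" by auto
      obtain c where c: "c \<noteq> 0" "?v t = c *s grid_point i j k l (z, w)"
        using ptH_eqD[OF grid_point_hyp[OF d4] v y0 b(2)] by blast
      have s: "?v t $ m = c * grid_point i j k l (z, w) $ m" for m unfolding c(2) by simp
      have "z0 = c * (z * (a $ k * w + a $ l))" "1 = c * (a $ k * w + a $ l)"
        using s[of i] s[of j] by (simp_all only: vec4_nth[OF d4] grid_point_nth[OF d4])
      then have "z0 = z" by (metis mult.left_commute mult.right_neutral)
      then show False using b(1) zw(2) by (auto simp: bad_pairs_def coef_zero_def)
    qed
    have "finite (bad_pairs i j k l)"
      using inj_f f_sub finite_common_points finite_imageD finite_subset by blast
    then have "card (?f ` bad_pairs i j k l \<union> ?g ` unity n) = card (bad_pairs i j k l) + n"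
      using disj finite_unity[OF n] by (simp add: card_Un_disjoint card_image inj_f inj_g card_unity[OF n])
    moreover have "card (?f ` bad_pairs i j k l \<union> ?g ` unity n) \<le> card common_points"
      using f_sub g_sub by (intro card_mono finite_common_points) auto
    ultimately show ?thesis using True by (simp add: coef_bool_def)
  qed
qed

text \<open>When both pairs have a vanishing coefficient, the two corresponding lines of the block
  coincide, since each passes through the centre of the other pencil.\<close>

lemma card_set_blk_le:
  assumes d4: "distinct [i, j, k, l]" and nz: "\<And>m. a $ m \<noteq> 0"
  shows "int (card (set_mset (blk i j k l))) \<le> 2 * int n - coef_bool i j * coef_bool k l"
proof (cases "has_coef_zero i j \<and> has_coef_zero k l")
  case False
  then show ?thesis using card_set_mset_le_size[of "blk i j k l"] size_blk by (auto simp: coef_bool_def)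
next
  case True
  then obtain z w where zw: "z \<in> unity n" "coef_zero i j z" "w \<in> unity n" "coef_zero k l w"
    by (auto simp: has_coef_zero_def)
  have "ln i j z \<subseteq> ln k l w"
  proof
    fix x assume "x \<in> ln i j z"
    then have e: "(P *v x) $ i = z * (P *v x) $ j" by (simp add: mem_ln)
    have al: "a $ l = - (a $ k * w)" using zw(4) by (simp add: coef_zero_def eq_neg_iff_add_eq_0 add.commute)
    have "dot a (P *v x) = 0" using P_in_hyp by (simp add: hyp_def)
    then have "(a $ i * z + a $ j) * (P *v x) $ j + a $ k * ((P *v x) $ k - w * (P *v x) $ l) = 0"
      by (simp add: dot4[OF d4] e al algebra_simps)
    then have "(P *v x) $ k = w * (P *v x) $ l" using zw(2) nz[of k] by (simp add: coef_zero_def)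
    then show "x \<in> ln k l w" by (simp add: mem_ln)
  qed
  then have "ln i j z = ln k l w"
    by (rule line_subset_eq[rotated 2]) (use d4 zw in \<open>auto intro!: is_line_ln\<close>)
  then have "set_mset (blk i j k l) \<subseteq> ln i j ` (unity n - {z}) \<union> ln k l ` unity n"
    using zw by (auto simp: set_blk)
  then have "card (set_mset (blk i j k l)) \<le> card (ln i j ` (unity n - {z}) \<union> ln k l ` unity n)"
    using finite_unity[OF n] by (intro card_mono) auto
  also have "\<dots> \<le> card (ln i j ` (unity n - {z})) + card (ln k l ` unity n)" by (rule card_Un_le)
  also have "\<dots> \<le> card (unity n - {z}) + card (unity n)"
    using finite_unity[OF n] by (intro add_mono card_image_le) auto
  also have "\<dots> = (n - 1) + n" using zw finite_unity[OF n] card_unity[OF n] by simp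
  finally show ?thesis using True n by (simp add: coef_bool_def)
qed

lemma no_zero:
  assumes nz: "\<And>m. a $ m \<noteq> 0"
  shows "n = 2 \<and> (\<forall>i j. (a $ i)\<^sup>2 = (a $ j)\<^sup>2)"
proof -
  have G0: "G = {#}" using G_imp_one_zero nz by (metis multiset_nonemptyE)
  have dn: "int d = 2 * int n" using size_G G0 by simp
  define s where "s = int (card common_points)"
  have "coord_points = {}" using nz by (auto simp: coord_points_def)
  moreover have "(\<Sum>p\<in>base_locus W \<inter> common_points. 1 - int (gmult p)) \<le> s"
  proof -
    have "(\<Sum>p\<in>base_locus W \<inter> common_points. 1 - int (gmult p)) \<le> (\<Sum>p\<in>base_locus W \<inter> common_points. 1)"
      by (rule sum_mono) simp
    also have "\<dots> = int (card (base_locus W \<inter> common_points))" by simp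
    also have "\<dots> \<le> s" unfolding s_def by (simp add: card_mono finite_common_points)
    finally show ?thesis .
  qed
  moreover define i j k l :: 4 where "i = 0" and "j = 1" and "k = 2" and "l = 3"
  have d1: "distinct [i, j, k, l]" and d2: "distinct [i, k, j, l]" and d3: "distinct [i, l, j, k]"
    and d1': "distinct [k, l, i, j]" and d2': "distinct [j, l, i, k]" and d3': "distinct [j, k, i, l]"
    by (simp_all add: i_def j_def k_def l_def)
  let ?\<Phi>s = "[grid_pred n i j k l, grid_pred n i k j l, grid_pred n i l j k,
     centre_pred i j k l, centre_pred k l i j, centre_pred i k j l, centre_pred j l i k,
     centre_pred i l j k, centre_pred j k i l]"
  have "3 * int d + 3 + (\<Sum>\<Phi>\<leftarrow>?\<Phi>s. excess \<Phi>) \<le> 2 * int (card (lines_of A)) +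
    (\<Sum>p\<in>base_locus W \<inter> common_points. 1 - int (gmult p)) +
    (\<Sum>l\<in>coord_points. int n - 1 - int (gmult (ptH (axis l 1))))"
  proof (rule main_inequality)
    show "homog_pred \<Phi>" if "\<Phi> \<in> set ?\<Phi>s" for \<Phi>
      using that homog_pred_grid homog_pred_centre by auto
    show "sorted_wrt (\<lambda>\<Phi> \<Psi>. \<forall>y. \<not> (\<Phi> y \<and> \<Psi> y)) ?\<Phi>s"
      by (auto simp: grid_pred_def centre_pred_def)
  qed
  ultimately have main: "3 * int d + 3 + (\<Sum>\<Phi>\<leftarrow>?\<Phi>s. excess \<Phi>) \<le> 2 * int (card (lines_of A)) + s" by simp
  define m where "m i j k l = coef_bool i j + coef_bool k l - coef_bool i j * coef_bool k l" for i j k l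
  define c where "c i j k l = coef_bool i j * coef_bool k l" for i j k l
  \<comment> \<open>One coincidence costs \<open>n\<close> grid points but adds a line through a
    centre. Two cost \<open>2 n - 1\<close> grid points, but the shared line carries
    \<open>n\<close> of the \<open>s\<close> points, which lowers the bound for the bad pairs. The
    net loss is \<open>n - 1\<close> in both cases.\<close>
  have block: "int n * int n - (int n - 1) * m i j k l - s + 2 * (int n - 1) \<le>
      excess (grid_pred n i j k l) + excess (centre_pred i j k l) + excess (centre_pred k l i j)"
    if d4: "distinct [i, j, k, l]" and d4': "distinct [k, l, i, j]" for i j k l
  proof -
    have g: "(int n - coef_bool i j) * (int n - coef_bool k l) - int (card (bad_pairs i j k l)) \<le> excess (grid_pred n i j k l)"
      using grid_excess[OF d4] num_coef_eq[OF nz] by (simp add: coef_bool_def)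
    have b: "int (card (bad_pairs i j k l)) + int n * (coef_bool i j * coef_bool k l) \<le> s"
      using bad_pairs_common_points[OF d4 nz] by (simp add: s_def)
    have e1: "int n - 1 + of_bool (has_coef_zero k l \<and> \<not> has_coef_zero i j) \<le> excess (centre_pred i j k l)"
      using centre_excess[OF d4 n2 nz nz] by (simp add: has_coef_zero_def)
    have e2: "int n - 1 + of_bool (has_coef_zero i j \<and> \<not> has_coef_zero k l) \<le> excess (centre_pred k l i j)"
      using centre_excess[OF d4' n2 nz nz] by (simp add: has_coef_zero_def)
    show ?thesis using g b e1 e2
      by (cases "has_coef_zero i j"; cases "has_coef_zero k l") (simp_all add: m_def coef_bool_def algebra_simps)
  qed
  have L: "int (card (lines_of A)) \<le> 6 * int n - (c i j k l + c i k j l + c i l j k)"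
    using card_lines_of_le_blk[OF d1] card_set_blk_le[OF d1 nz] card_set_blk_le[OF d2 nz] card_set_blk_le[OF d3 nz]
    unfolding c_def by linarith
  have cb: "coef_bool i j \<in> {0, 1}" for i j by (simp add: coef_bool_def)
  have mc: "m i j k l \<in> {0, 1} \<and> c i j k l \<in> {0, m i j k l}" for i j k l
    using cb[of i j] cb[of k l] by (auto simp: m_def c_def)
  \<comment> \<open>The bound is applied to both orders of the two pairs, so that one coincidence in
    either pair already improves it.\<close>
  have sb: "s \<le> (if int n = 2 then 1 else 2) * (int n - m i j k l) + (if int n = 2 then 2 else int n) * c i j k l"
    if d4: "distinct [i, j, k, l]" and d4': "distinct [k, l, i, j]" for i j k l
    using card_common_points_le_coef[OF d4 nz] card_common_points_le_coef[OF d4' nz] cb[of i j] cb[of k l]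
    by (auto simp: m_def c_def s_def)
  have s3: "s \<le> 5" if n3: "int n = 3" and m0: "m i j k l = 0" and d4: "distinct [i, j, k, l]" for i j k l
  proof -
    have "\<not> has_coef_zero i j" using m0 cb[of k l] by (auto simp: m_def coef_bool_def of_bool_def split: if_splits)
    then show ?thesis using card_common_points_3[OF d4 nz] n3 by (simp add: s_def)
  qed
  \<comment> \<open>Three pairwise opposite cubes of nonzero numbers cannot exist.\<close>
  have n3: "c i j k l + c i k j l + c i l j k \<noteq> 3" if "int n = 3"
  proof
    assume "c i j k l + c i k j l + c i l j k = 3"
    then have h: "has_coef_zero i j" "has_coef_zero i k" "has_coef_zero j k"
      by (auto simp: c_def coef_bool_def of_bool_def split: if_splits)
    have "a $ i ^ 3 = - (a $ j ^ 3)" "a $ i ^ 3 = - (a $ k ^ 3)" "a $ j ^ 3 = - (a $ k ^ 3)"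
      using has_coef_zero_power[OF h(1)] has_coef_zero_power[OF h(2)] has_coef_zero_power[OF h(3)] that by simp_all
    then have "a $ i ^ 3 = - (a $ i ^ 3)" by simp
    then show False using nz by simp
  qed
  have "int n = 2 \<and> c i j k l = 1 \<and> c i k j l = 1 \<and> c i l j k = 1"
  proof (rule no_zero_arithmetic)
    show "3 * (int n * int n) - (int n - 1) * (m i j k l + m i k j l + m i l j k)
        + 2 * (c i j k l + c i k j l + c i l j k) - 3 \<le> 4 * s"
      using main block[OF d1 d1'] block[OF d2 d2'] block[OF d3 d3'] L dn by (simp add: algebra_simps)
  qed (use n2 mc sb[OF d1 d1'] sb[OF d2 d2'] sb[OF d3 d3'] s3[OF _ _ d1] s3[OF _ _ d2] s3[OF _ _ d3] n3 in auto)
  then have n2': "n = 2" and h: "has_coef_zero i j" "has_coef_zero i k" "has_coef_zero i l"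
    by (auto simp: c_def coef_bool_def of_bool_def split: if_splits)
  have "(a $ i)\<^sup>2 = (a $ j)\<^sup>2" "(a $ i)\<^sup>2 = (a $ k)\<^sup>2" "(a $ i)\<^sup>2 = (a $ l)\<^sup>2"
    using has_coef_zero_power[OF h(1)] has_coef_zero_power[OF h(2)] has_coef_zero_power[OF h(3)] n2' by simp_all
  then have "\<forall>m. (a $ m)\<^sup>2 = (a $ i)\<^sup>2" using all4[OF d1, of "\<lambda>m. (a $ m)\<^sup>2 = (a $ i)\<^sup>2"] by metis
  then show ?thesis using n2' by metis
qed

end

section \<open>Coordinates\<close>

text \<open>An explicit block of G(n,1,3), used to evaluate the definite description in
  \<open>block_of\<close>.\<close>

definition coord_block :: "nat \<Rightarrow> 3 \<Rightarrow> 3 \<Rightarrow> 3 \<Rightarrow> pline multiset" where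
  "coord_block n p q r = replicate_mset n {v. v $ p = 0} +
     image_mset (\<lambda>z. {v. v $ q = z * v $ r}) (mset_set (unity n))"

lemma sum_singletons: "finite S \<Longrightarrow> (\<Sum>z\<in>S. {#f z#}) = image_mset f (mset_set S)"
  by (induction S rule: finite_induct) auto

lemma axis3_nonzero: "(axis p 1 :: complex ^ 3) \<noteq> 0"
  by (metis axis_nth zero_index zero_neq_one)

lemma dot_commute: "dot a x = dot x a"
  by (simp add: dot_def mult.commute)

lemma dot_axis_left: "dot (axis i c) x = c * x $ i"
  by (metis dot_axis dot_commute mult.commute)

lemma splits_power_diff:
  fixes f g :: "3 mpoly"
  assumes n: "n \<ge> 1" and ab: "\<And>x. eval_poly f x = dot a x" "\<And>x. eval_poly g x = dot b x"
    and nz: "\<And>z. z \<in> unity n \<Longrightarrow> a - z *s b \<noteq> 0"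
  shows "splits_into (f ^ n - g ^ n) (image_mset (\<lambda>z. hyp (a - z *s b)) (mset_set (unity n)))"
proof -
  have "f ^ n - g ^ n = (\<Prod>z\<in>unity n. lin (a - z *s b))"
    by (rule mpoly_eqI) (simp add: ab power_diff_eq_prod_unity[OF n] dot_diff_left)
  moreover have "splits_into (\<Prod>z\<in>unity n. lin (a - z *s b)) (\<Sum>z\<in>unity n. {#hyp (a - z *s b)#})"
    by (rule splits_into_prod[OF finite_unity[OF n]]) (rule splits_into_lin[OF nz])
  ultimately show ?thesis by (simp add: sum_singletons finite_unity[OF n])
qed

lemma splits_coord_block:
  assumes n: "n \<ge> 1" and qr: "q \<noteq> r"
  shows "splits_into (Var p ^ n * (Var q ^ n - Var r ^ n)) (coord_block n p q r)"
proof -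
  have "Var p = lin (axis p 1)" by (rule mpoly_eqI) (simp add: dot_axis_left)
  then have "splits_into (Var p) {#hyp (axis p 1)#}"
    using splits_into_lin[OF axis3_nonzero] by simp
  then have 1: "splits_into (Var p ^ n) (repeat_mset n {#hyp (axis p 1)#})"
    by (rule splits_into_power)
  have "axis q 1 - z *s axis r 1 \<noteq> (0 :: complex ^ 3)" for z
  proof
    assume "axis q 1 - z *s axis r 1 = (0 :: complex ^ 3)"
    then have "(axis q 1 - z *s axis r 1) $ q = (0 :: complex)" by simp
    then show False using qr by (simp add: axis_def)
  qed
  then have 2: "splits_into (Var q ^ n - Var r ^ n)
      (image_mset (\<lambda>z. hyp (axis q 1 - z *s axis r 1)) (mset_set (unity n)))"
    by (intro splits_power_diff[OF n]) (simp_all add: dot_axis_left)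
  have "hyp (axis p 1) = {v. v $ p = 0}" "hyp (axis q 1 - z *s axis r 1) = {v. v $ q = z * v $ r}"
    for z and p q r :: 3
    by (auto simp: hyp_def dot_axis_left dot_diff_left)
  then show ?thesis using splits_into_mult[OF 1 2] by (simp add: coord_block_def)
qed

lemma G_multinet_eq:
  "n \<ge> 1 \<Longrightarrow> G_multinet n = [coord_block n 1 2 3, coord_block n 2 1 3, coord_block n 3 1 2]"
  unfolding G_multinet_def by (simp add: block_of_eq[OF splits_coord_block])

lemma A3_net_eq: "A3_net = G_multinet 1"
  by (simp add: A3_net_def G_multinet_def)

lemma image_Collect_inj:
  fixes T :: "complex ^ 3 ^ 3"
  assumes T: "inj ((*v) T)"
  shows "(\<lambda>v. T *v v) ` {x. \<phi> (T *v x)} = {v. \<phi> v}"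
proof -
  have "surj ((*v) T)"
    using T matrix_left_invertible_injective[of T] matrix_right_invertible_surjective[of T] matrix_left_right_inverse by metis
  then have "v \<in> (\<lambda>v. T *v v) ` {x. \<phi> (T *v x)}" if "\<phi> v" for v
    using that by (metis (mono_tags, lifting) image_eqI mem_Collect_eq surj_def)
  then show ?thesis by auto
qed

lemma proj_equiv_G_multinetI:
  fixes T :: "complex ^ 3 ^ 3"
  assumes n: "n \<ge> 1" and T: "inj ((*v) T)" and A: "mset A = {#X, Y, Z#}"
    and im: "image_mset (\<lambda>l. (\<lambda>v. T *v v) ` l) X = coord_block n 1 2 3"
      "image_mset (\<lambda>l. (\<lambda>v. T *v v) ` l) Y = coord_block n 2 1 3"
      "image_mset (\<lambda>l. (\<lambda>v. T *v v) ` l) Z = coord_block n 3 1 2"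
  shows "proj_equiv A (G_multinet n)"
proof -
  have "invertible T" using T by (simp add: invertible_left_inverse matrix_left_invertible_injective)
  moreover have "mset (map (image_mset (\<lambda>l. (\<lambda>v. T *v v) ` l)) A) = mset (G_multinet n)"
    by (simp add: A im G_multinet_eq[OF n])
  ultimately show ?thesis unfolding proj_equiv_def by blast
qed

text \<open>The transpose maps four dimensions to three, so it has a nonzero kernel vector, which is
  normal to the range of \<open>P\<close>. Comparing dimensions gives equality.\<close>

lemma ex_hyp_range:
  fixes P :: "complex ^ 3 ^ 4"
  assumes P: "inj ((*v) P)"
  shows "\<exists>a. a \<noteq> 0 \<and> range ((*v) P) = hyp a"
proof -
  let ?B = "transpose P"
  have dim3: "vec.dim (UNIV :: (complex ^ 3) set) = 3" and dim4: "vec.dim (UNIV :: (complex ^ 4) set) = 4"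
    by (subst vec_dim_card, simp)+
  have "\<not> inj ((*v) ?B)"
  proof
    assume "inj ((*v) ?B)"
    then have "vec.dim (range ((*v) ?B)) = vec.dim (UNIV :: (complex ^ 4) set)"
      by (intro vec.dim_image_eq) (auto intro: inj_on_subset)
    moreover have "vec.dim (range ((*v) ?B)) \<le> CARD(3)" by (rule dim_subset_UNIV_cart_gen)
    ultimately show False using dim4 by simp
  qed
  then obtain a where a: "a \<noteq> 0" "?B *v a = 0" by (auto simp: vec.inj_iff_eq_0)
  have dot_P: "dot a (P *v x) = dot (?B *v a) x" for x
  proof -
    have "dot a (P *v x) = (\<Sum>i\<in>UNIV. \<Sum>j\<in>UNIV. a $ i * (P $ i $ j * x $ j))"
      by (simp add: dot_def matrix_vector_mult_def sum_distrib_left)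
    also have "\<dots> = (\<Sum>j\<in>UNIV. \<Sum>i\<in>UNIV. a $ i * (P $ i $ j * x $ j))" by (rule sum.swap)
    also have "\<dots> = dot (?B *v a) x"
      by (simp add: dot_def matrix_vector_mult_def transpose_def sum_distrib_left mult_ac)
    finally show ?thesis .
  qed
  have sub: "range ((*v) P) \<subseteq> hyp a" using a dot_P by (auto simp: hyp_def)
  have subsp: "vec.subspace (hyp a)" by (simp add: vec.subspace_def hyp_def dot_add_right)
  have "hyp a \<noteq> UNIV" using dot_nonzero[OF a(1)] by (auto simp: hyp_def)
  then have "vec.dim (hyp a) < vec.dim (UNIV :: (complex ^ 4) set)"
    using vec.subspace_dim_equal[OF subsp vec.subspace_UNIV] by force
  then have d3: "vec.dim (hyp a) \<le> 3" using dim4 by linarith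
  have "vec.dim (range ((*v) P)) = vec.dim (UNIV :: (complex ^ 3) set)"
    using P by (intro vec.dim_image_eq) (auto intro: inj_on_subset)
  then have "vec.dim (hyp a) \<le> vec.dim (range ((*v) P))" using d3 dim3 by linarith
  then have "range ((*v) P) = hyp a"
    by (intro vec.subspace_dim_equal[OF _ subsp sub] vec.subspace_image vec.subspace_UNIV)
  then show ?thesis using a(1) by blast
qed

section \<open>From planes of the arrangement to traces in coordinates\<close>

lemma diff_dvd_power_diff:
  fixes x y :: "'a::comm_ring_1"
  shows "x - y dvd x ^ n - y ^ n"
proof (cases n)
  case (Suc m)
  then show ?thesis using diff_power_eq_sum[of x m y] by simp
qed simp

lemma Const_power: "Const (c ^ n) = Const c ^ n"
  by (induction n) (simp_all add: Const_mult)

lemma diff_dvd_commute: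
  fixes x y z :: "'a::comm_ring_1"
  shows "x - y dvd z \<longleftrightarrow> y - x dvd z"
  by (metis minus_diff_eq minus_dvd_iff)

lemma power_diff_dvd_Q:
  assumes "i \<noteq> j"
  shows "(Var i ^ n - Var j ^ n :: 4 mpoly) dvd prod_list (Q_blocks n)"
proof -
  have d: "distinct [0, 1, 2, 3 :: 4]" by simp
  let ?v = "\<lambda>i. Var i ^ n :: 4 mpoly"
  have six: "x dvd p * q * (r * s) * (t * u)" if "x \<in> {p, q, r, s, t, u}" for x p q r s t u :: "4 mpoly"
    using that by (auto intro: dvd_mult dvd_mult2)
  have le: "?v i - ?v j dvd prod_list (Q_blocks n)"
    if "(i, j) \<in> {(0, 1), (2, 3), (0, 2), (1, 3), (0, 3), (1, 2)}" for i j
  proof -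
    have "prod_list (Q_blocks n) = (?v 0 - ?v 1) * (?v 2 - ?v 3) * ((?v 0 - ?v 2) * (?v 1 - ?v 3))
       * ((?v 0 - ?v 3) * (?v 1 - ?v 2))"
      by (simp add: Q_blocks_def mult.assoc)
    moreover have "?v i - ?v j \<in> {?v 0 - ?v 1, ?v 2 - ?v 3, ?v 0 - ?v 2, ?v 1 - ?v 3, ?v 0 - ?v 3, ?v 1 - ?v 2}"
      using that by blast
    ultimately show ?thesis using six by metis
  qed
  have "(i, j) \<in> {(0, 1), (2, 3), (0, 2), (1, 3), (0, 3), (1, 2)} \<or> (j, i) \<in> {(0, 1), (2, 3), (0, 2), (1, 3), (0, 3), (1, 2)}"
    using cases4[OF d, of i] cases4[OF d, of j] assms by auto
  then show ?thesis
  proof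
    assume "(j, i) \<in> {(0, 1), (2, 3), (0, 2), (1, 3), (0, 3), (1, 2)}"
    then show ?thesis using le[of j i] by (subst diff_dvd_commute)
  qed (rule le)
qed

text \<open>If the plane were \<open>y_i = z y_j\<close>, the form
  \<open>Var i - Const z * Var j\<close> would divide \<open>Var i ^ n - Var j ^ n\<close> and hence
  the product of the three blocks.\<close>

lemma Q_trace_of_plane:
  assumes n: "n \<ge> 1" and P: "inj ((*v) P)" and H: "range ((*v) P) \<notin> Q_planes n"
  shows "\<exists>a. Q_trace n P a"
proof -
  obtain a where a: "a \<noteq> 0" "range ((*v) P) = hyp a" using ex_hyp_range[OF P] by blast
  have "\<exists>y\<in>hyp a. y $ i \<noteq> z * y $ j" if ij: "i \<noteq> j" and z: "z \<in> unity n" for i j z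
  proof (rule ccontr)
    assume *: "\<not> ?thesis"
    let ?b = "axis i 1 - z *s axis j 1 :: complex ^ 4"
    have "?b $ i \<noteq> 0" using ij by (simp add: axis_def)
    then have b: "?b \<noteq> 0" by (metis zero_index)
    have hb: "hyp ?b = {y. y $ i = z * y $ j}" by (auto simp: hyp_def dot_diff_left dot_axis_left)
    then have "hyp a \<subseteq> hyp ?b" using * by auto
    then have ab: "hyp a = hyp ?b" using hyp_subset_imp_scale[OF a(1) b] hyp_scale by metis
    let ?\<alpha> = "Var i - Const z * Var j :: 4 mpoly"
    have "homogeneous 1 ?\<alpha>"
      using homogeneous_mult[OF homogeneous_Const homogeneous_Var, of z j] homogeneous_Var
      by (intro homogeneous_diff) auto
    moreover have "?\<alpha> \<noteq> 0"
    proof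
      assume "?\<alpha> = 0"
      then have "eval_poly ?\<alpha> (axis i 1) = 0" by simp
      then show False using ij by (simp add: axis_def)
    qed
    moreover have "?\<alpha> dvd prod_list (Q_blocks n)"
    proof -
      have "(Const z * Var j :: 4 mpoly) ^ n = Var j ^ n"
        using z by (simp add: power_mult_distrib Const_power[symmetric] unity_def)
      then have "?\<alpha> dvd Var i ^ n - Var j ^ n" using diff_dvd_power_diff[of "Var i" "Const z * Var j" n] by simp
      then show ?thesis using power_diff_dvd_Q[OF ij] dvd_trans by blast
    qed
    moreover have "zero_set ?\<alpha> = hyp a" unfolding ab hb by (auto simp: zero_set_def)
    ultimately have "hyp a \<in> Q_planes n" unfolding Q_planes_def linear_form_def by blast
    then show False using H a by simp
  qed
  then have "Q_trace n P a" using n a P by unfold_locales auto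
  then show ?thesis by blast
qed

lemma eval_restrict_along: "eval_poly (restrict_along P f) x = eval_poly f (P *v x)"
proof -
  have "(\<chi> i. eval_poly (\<Sum>j\<in>UNIV. Const (P $ i $ j) * Var j) x) = P *v x"
    by (simp add: matrix_vector_mult_def)
  then show ?thesis by (simp add: restrict_along_def eval_subst)
qed

context Q_trace
begin

lemma splits_restrict_along_pair:
  assumes "i \<noteq> j" "k \<noteq> l"
  shows "splits_into (restrict_along P ((Var i ^ n - Var j ^ n) * (Var k ^ n - Var l ^ n))) (blk i j k l)"
proof -
  have nz: "P $ i - z *s P $ j \<noteq> 0" if ij: "i \<noteq> j" "z \<in> unity n" for i j z
  proof
    assume "P $ i - z *s P $ j = 0"
    then have "ln i j z = UNIV" by (auto simp: ln_def hyp_def)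
    moreover obtain b where "b \<noteq> 0" "ln i j z = hyp b" using is_line_ln[OF ij] by (auto simp: is_line_def)
    ultimately show False using dot_nonzero[of b] by (auto simp: hyp_def)
  qed
  have ln_eq: "ln i j = (\<lambda>z. hyp (P $ i - z *s P $ j))" for i j by (rule ext) (simp add: ln_def)
  have s: "splits_into (lin (P $ i) ^ n - lin (P $ j) ^ n) (image_mset (ln i j) (mset_set (unity n)))" if "i \<noteq> j" for i j
    using splits_power_diff[OF n, of "lin (P $ i)" "P $ i" "lin (P $ j)" "P $ j"] nz[OF that] ln_eq[of i j] by simp
  have "restrict_along P ((Var i ^ n - Var j ^ n) * (Var k ^ n - Var l ^ n)) =
      (lin (P $ i) ^ n - lin (P $ j) ^ n) * (lin (P $ k) ^ n - lin (P $ l) ^ n)"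
    by (rule mpoly_eqI) (simp add: eval_restrict_along P_nth)
  then show ?thesis unfolding blk_def using splits_into_mult[OF s[OF assms(1)] s[OF assms(2)]] by simp
qed

lemma splits_restrict_along: "b < 3 \<Longrightarrow> splits_into (restrict_along P (Q_blocks n ! b)) (blocks ! b)"
proof -
  have "splits_into (restrict_along P (Q_blocks n ! 0)) (blocks ! 0)"
    "splits_into (restrict_along P (Q_blocks n ! 1)) (blocks ! 1)"
    "splits_into (restrict_along P (Q_blocks n ! 2)) (blocks ! 2)"
    unfolding Q_blocks_def blocks_def using splits_restrict_along_pair by simp_all
  moreover assume "b < 3"
  then have "b = 0 \<or> b = 1 \<or> b = 2" by auto
  ultimately show ?thesis by blast
qed

text \<open>The first assumption on \<open>T\<close> says that all \<open>n\<close> lines of the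
  pencil of \<open>i, j\<close> are one and the same line; this produces the line of multiplicity
  \<open>n\<close>.\<close>

lemma image_blk_coord:
  fixes T :: "complex ^ 3 ^ 3"
  assumes T: "inj ((*v) T)"
    and 1: "\<And>x z. z \<in> unity n \<Longrightarrow> x \<in> ln i j z \<longleftrightarrow> (T *v x) $ p = 0"
    and 2: "\<And>x z. z \<in> unity n \<Longrightarrow> x \<in> ln k l z \<longleftrightarrow> (T *v x) $ q = z * (T *v x) $ r"
  shows "image_mset (\<lambda>L. (\<lambda>v. T *v v) ` L) (blk i j k l) = coord_block n p q r"
proof -
  have l1: "(\<lambda>v. T *v v) ` ln i j z = {v. v $ p = 0}" if "z \<in> unity n" for z
  proof -
    have "ln i j z = {x. (T *v x) $ p = 0}" using 1[OF that] by blast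
    then show ?thesis using image_Collect_inj[OF T, of "\<lambda>v. v $ p = 0"] by simp
  qed
  have l2: "(\<lambda>v. T *v v) ` ln k l z = {v. v $ q = z * v $ r}" if "z \<in> unity n" for z
  proof -
    have "ln k l z = {x. (T *v x) $ q = z * (T *v x) $ r}" using 2[OF that] by blast
    then show ?thesis using image_Collect_inj[OF T, of "\<lambda>v. v $ q = z * v $ r"] by simp
  qed
  have "image_mset (\<lambda>L. (\<lambda>v. T *v v) ` L) (image_mset (ln i j) (mset_set (unity n)))
      = image_mset (\<lambda>_. {v. v $ p = 0}) (mset_set (unity n))"
    by (simp add: multiset.map_comp o_def) (rule image_mset_cong, use l1 finite_unity[OF n] in auto)
  moreover have "image_mset (\<lambda>L. (\<lambda>v. T *v v) ` L) (image_mset (ln k l) (mset_set (unity n)))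
      = image_mset (\<lambda>z. {v. v $ q = z * v $ r}) (mset_set (unity n))"
    by (simp add: multiset.map_comp o_def) (rule image_mset_cong, use l2 finite_unity[OF n] in auto)
  ultimately show ?thesis
    by (simp add: blk_def coord_block_def image_mset_const_eq card_unity[OF n])
qed

lemma vec_eq_0_iff4:
  assumes "distinct [i, j, k, l :: 4]"
  shows "(y :: complex ^ 4) = 0 \<longleftrightarrow> y $ i = 0 \<and> y $ j = 0 \<and> y $ k = 0 \<and> y $ l = 0"
  using all4[OF assms, of "\<lambda>m. y $ m = 0"] by (simp add: vec_eq_iff)

lemma inj_of_kernel:
  fixes T :: "complex ^ 3 ^ 3"
  assumes "\<And>x. (T *v x) $ 1 = 0 \<Longrightarrow> (T *v x) $ 2 = 0 \<Longrightarrow> (T *v x) $ 3 = 0 \<Longrightarrow> P *v x = 0"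
  shows "inj ((*v) T)"
  unfolding vec.inj_iff_eq_0 using assms P_zero_iff by (metis zero_index)

lemma rows_mult:
  fixes T :: "complex ^ 3 ^ 3"
  assumes "T = vector [b, c, e]"
  shows "(T *v x) $ 1 = dot b x" "(T *v x) $ 2 = dot c x" "(T *v x) $ 3 = dot e x"
  by (simp_all add: assms matrix_vector_mult_def dot_def vector_3)

end

section \<open>Classification\<close>

context induced
begin

lemma A_eq_blocks:
  assumes "G = {#}"
  shows "A = blocks"
proof (rule nth_equalityI)
  show "length A = length blocks" by (simp add: length_A blocks_def)
  show "A ! b = blocks ! b" if "b < length A" for b
    using blocks_eq[of b] that assms length_A by simp
qed

lemma degree_of_G_empty: "G = {#} \<Longrightarrow> d = 2 * n"
  using size_G by simp

text \<open>On \<open>y_s = 0\<close> all lines \<open>y_s = z y_m\<close> become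
  \<open>y_m = 0\<close>, and the other three coordinates serve as coordinates of the plane.\<close>

lemma proj_equiv_coordinate_plane:
  assumes d4: "distinct [s, i, j, k]" and a0: "a $ i = 0" "a $ j = 0" "a $ k = 0"
  shows "d = 2 * n \<and> proj_equiv A (G_multinet n)"
proof -
  have G0: "G = {#}" using G_imp_one_zero a0 d4 by (metis multiset_nonemptyE distinct_length_2_or_more)
  have as: "a $ s \<noteq> 0" using a_nz vec_eq_0_iff4[OF d4, of a] a0 by blast
  have ys: "(P *v x) $ s = 0" for x
  proof -
    have "dot a (P *v x) = 0" using P_in_hyp by (simp add: hyp_def)
    then show ?thesis using as by (simp add: dot4[OF d4] a0)
  qed
  define T :: "complex ^ 3 ^ 3" where "T = vector [P $ i, P $ j, P $ k]"
  have Tx: "(T *v x) $ 1 = (P *v x) $ i" "(T *v x) $ 2 = (P *v x) $ j" "(T *v x) $ 3 = (P *v x) $ k" for x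
    using rows_mult[OF T_def] P_nth by simp_all
  have T: "inj ((*v) T)" by (rule inj_of_kernel) (simp add: Tx vec_eq_0_iff4[OF d4] ys)
  have m: "mset A = {#blk s i j k, blk s j i k, blk s k i j#}"
    using A_eq_blocks[OF G0] mset_blocks[OF d4] by simp
  have "proj_equiv A (G_multinet n)"
    by (rule proj_equiv_G_multinetI[OF n T m]; rule image_blk_coord[OF T])
      (use unity_nonzero[OF n] in \<open>auto simp: mem_ln Tx ys\<close>)
  then show ?thesis using degree_of_G_empty[OF G0] by simp
qed

text \<open>The differences \<open>y_m - y_0\<close> are coordinates on the plane because it does
  not contain \<open>(1, 1, 1, 1)\<close>, and the remaining forms are differences of two of
  them.\<close>

lemma proj_equiv_n1:
  assumes n1: "n = 1" and sum: "a $ 0 + a $ 1 + a $ 2 + a $ 3 \<noteq> 0"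
  shows "d = 2 * n \<and> proj_equiv A (G_multinet n)"
proof -
  have u: "unity n = {1}" by (auto simp: unity_def n1)
  have d4: "distinct [0, 1, 2, 3 :: 4]" by simp
  have G0: "G = {#}"
  \<comment> \<open>A common line would force three coefficients to add up to 0 while the fourth
    vanishes, so the plane would contain \<open>(1, 1, 1, 1)\<close>.\<close>
  proof (rule ccontr)
    assume "G \<noteq> {#}"
    then obtain L where L: "L \<in># G" by blast
    then obtain s where s: "a $ s = 0" "\<And>m. m \<noteq> s \<Longrightarrow> a $ m \<noteq> 0" using G_imp_one_zero by blast
    obtain k where "k \<noteq> s" by (metis zero_neq_one)
    then obtain i j where d: "distinct [k, s, i, j]" using ex_other_two by blast
    then have d': "distinct [i, j, k, s]" by auto
    have "a $ i \<noteq> 0" "a $ j \<noteq> 0" "a $ k \<noteq> 0" using s(2) d by auto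
    then obtain z where "z \<in> unity n" "L = ln i j z" using G_subset_ln(2)[OF d' s(1)] L by blast
    then have "a $ i * 1 + a $ j = - a $ k" using G_line_one_zero[OF d', of 1] L u s d n1 by auto
    then have "a $ i + a $ j + a $ k + a $ s = 0" using s by simp
    then have "dot a (\<chi> m. 1) = 0" by (simp add: dot4[OF d'])
    then show False using sum by (simp add: dot4[OF d4])
  qed
  define T :: "complex ^ 3 ^ 3" where "T = vector [P $ 1 - P $ 0, P $ 2 - P $ 0, P $ 3 - P $ 0]"
  have Tx: "(T *v x) $ 1 = (P *v x) $ 1 - (P *v x) $ 0" "(T *v x) $ 2 = (P *v x) $ 2 - (P *v x) $ 0"
    "(T *v x) $ 3 = (P *v x) $ 3 - (P *v x) $ 0" for x
    using rows_mult[OF T_def] P_nth by (simp_all add: dot_diff_left)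
  have T: "inj ((*v) T)"
  proof (rule inj_of_kernel)
    fix x assume "(T *v x) $ 1 = 0" "(T *v x) $ 2 = 0" "(T *v x) $ 3 = 0"
    then have e: "(P *v x) $ 1 = (P *v x) $ 0" "(P *v x) $ 2 = (P *v x) $ 0" "(P *v x) $ 3 = (P *v x) $ 0"
      by (simp_all add: Tx)
    have "dot a (P *v x) = 0" using P_in_hyp by (simp add: hyp_def)
    then have "(a $ 0 + a $ 1 + a $ 2 + a $ 3) * (P *v x) $ 0 = 0"
      by (simp add: dot4[OF d4] e algebra_simps)
    then show "P *v x = 0" using sum e by (simp add: vec_eq_0_iff4[OF d4])
  qed
  have m: "mset A = {#blk 0 1 2 3, blk 0 2 1 3, blk 0 3 1 2#}"
    using A_eq_blocks[OF G0] mset_blocks[OF d4] by simp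
  have "proj_equiv A (G_multinet n)"
    by (rule proj_equiv_G_multinetI[OF n T m]; rule image_blk_coord[OF T]) (auto simp: u mem_ln Tx)
  then show ?thesis using degree_of_G_empty[OF G0] by simp
qed

lemma mset_unity_2: "e\<^sup>2 = 1 \<Longrightarrow> mset_set (unity 2) = {#e, - e#}"
proof -
  assume e: "e\<^sup>2 = (1 :: complex)"
  then have "unity 2 = {e, - e}" by (auto simp: unity_def power2_eq_iff simp flip: e)
  moreover have "e \<noteq> - e" using e by (auto simp: eq_neg_iff_add_eq_0 simp flip: mult_2)
  ultimately show ?thesis by simp
qed

text \<open>After scaling by the signs \<open>e m\<close>, the plane is
  \<open>y_0 + y_1 + y_2 + y_3 = 0\<close> and the sums \<open>y_0 + y_m\<close> are coordinates.
  For the first block, \<open>y_0 + y_1 = - (y_2 + y_3)\<close> is the double line,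
  \<open>y_0 - y_1\<close> is the sum of the other two coordinates, and \<open>y_2 - y_3\<close> is
  their difference.\<close>

lemma proj_equiv_n2:
  assumes n2: "n = 2" and sq: "\<And>i j. (a $ i)\<^sup>2 = (a $ j)\<^sup>2" and nz: "\<And>m. a $ m \<noteq> 0"
  shows "d = 2 * n \<and> proj_equiv A (G_multinet n)"
proof -
  have d4: "distinct [0, 1, 2, 3 :: 4]" by simp
  have G0: "G = {#}" using G_imp_one_zero nz by (metis multiset_nonemptyE)
  define e where "e m = a $ m / a $ 0" for m
  have e2: "(e m)\<^sup>2 = 1" for m using sq[of m 0] nz by (simp add: e_def power_divide)
  have ee: "e m * (e m * x) = x" for m x using e2[of m] by (simp add: power2_eq_square flip: mult.assoc)
  define T :: "complex ^ 3 ^ 3" where "T = vector [P $ 0 + e 1 *s P $ 1, P $ 0 + e 2 *s P $ 2, P $ 0 + e 3 *s P $ 3]"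
  define y where "y m x = e m * (P *v x) $ m" for m x
  have Tx: "(T *v x) $ 1 = (P *v x) $ 0 + y 1 x" "(T *v x) $ 2 = (P *v x) $ 0 + y 2 x"
    "(T *v x) $ 3 = (P *v x) $ 0 + y 3 x" for x
    using rows_mult[OF T_def] P_nth by (simp_all add: dot_add_left y_def)
  have sum0: "(P *v x) $ 0 + y 1 x + y 2 x + y 3 x = 0" for x
  proof -
    have "dot a (P *v x) = 0" using P_in_hyp by (simp add: hyp_def)
    then have "a $ 0 * ((P *v x) $ 0 + y 1 x + y 2 x + y 3 x) = 0"
      using nz[of 0] by (simp add: dot4[OF d4] y_def e_def algebra_simps)
    then show ?thesis using nz by simp
  qed
  have T: "inj ((*v) T)"
  proof (rule inj_of_kernel)
    fix x assume "(T *v x) $ 1 = 0" "(T *v x) $ 2 = 0" "(T *v x) $ 3 = 0"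
    then have y: "y 1 x = - (P *v x) $ 0" "y 2 x = - (P *v x) $ 0" "y 3 x = - (P *v x) $ 0"
      by (simp_all add: Tx eq_neg_iff_add_eq_0 add.commute)
    then have "(P *v x) $ 0 = 0" using sum0[of x] by simp
    moreover from this have "y 1 x = 0" "y 2 x = 0" "y 3 x = 0" using y by simp_all
    then have "(P *v x) $ 1 = 0" "(P *v x) $ 2 = 0" "(P *v x) $ 3 = 0"
      using nz by (simp_all add: y_def e_def)
    ultimately show "P *v x = 0" by (simp add: vec_eq_0_iff4[OF d4])
  qed
  have block: "image_mset (\<lambda>L. (\<lambda>v. T *v v) ` L) (blk 0 j k l) = coord_block 2 p q r"
    if Tp: "\<And>x. (T *v x) $ p = (P *v x) $ 0 + y j x" "\<And>x. (T *v x) $ q = (P *v x) $ 0 + y k x"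
      "\<And>x. (T *v x) $ r = (P *v x) $ 0 + y l x"
      and s: "\<And>x. (P *v x) $ 0 + y j x + y k x + y l x = 0" for j k l p q r
  proof -
    have yv: "(P *v x) $ m = e m * y m x" for m x unfolding y_def ee ..
    have y0: "(P *v x) $ 0 = - y j x - y k x - y l x" for x
      using s[of x] by (simp add: algebra_simps eq_neg_iff_add_eq_0)
    have e0: "e m \<noteq> 0" for m using nz by (simp add: e_def)
    have im: "(\<lambda>v. T *v v) ` L = {v. \<phi> v}" if "\<And>x. x \<in> L \<longleftrightarrow> \<phi> (T *v x)" for L \<phi>
    proof -
      have "L = {x. \<phi> (T *v x)}" using that by blast
      then show ?thesis using image_Collect_inj[OF T] by metis
    qed
    have f2: "(e k * e l)\<^sup>2 = 1" using e2 by (simp add: power_mult_distrib)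
    have l1: "(\<lambda>v. T *v v) ` ln 0 j (- e j) = {v. v $ p = 0}"
      by (rule im) (simp add: mem_ln Tp yv[of _ j] ee eq_neg_iff_add_eq_0)
    have l2: "(\<lambda>v. T *v v) ` ln 0 j (e j) = {v. v $ q = (- 1) * v $ r}"
    proof (rule im)
      fix x
      have "(P *v x) $ 0 + y k x + ((P *v x) $ 0 + y l x) = (P *v x) $ 0 - y j x"
        unfolding y0 by (simp add: algebra_simps)
      then have "(P *v x) $ 0 = y j x \<longleftrightarrow> (P *v x) $ 0 + y k x = - ((P *v x) $ 0 + y l x)"
        by (metis eq_neg_iff_add_eq_0 right_minus_eq)
      then show "x \<in> ln 0 j (e j) \<longleftrightarrow> (T *v x) $ q = (- 1) * (T *v x) $ r"
        by (simp only: mem_ln Tp yv[of _ j] ee mult_minus_left mult_1)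
    qed
    have k1: "e k * y k x = e k * e l * (e l * y l x) \<longleftrightarrow> y k x = y l x"
      "e k * y k x = - (e k * e l) * (e l * y l x) \<longleftrightarrow> y k x = - y l x" for x
    proof -
      have 1: "e k * e l * (e l * y l x) = e k * y l x" by (simp only: mult.assoc ee)
      show "e k * y k x = e k * e l * (e l * y l x) \<longleftrightarrow> y k x = y l x" unfolding 1 using e0 by simp
      have 2: "- (e k * e l) * (e l * y l x) = e k * (- y l x)" using 1 by simp
      show "e k * y k x = - (e k * e l) * (e l * y l x) \<longleftrightarrow> y k x = - y l x" unfolding 2 by (simp only: mult_cancel_left e0 simp_thms)
    qed
    have l3: "(\<lambda>v. T *v v) ` ln k l (e k * e l) = {v. v $ q = 1 * v $ r}"
      by (rule im) (simp only: mem_ln Tp yv[of _ k] yv[of _ l] k1 mult_1 add_left_cancel)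
    have l4: "(\<lambda>v. T *v v) ` ln k l (- (e k * e l)) = {v. v $ p = 0}"
    proof (rule im)
      fix x
      have "(P *v x) $ 0 + y j x = - (y k x + y l x)" unfolding y0 by simp
      then have "y k x = - y l x \<longleftrightarrow> (P *v x) $ 0 + y j x = 0"
        by (metis eq_neg_iff_add_eq_0 neg_equal_0_iff_equal)
      then show "x \<in> ln k l (- (e k * e l)) \<longleftrightarrow> (T *v x) $ p = 0"
        by (simp only: mem_ln Tp yv[of _ k] yv[of _ l] k1)
    qed
    have "image_mset (\<lambda>L. (\<lambda>v. T *v v) ` L) (blk 0 j k l) =
      {#(\<lambda>v. T *v v) ` ln 0 j (e j), (\<lambda>v. T *v v) ` ln 0 j (- e j),
        (\<lambda>v. T *v v) ` ln k l (e k * e l), (\<lambda>v. T *v v) ` ln k l (- (e k * e l))#}"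
    proof -
      have u: "mset_set (unity n) = {#e j, - e j#}" "mset_set (unity n) = {#e k * e l, - (e k * e l)#}"
        using mset_unity_2[OF e2[of j]] mset_unity_2[OF f2] n2 by auto
      have "image_mset (ln 0 j) (mset_set (unity n)) = {#ln 0 j (e j), ln 0 j (- e j)#}"
        by (subst u(1)) simp
      moreover have "image_mset (ln k l) (mset_set (unity n)) = {#ln k l (e k * e l), ln k l (- (e k * e l))#}"
        by (subst u(2)) simp
      ultimately
      show ?thesis by (simp add: blk_def)
    qed
    also have "\<dots> = {#{v. v $ q = (- 1) * v $ r}, {v. v $ p = 0}, {v. v $ q = 1 * v $ r}, {v. v $ p = 0}#}"
      unfolding l1 l2 l3 l4 ..
    also have "\<dots> = coord_block 2 p q r"
      unfolding coord_block_def mset_unity_2[of 1, simplified] by (simp add: numeral_2_eq_2 add_mset_commute)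
    finally show ?thesis .
  qed
  have m: "mset A = {#blk 0 1 2 3, blk 0 2 1 3, blk 0 3 1 2#}"
    using A_eq_blocks[OF G0] mset_blocks[OF d4] by simp
  have "proj_equiv A (G_multinet 2)"
  proof (rule proj_equiv_G_multinetI[OF _ T m])
    show "image_mset (\<lambda>L. (\<lambda>v. T *v v) ` L) (blk 0 1 2 3) = coord_block 2 1 2 3"
      by (rule block) (simp_all add: Tx sum0)
    show "image_mset (\<lambda>L. (\<lambda>v. T *v v) ` L) (blk 0 2 1 3) = coord_block 2 2 1 3"
      by (rule block) (use sum0 in \<open>simp_all add: Tx add_ac\<close>)
    show "image_mset (\<lambda>L. (\<lambda>v. T *v v) ` L) (blk 0 3 1 2) = coord_block 2 3 1 2"
      by (rule block) (use sum0 in \<open>simp_all add: Tx add_ac\<close>)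
  qed simp
  then show ?thesis using degree_of_G_empty[OF G0] n2 by simp
qed

text \<open>If all six planes pass through the point (1, 1, 1, 1) of the plane H, the lines of a connected block coincide.\<close>

lemma n1_sum_zero_not_complete:
  assumes n1: "n = 1" and sum: "a $ 0 + a $ 1 + a $ 2 + a $ 3 = 0" and d2: "d \<ge> 2"
    and complete: "3 * int d + 3 + (\<Sum>p\<in>other_points (base_locus W) A. int (num_lines_through A p) - 1)
       = 2 * int (card (lines_of A)) + (\<Sum>p\<in>base_locus W. int (base_mult A p) - 1)"
  shows False
proof -
  have u: "unity n = {1}" by (auto simp: unity_def n1)
  have d4: "distinct [0, 1, 2, 3 :: 4]" by simp
  have dd: "d = 2" using size_G n1 d2 by simp
  define y :: "complex ^ 4" where "y = (\<chi> m. 1)"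
  have y: "y \<in> hyp a" using sum by (simp add: hyp_def y_def dot4[OF d4])
  have y0: "y \<noteq> 0" by (simp add: y_def vec_eq_iff)
  define p where "p = ptH y"
  have p_pt: "is_point p" unfolding p_def by (rule is_point_ptH[OF y y0])
  have tr: "p \<subseteq> L" if tl: "L \<in> trace_lines" for L
  proof -
    obtain i j where L: "i \<noteq> j" "L = ln i j 1" using tl by (auto simp: trace_lines_def u)
    show ?thesis unfolding p_def L(2) using ptH_ln[OF y L(1) one_in_unity] by (simp add: y_def)
  qed
  have pL: "p \<subseteq> L" if "b < 3" "L \<in># A ! b" for b L
  proof -
    have "A ! b \<in> set A" using that(1) length_A by simp
    then have "L \<in> lines_of A" using that(2) by (auto simp: lines_of_def)
    then show ?thesis using tr lines_of_trace_lines by blast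
  qed
  have meet: "L \<inter> L' = p" if "b < 3" "b' < 3" "L \<in># A ! b" "L' \<in># A ! b'" "L \<noteq> L'" for b b' L L'
  proof -
    have "lift y \<in> p" using mem_pt_self by (simp add: p_def ptH_def)
    then have "lift y \<in> L" "lift y \<in> L'" using pL that by blast+
    then show ?thesis
      unfolding p_def ptH_def using lines_meet that is_line_block lift_nonzero[OF y y0] by blast
  qed
  have ne: "A ! b \<noteq> {#}" if "b < 3" for b using size_block[OF that] dd by auto
  have X: "base_locus W = {p}"
  proof
    obtain L0 L1 where "L0 \<in># A ! 0" "L1 \<in># A ! 1" using ne[of 0] ne[of 1] by (auto simp: multiset_nonemptyE) (metis multiset_nonemptyE)
    then show "{p} \<subseteq> base_locus W" using base_locus_eq[of 0 1] pL[of 0] pL[of 1] p_pt by auto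
    show "base_locus W \<subseteq> {p}"
    proof
      fix q assume q: "q \<in> base_locus W"
      then obtain L L' where L: "is_point q" "L \<in># A ! 0" "q \<subseteq> L" "L' \<in># A ! 1" "q \<subseteq> L'"
        using base_locus_eq[of 0 1] by auto
      have ne': "L \<noteq> L'" using L blocks_disjoint[of 0 1] by auto
      obtain x where x: "x \<noteq> 0" "q = pt x" using L(1) by (rule is_pointE)
      then have "x \<in> L" "x \<in> L'" using L mem_pt_self by auto
      then have "L \<inter> L' = q" using lines_meet[of L L' x] L x ne' is_line_block[of 0] is_line_block[of 1] by auto
      then show "q \<in> {p}" using meet[of 0 1 L L'] L ne' by auto
    qed
  qed
  have one: "card (set_mset (A ! b)) \<le> 1" if b: "b < 3" for b
  proof -
    have "A ! b \<in> set A" using b length_A by simp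
    then have conn: "block_connected (base_locus W) (A ! b)"
      using multinet by (simp add: multinet_of_pencil_def)
    have id: "{(l, l'). l \<in># A ! b \<and> l' \<in># A ! b \<and> l \<inter> l' \<notin> base_locus W} \<subseteq> Id"
      using meet[OF b b] X by auto
    have "L = L'" if "L \<in># A ! b" "L' \<in># A ! b" for L L'
    proof -
      have "(L, L') \<in> {(l, l'). l \<in># A ! b \<and> l' \<in># A ! b \<and> l \<inter> l' \<notin> base_locus W}\<^sup>*"
        using conn that unfolding block_connected_def by blast
      then have "(L, L') \<in> Id\<^sup>*" using rtrancl_mono[OF id] by blast
      then show ?thesis by simp
    qed
    then show ?thesis by (simp add: card_le_Suc0_iff_eq)
  qed
  have "card (lines_of A) \<le> 3" using card_lines_of_le one[of 0] one[of 1] one[of 2] by simp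
  moreover have "(\<Sum>p\<in>base_locus W. int (base_mult A p) - 1) \<le> 1"
  proof -
    have "A ! 0 = hd A" using length_A by (cases A) auto
    then have "base_mult A p \<le> size (A ! 0)" by (simp add: base_mult_eq size_filter_mset_lesseq)
    then show ?thesis using size_block[of 0] dd X by simp
  qed
  moreover have "0 \<le> (\<Sum>p\<in>other_points (base_locus W) A. int (num_lines_through A p) - 1)"
    by (rule sum_nonneg) (use num_lines_ge_2 in fastforce)
  \<comment> \<open>With \<open>d = 2\<close>, three lines and one base point of multiplicity at
    most 2, completeness would give \<open>9 \<le> 7\<close>.\<close>
  ultimately show False using complete dd by simp
qed

lemma classification:
  assumes d2: "d \<ge> 2"
    and complete: "3 * int d + 3 + (\<Sum>p\<in>other_points (base_locus W) A. int (num_lines_through A p) - 1)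
       = 2 * int (card (lines_of A)) + (\<Sum>p\<in>base_locus W. int (base_mult A p) - 1)"
  shows "d = 2 * n \<and> proj_equiv A (G_multinet n)"
proof (cases "n = 1")
  case True
  then show ?thesis using proj_equiv_n1 n1_sum_zero_not_complete d2 complete by blast
next
  case False
  then have n2: "n \<ge> 2" using n by simp
  interpret complete_induced n P a W d A G
    by unfold_locales (use n2 complete in auto)
  show ?thesis
  proof (cases "\<forall>m. a $ m \<noteq> 0")
    case True
    then show ?thesis using no_zero proj_equiv_n2 by blast
  next
    case False
    then obtain l where l: "a $ l = 0" by blast
    obtain k where "k \<noteq> l" by (metis zero_neq_one)
    then obtain i j where "distinct [k, l, i, j]" using ex_other_two by blast
    then have p: "distinct [i, j, k, l]" "distinct [i, k, j, l]" "distinct [j, k, i, l]" "distinct [k, i, j, l]" "distinct [j, i, k, l]"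
      by auto
    have "\<not> (a $ i = 0 \<and> a $ j = 0 \<and> a $ k = 0)" using vec_eq_0_iff4[OF p(1), of a] l a_nz by blast
    then consider "a $ i \<noteq> 0" "a $ j \<noteq> 0" "a $ k \<noteq> 0" | "a $ i \<noteq> 0" "a $ j \<noteq> 0" "a $ k = 0"
      | "a $ i \<noteq> 0" "a $ j = 0" "a $ k \<noteq> 0" | "a $ i = 0" "a $ j \<noteq> 0" "a $ k \<noteq> 0"
      | "a $ i \<noteq> 0" "a $ j = 0" "a $ k = 0" | "a $ i = 0" "a $ j \<noteq> 0" "a $ k = 0"
      | "a $ i = 0" "a $ j = 0" "a $ k \<noteq> 0" by blast
    then show ?thesis
    proof cases
      case 1 then show ?thesis using not_one_zero[OF p(1) l] by blast
    next
      case 2 then show ?thesis using not_two_zeros[OF p(1) _ l] by blast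
    next
      case 3 then show ?thesis using not_two_zeros[OF p(2) _ l] by blast
    next
      case 4 then show ?thesis using not_two_zeros[OF p(3) _ l] by blast
    next
      case 5 then show ?thesis using proj_equiv_coordinate_plane[OF p(1)] l by blast
    next
      case 6 then show ?thesis using proj_equiv_coordinate_plane[OF p(5)] l by blast
    next
      case 7 then show ?thesis using proj_equiv_coordinate_plane[OF p(4)] l by blast
    qed
  qed
qed

end

text \<open>A factor of a product of linear forms is again such a product, so the common factor has
  a multiset of lines; by uniqueness of the splitting it is the same for the three blocks.\<close>

lemma induced_by_imp_induced:
  assumes n: "n \<ge> 1" and ind: "induced_by n H A" and net: "multinet_of_pencil W k d A"
  shows "k = 3 \<and> (\<exists>P a G. induced n P a W d A G)"
proof -
  obtain P g R where P: "inj ((*v) P)" "range ((*v) P) = H" and H: "H \<notin> Q_planes n"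
    and R: "map (restrict_along P) (Q_blocks n) = map (\<lambda>r. g * r) R" "list_all2 splits_into R A"
    using ind unfolding induced_by_def by blast
  have lenR: "length R = 3" using arg_cong[OF R(1), of length] by (simp add: Q_blocks_def)
  then have lenA: "length A = 3" using R(2) by (simp add: list_all2_lengthD)
  then have k: "k = 3" using net by (simp add: multinet_of_pencil_def)
  obtain a where "Q_trace n P a" using Q_trace_of_plane[OF n P(1)] P(2) H by blast
  then interpret Q_trace n P a .
  have fac: "splits_into (g * R ! b) (blocks ! b) \<and> splits_into (R ! b) (A ! b)" if b: "b < 3" for b
  proof -
    have "length (Q_blocks n) = 3" by (simp add: Q_blocks_def)
    then have "restrict_along P (Q_blocks n ! b) = map (restrict_along P) (Q_blocks n) ! b" using b by simp
    also have "\<dots> = g * R ! b" unfolding R(1) using b lenR by simp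
    finally have "restrict_along P (Q_blocks n ! b) = g * R ! b" .
    then show ?thesis using splits_restrict_along[OF b] R(2) b lenR by (simp add: list_all2_nthD)
  qed
  have ex: "\<exists>G. blocks ! b = A ! b + G \<and> splits_into g G" if b: "b < 3" for b
  proof -
    obtain B1 B2 where "blocks ! b = B1 + B2" "splits_into g B1" "splits_into (R ! b) B2"
      using splits_into_mult_iff fac[OF b] by blast
    then show ?thesis using splits_into_unique fac[OF b] by (metis add.commute)
  qed
  obtain G where G: "splits_into g G" using ex[of 0] by auto
  have "blocks ! b = A ! b + G" if "b < 3" for b using ex[OF that] G splits_into_unique by blast
  then have "induced n P a W d A G"
    by unfold_locales (use net k in auto)
  then show ?thesis using k by blast
qed

lemma complete_induced_from_Q:
  assumes n: "n \<ge> 1" and ind: "induced_from_Q n A" and c: "complete_multinet k d A"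
  shows "k = 3 \<and> d = 2 * n \<and> proj_equiv A (G_multinet n)"
proof -
  obtain H where H: "induced_by n H A" using ind by (auto simp: induced_from_Q_def)
  obtain W where d2: "d \<ge> 2" and W: "multinet_of_pencil W k d A" and
    eq: "3 + int (card (base_locus W)) =
          (2 - int k) * (3 * int d - (int d)\<^sup>2
             + (\<Sum>p\<in>base_locus W. (int (base_mult A p))\<^sup>2 - int (base_mult A p)))
          + 2 * int (card (lines_of A))
          - (\<Sum>p\<in>other_points (base_locus W) A. int (num_lines_through A p) - 1)"
    using c unfolding complete_multinet_def by blast
  obtain P a G where k: "k = 3" and "induced n P a W d A G" using induced_by_imp_induced[OF n H W] by blast
  then interpret induced n P a W d A G by simp
  show ?thesis using classification[OF d2] complete_iff[OF refl thr_base_eq] eq k by simp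
qed

section \<open>The multinets of type G(n, 1, 3)\<close>

text \<open>A common divisor splits into lines taken from both multisets, hence into none, and is a
  nonzero constant.\<close>

lemma coprime_splits:
  assumes f: "splits_into f B" "splits_into g C" and dis: "set_mset B \<inter> set_mset C = {}"
    and h: "h dvd f" "h dvd g"
  shows "h dvd 1"
proof -
  obtain B1 where B1: "splits_into h B1" "B1 \<subseteq># B"
    using h(1) splits_into_mult_iff f(1) unfolding dvd_def by (metis mset_subset_eq_add_left)
  obtain C1 where C1: "splits_into h C1" "C1 \<subseteq># C"
    using h(2) splits_into_mult_iff f(2) unfolding dvd_def by (metis mset_subset_eq_add_left)
  have "B1 = C1" using B1 C1 splits_into_unique by blast
  then have "set_mset B1 \<subseteq> set_mset B \<inter> set_mset C" using B1(2) C1(2) set_mset_mono by blast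
  then have "B1 = {#}" using dis by simp
  then obtain c where "c \<noteq> 0" "h = Const c" using B1(1) by (auto simp: splits_into_iff)
  then show ?thesis using Const_dvd_1 by simp
qed

section \<open>The pencil of the multinet G(n,1,3)\<close>

definition G_poly :: "nat \<Rightarrow> nat \<Rightarrow> 3 mpoly" where
  "G_poly n = (!) [Var 1 ^ n * (Var 2 ^ n - Var 3 ^ n), Var 2 ^ n * (Var 1 ^ n - Var 3 ^ n),
     Var 3 ^ n * (Var 1 ^ n - Var 2 ^ n)]"

definition G_pencil :: "nat \<Rightarrow> 3 mpoly set" where
  "G_pencil n = {Const a * G_poly n 0 + Const b * G_poly n 1 | a b. True}"

lemma less_3_cases: "b < 3 \<Longrightarrow> b = 0 \<or> b = 1 \<or> b = (2 :: nat)"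
  by auto

lemma G_poly_simps:
  "G_poly n 0 = Var 1 ^ n * (Var 2 ^ n - Var 3 ^ n)" "G_poly n 1 = Var 2 ^ n * (Var 1 ^ n - Var 3 ^ n)"
  "G_poly n 2 = Var 3 ^ n * (Var 1 ^ n - Var 2 ^ n)"
  by (simp_all add: G_poly_def)

lemma splits_G_poly:
  assumes n: "n \<ge> 1" and b: "b < 3"
  shows "splits_into (G_poly n b) (G_multinet n ! b)"
  using less_3_cases[OF b]
  by (elim disjE) (simp_all add: G_poly_simps G_multinet_eq[OF n] splits_coord_block[OF n] del: One_nat_def)

lemma homogeneous_G_poly: "homogeneous (2 * n) (G_poly n b)" if "b < 3"
proof -
  have v: "homogeneous n (Var i ^ n)" for i :: 3 using homogeneous_power[OF homogeneous_Var, of n i] by simp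
  have "homogeneous (n + n) (Var i ^ n * (Var j ^ n - Var k ^ n))" for i j k :: 3
    by (intro homogeneous_mult homogeneous_diff v)
  then show ?thesis using less_3_cases[OF that] by (auto simp: G_poly_simps mult_2 simp del: One_nat_def)
qed

text \<open>Point number \<open>b\<close> lies on fiber number \<open>b\<close> and on neither of
  the other two, because \<open>2^n \<noteq> 1\<close>. This yields the independence of the
  fibers.\<close>

definition G_witness :: "nat \<Rightarrow> complex ^ 3" where
  "G_witness b = [vector [0, 1, 2], vector [1, 0, 2], vector [1, 2, 0]] ! b"

lemma eval_G_witness:
  assumes n: "n \<ge> 1" and b: "b < 3" "c < 3"
  shows "eval_poly (G_poly n b) (G_witness c) = 0 \<longleftrightarrow> b = c"
  using less_3_cases[OF b(1)] less_3_cases[OF b(2)] n two_not_unity[OF n] two_not_unity[OF n, symmetric]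
  by (elim disjE) (simp_all add: G_poly_simps G_witness_def vector_3 power_0_left del: One_nat_def)

lemma G_blocks_disjoint:
  assumes n: "n \<ge> 1" and b: "b < 3" "c < 3" "b \<noteq> c"
  shows "set_mset (G_multinet n ! b) \<inter> set_mset (G_multinet n ! c) = {}"
proof -
  have two: "(2 :: complex) \<notin> unity n" using two_not_unity[OF n] by (simp add: unity_def)
  have nz: "z \<noteq> 0" if "z \<in> unity n" for z using unity_nonzero[OF n that] .
  have half: "z \<noteq> 2" if "z \<in> unity n" for z using two that by blast
  have s: "set_mset (coord_block n p q r) = insert {v. v $ p = 0} ((\<lambda>z. {v. v $ q = z * v $ r}) ` unity n)" for p q r
    using n by (auto simp: coord_block_def finite_unity[OF n])
  have ne: "{v :: complex ^ 3. \<phi> v} \<noteq> {v. \<psi> v}" if "\<phi> w" "\<not> \<psi> w" for \<phi> \<psi> w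
    using that by blast
  have d: "set_mset (coord_block n p q r) \<inter> set_mset (coord_block n q p r) = {}
     \<and> set_mset (coord_block n p q r) \<inter> set_mset (coord_block n r p q) = {}"
    if pqr: "p \<noteq> q" "q \<noteq> r" "p \<noteq> r" for p q r :: 3
  proof -
    have w: "\<exists>v :: complex ^ 3. v $ p = x \<and> v $ q = y \<and> v $ r = t" for x y t
      by (rule exI[of _ "\<chi> m. if m = p then x else if m = q then y else t"]) (use pqr in auto)
    have 1: "{v :: complex ^ 3. v $ p = 0} \<noteq> {v. v $ q = 0}" using w[of 0 1 1] by (metis (mono_tags, lifting) mem_Collect_eq zero_neq_one)
    have 2: "{v :: complex ^ 3. v $ p = 0} \<noteq> {v. v $ r = 0}" using w[of 0 1 1] by (metis (mono_tags, lifting) mem_Collect_eq zero_neq_one)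
    have 3: "{v :: complex ^ 3. v $ p = 0} \<noteq> {v. v $ p = z * v $ r}" if "z \<in> unity n" for z
      using w[of 0 1 1] nz[OF that] by (metis (mono_tags, lifting) mem_Collect_eq mult.right_neutral)
    have 4: "{v :: complex ^ 3. v $ p = 0} \<noteq> {v. v $ p = z * v $ q}" if "z \<in> unity n" for z
      using w[of 0 1 1] nz[OF that] by (metis (mono_tags, lifting) mem_Collect_eq mult.right_neutral)
    have 5: "{v :: complex ^ 3. v $ q = z * v $ r} \<noteq> {v. v $ q = 0}" if "z \<in> unity n" for z
      using w[of 0 z 1] nz[OF that] by (metis (mono_tags, lifting) mem_Collect_eq mult.right_neutral)
    have 6: "{v :: complex ^ 3. v $ q = z * v $ r} \<noteq> {v. v $ r = 0}" if "z \<in> unity n" for z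
      using w[of 0 z 1] by (metis (mono_tags, lifting) mem_Collect_eq mult.right_neutral zero_neq_one)
    have 7: "{v :: complex ^ 3. v $ q = z * v $ r} \<noteq> {v. v $ p = z' * v $ r}" if "z \<in> unity n" "z' \<in> unity n" for z z'
      using w[of 0 z 1] nz[OF that(2)] by (metis (mono_tags, lifting) mem_Collect_eq mult.right_neutral)
    have 8: "{v :: complex ^ 3. v $ q = z * v $ r} \<noteq> {v. v $ p = z' * v $ q}" if "z \<in> unity n" "z' \<in> unity n" for z z'
      using w[of 0 z 1] nz[OF that(1)] nz[OF that(2)] by (metis (mono_tags, lifting) mem_Collect_eq mult.right_neutral mult_eq_0_iff)
    show ?thesis unfolding s using 1 2 3 4 5 6 7 8 by blast
  qed
  have "(2 :: 3) \<noteq> 3" "(1 :: 3) \<noteq> 2" "(1 :: 3) \<noteq> 3" by auto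
  have swap: "set_mset (coord_block n 2 1 3) \<inter> set_mset (coord_block n 3 1 2) = {}"
  proof -
    have e: "(\<lambda>z. {v :: complex ^ 3. v $ 1 = z * v $ 2}) ` unity n = (\<lambda>z. {v. v $ 2 = z * v $ 1}) ` unity n"
    proof -
      have k: "(\<lambda>z. {v :: complex ^ 3. v $ p = z * v $ q}) ` unity n \<subseteq> (\<lambda>z. {v. v $ q = z * v $ p}) ` unity n" for p q
      proof (rule image_subsetI)
        fix z assume z: "z \<in> unity n"
        show "{v :: complex ^ 3. v $ p = z * v $ q} \<in> (\<lambda>z. {v. v $ q = z * v $ p}) ` unity n"
          by (rule image_eqI[of _ _ "1 / z"])
            (use nz[OF z] unity_divide[OF one_in_unity z] in \<open>auto simp: field_simps\<close>)
      qed
      show ?thesis using k[of 1 2] k[of 2 1] by blast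
    qed
    have "set_mset (coord_block n 3 1 2) = set_mset (coord_block n 3 2 1)" unfolding s e ..
    then show ?thesis using d[of 2 1 3] by simp
  qed
  show ?thesis
    using less_3_cases[OF b(1)] less_3_cases[OF b(2)] b(3) d[of 1 2 3] swap
    by (elim disjE) (simp_all add: G_multinet_eq[OF n] Int_commute del: One_nat_def)
qed

lemma multinet_G_multinet:
  assumes n: "n \<ge> 1"
  shows "multinet_of_pencil (G_pencil n) 3 (2 * n) (G_multinet n)"
  unfolding multinet_of_pencil_def
proof (intro conjI)
  have G2: "G_poly n 2 = Const (- 1) * G_poly n 0 + Const 1 * G_poly n 1"
    by (rule mpoly_eqI) (simp add: G_poly_simps algebra_simps del: One_nat_def)
  have mem: "G_poly n b \<in> G_pencil n" if "b < 3" for b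
  proof -
    have "G_poly n 0 = Const 1 * G_poly n 0 + Const 0 * G_poly n 1"
      "G_poly n 1 = Const 0 * G_poly n 0 + Const 1 * G_poly n 1" by simp_all
    then have "G_poly n 0 \<in> G_pencil n" "G_poly n 1 \<in> G_pencil n" "G_poly n 2 \<in> G_pencil n"
      unfolding G_pencil_def using G2 by blast+
    then show ?thesis using less_3_cases[OF that] by metis
  qed
  show "3 \<le> (3 :: nat)" by simp
  show "length (G_multinet n) = 3" by (simp add: G_multinet_def)
  have indep: "a = 0 \<and> b = 0" if "Const a * G_poly n 0 + Const b * G_poly n 1 = 0" for a b
  proof -
    have e: "a * eval_poly (G_poly n 0) x + b * eval_poly (G_poly n 1) x = 0" for x
      using arg_cong[OF that, of "\<lambda>f. eval_poly f x"] by simp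
    have "eval_poly (G_poly n 0) (G_witness 0) = 0" "eval_poly (G_poly n 1) (G_witness 0) \<noteq> 0"
      "eval_poly (G_poly n 0) (G_witness 1) \<noteq> 0" "eval_poly (G_poly n 1) (G_witness 1) = 0"
      using eval_G_witness[OF n] by simp_all
    then show ?thesis using e[of "G_witness 0"] e[of "G_witness 1"] by auto
  qed
  show "is_pencil (2 * n) (G_pencil n)"
    unfolding is_pencil_def G_pencil_def
    by (rule exI[of _ "G_poly n 0"], rule exI[of _ "G_poly n 1"]) (use indep homogeneous_G_poly in auto)
  show "no_fixed_component (G_pencil n)"
    unfolding no_fixed_component_def
    using coprime_splits[OF splits_G_poly[OF n] splits_G_poly[OF n] G_blocks_disjoint[OF n], of 0 1] mem by auto
  show "\<exists>F. (\<forall>i<3. F i \<in> G_pencil n \<and> splits_into (F i) (G_multinet n ! i)) \<and>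
          (\<forall>i<3. \<forall>j<3. i \<noteq> j \<longrightarrow> \<not> (\<exists>c. F i = Const c * F j))"
  proof (intro exI[of _ "G_poly n"] conjI allI impI)
    fix i j :: nat assume ij: "i < 3" "j < 3" "i \<noteq> j"
    show "\<not> (\<exists>c. G_poly n i = Const c * G_poly n j)"
    proof
      assume "\<exists>c. G_poly n i = Const c * G_poly n j"
      then obtain c where "eval_poly (G_poly n i) (G_witness j) = c * eval_poly (G_poly n j) (G_witness j)"
        by (metis eval_Const eval_mult)
      then show False using eval_G_witness[OF n ij(1,2)] eval_G_witness[OF n ij(2,2)] ij(3) by simp
    qed
  qed (use mem splits_G_poly[OF n] in auto)
  show "\<forall>B\<in>set (G_multinet n). block_connected (base_locus (G_pencil n)) B"
  proof -
    \<comment> \<open>The block is connected as a star: the line \<open>v_p = 0\<close> meets each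
      line \<open>v_q = z v_r\<close> in the point with coordinates \<open>0, z, 1\<close>, where
      another fiber does not vanish.\<close>
    have conn: "block_connected (base_locus (G_pencil n)) (coord_block n p q r)"
      if F: "c < 3" "\<And>v. eval_poly (G_poly n c) v = 0 \<longleftrightarrow> v $ q ^ n * (v $ p ^ n - v $ r ^ n) = 0" and pqr: "p \<noteq> q" "q \<noteq> r" "p \<noteq> r" for p q r c
    proof -
      let ?B = "coord_block n p q r" and ?L0 = "{v :: complex ^ 3. v $ p = 0}"
      let ?M = "\<lambda>z. {v :: complex ^ 3. v $ q = z * v $ r}"
      let ?R = "{(l, l'). l \<in># ?B \<and> l' \<in># ?B \<and> l \<inter> l' \<notin> base_locus (G_pencil n)}"
      have s: "set_mset ?B = insert ?L0 (?M ` unity n)"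
        using n by (auto simp: coord_block_def finite_unity[OF n])
      have notX: "?L0 \<inter> ?M z \<notin> base_locus (G_pencil n)" if z: "z \<in> unity n" for z
      proof
        assume X: "?L0 \<inter> ?M z \<in> base_locus (G_pencil n)"
        let ?v = "(\<chi> m. if m = p then 0 else if m = q then z else 1) :: complex ^ 3"
        have "?v \<in> ?L0 \<inter> ?M z" using pqr by simp
        moreover have "?L0 \<inter> ?M z \<subseteq> zero_set (G_poly n c)"
          using X mem[OF F(1)] unfolding base_locus_def by blast
        ultimately have "?v \<in> zero_set (G_poly n c)" by blast
        then have "eval_poly (G_poly n c) ?v = 0" by (simp only: zero_set_def mem_Collect_eq)
        then show False using unity_nonzero[OF n z] n pqr by (simp add: F(2) power_0_left)
      qed
      have "(l, ?L0) \<in> ?R\<^sup>* \<and> (?L0, l) \<in> ?R\<^sup>*" if lB: "l \<in># ?B" for l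
      proof (cases "l = ?L0")
        case False
        then obtain z where "z \<in> unity n" "l = ?M z" using lB s by auto
        then have "(l, ?L0) \<in> ?R" "(?L0, l) \<in> ?R" using lB s notX by (auto simp: Int_commute)
        then show ?thesis by blast
      qed simp
      then show ?thesis unfolding block_connected_def by (meson rtrancl_trans)
    qed
    have "block_connected (base_locus (G_pencil n)) (coord_block n 1 2 3)"
      by (rule conn[of 1]) (simp_all add: G_poly_simps del: One_nat_def)
    moreover have "block_connected (base_locus (G_pencil n)) (coord_block n 2 1 3)"
      by (rule conn[of 0]) (simp_all add: G_poly_simps)
    moreover have "block_connected (base_locus (G_pencil n)) (coord_block n 3 1 2)"
      by (rule conn[of 0]) (auto simp: G_poly_simps)
    ultimately show ?thesis by (simp add: G_multinet_eq[OF n])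
  qed
qed

text \<open>The trace on \<open>y_0 = 0\<close>, with nothing divided out. There are
  \<open>3 n + 3\<close> lines, three base points of multiplicity \<open>n\<close> with all others
  of multiplicity 1, and \<open>3 n\<close> double points off the base; both sides of the
  completeness equation are \<open>9 n + 3\<close>.\<close>

locale coordinate_trace = induced n P "axis 0 1" W d A "{#}" for n P W d A
begin

lemma coord_0: "y \<in> hyp (axis 0 1) \<longleftrightarrow> y $ 0 = 0"
  by (simp add: hyp_def dot_axis_left)

lemma P_coord_0: "(P *v x) $ 0 = 0"
  using P_in_hyp coord_0 by blast

lemma A_blocks: "A = blocks"
  by (rule A_eq_blocks) simp

lemma base_locus_triI:
  assumes "y \<in> hyp (axis 0 1)" "y \<noteq> 0" "tri n y"
  shows "ptH y \<in> base_locus W" "base_mult A (ptH y) = tri_weight n y"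
proof -
  have t: "size {#L \<in># A ! b. ptH y \<subseteq> L#} = tri_weight n y" if "b < 3" for b
    using thr_base[OF assms that] by simp
  have "tri_weight n y > 0" using n by (simp add: tri_weight_def)
  then have "\<exists>L\<in>#A ! b. ptH y \<subseteq> L" if "b < 3" for b
  proof -
    have "size {#L \<in># A ! b. ptH y \<subseteq> L#} > 0" using t[OF that] \<open>tri_weight n y > 0\<close> by simp
    then have "{#L \<in># A ! b. ptH y \<subseteq> L#} \<noteq> {#}" by (metis less_irrefl size_empty)
    then obtain L where "L \<in># {#L \<in># A ! b. ptH y \<subseteq> L#}" by (metis multiset_nonemptyE)
    then show ?thesis by auto
  qed
  from this[of 0] this[of 1] show 1: "ptH y \<in> base_locus W"
    using base_locus_eq[of 0 1] is_point_ptH[OF assms(1,2)] by auto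
  show "base_mult A (ptH y) = tri_weight n y" using base_mult_tri[OF assms(1,2) 1] by simp
qed

lemma ln_0: "m \<noteq> 0 \<Longrightarrow> z \<in> unity n \<Longrightarrow> ln 0 m z = ln 0 m 1"
  using unity_nonzero[OF n, of z] by (auto simp: mem_ln P_coord_0)

lemma ln_0_swap: "m \<noteq> 0 \<Longrightarrow> z \<in> unity n \<Longrightarrow> ln m 0 z = ln 0 m 1"
  by (auto simp: mem_ln P_coord_0)

lemma ln_0_neq:
  assumes d: "distinct [0, m, j, k]" and z: "z \<in> unity n"
  shows "ln 0 m 1 \<noteq> ln j k z"
proof (rule ln_neq_opposite[OF d one_in_unity z])
  show "axis 0 (1 :: complex) $ 0 * 1 + axis 0 1 $ m \<noteq> 0" using d by (simp add: axis_def)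
qed

lemma card_set_block:
  assumes d: "distinct [0, m, j, k]"
  shows "card (set_mset (blk 0 m j k)) = n + 1"
proof -
  have "ln 0 m ` unity n = {ln 0 m 1}"
  proof
    show "ln 0 m ` unity n \<subseteq> {ln 0 m 1}" using ln_0[of m] d by (intro image_subsetI) simp
    show "{ln 0 m 1} \<subseteq> ln 0 m ` unity n" using one_in_unity by blast
  qed
  then have "set_mset (blk 0 m j k) = insert (ln 0 m 1) (ln j k ` unity n)" by (simp add: set_blk)
  moreover have "ln 0 m 1 \<notin> ln j k ` unity n" using ln_0_neq[OF d] by blast
  moreover have "inj_on (ln j k) (unity n)"
  proof -
    have d': "distinct [j, k, 0, m]" using d by auto
    have "ln j k z \<noteq> ln j k w" if "z \<noteq> w" for z w by (rule ln_neq_same[OF d' that]) simp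
    then show ?thesis by (meson inj_onI)
  qed
  ultimately show ?thesis using finite_unity[OF n] by (simp add: card_image card_unity[OF n])
qed

lemma card_lines_of: "card (lines_of A) = 3 * n + 3"
proof -
  have "lines_of A = set_mset (A ! 0) \<union> set_mset (A ! 1) \<union> set_mset (A ! 2)"
    unfolding A_blocks by (auto simp: lines_of_def blocks_def)
  moreover have "set_mset (A ! 0) \<inter> set_mset (A ! 1) = {}"
    "(set_mset (A ! 0) \<union> set_mset (A ! 1)) \<inter> set_mset (A ! 2) = {}"
    using blocks_disjoint[of 0 1] blocks_disjoint[of 0 2] blocks_disjoint[of 1 2] by auto
  ultimately have "card (lines_of A) = card (set_mset (A ! 0)) + card (set_mset (A ! 1)) + card (set_mset (A ! 2))"
    by (simp add: card_Un_disjoint)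
  then show ?thesis unfolding A_blocks by (simp add: blocks_def card_set_block)
qed

lemma axis_in_hyp: "m \<noteq> 0 \<Longrightarrow> axis m 1 \<in> hyp (axis 0 1)"
  by (rule coord_0[THEN iffD2]) (simp add: axis_def)

lemma axis_tri:
  assumes "m \<noteq> 0"
  shows "tri n (axis m 1)" "tri_weight n (axis m 1) = n"
proof -
  obtain j k where d: "distinct [0, m, j, k]" using ex_other_two[of 0 m] assms by auto
  show "tri n (axis m 1)" unfolding tri_iff[OF d] using d by (auto simp: axis_def)
  have "(axis m 1 $ 0 :: complex) ^ n \<noteq> axis m 1 $ m ^ n" using assms n by (simp add: axis_def power_0_left)
  then have "\<not> (\<forall>i j. (axis m 1 $ i :: complex) ^ n = axis m 1 $ j ^ n)" by blast
  moreover have "\<exists>l. \<forall>i. i \<noteq> l \<longrightarrow> axis m 1 $ i = (0 :: complex)" by (rule exI[of _ m]) (simp add: axis_def)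
  ultimately show "tri_weight n (axis m 1) = n" by (auto simp: tri_weight_def)
qed

text \<open>No point with \<open>y_0 = 0\<close> has four equal powers, so the general upper bound
  involves only the vertices; the three vertices in the plane attain it.\<close>

lemma sum_base_mult: "(\<Sum>p\<in>base_locus W. int (base_mult A p) - 1) = 3 * (int n - 1)"
proof (rule antisym)
  have d4: "distinct [0, 1, 2, 3 :: 4]" by simp
  have c0: "common_points = {}"
  proof (rule ccontr)
    assume "common_points \<noteq> {}"
    then obtain y where y: "y \<in> hyp (axis 0 1)" "y \<noteq> 0" "all_eq n y" by (auto simp: common_points_def)
    then show False using all_eq_nonzero[OF n y(2,3)] coord_0 by blast
  qed
  have "coord_points \<subseteq> {1, 2, 3}"
  proof
    fix m assume "m \<in> coord_points"
    then have "m \<noteq> 0" by (auto simp: coord_points_def)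
    then show "m \<in> {1, 2, 3}" using cases4[OF d4, of m] by blast
  qed
  then have "card coord_points \<le> card {1, 2, 3 :: 4}" by (intro card_mono) auto
  then have "int (card coord_points) * (int n - 1) \<le> 3 * (int n - 1)" using n by (intro mult_right_mono) auto
  then show "(\<Sum>p\<in>base_locus W. int (base_mult A p) - 1) \<le> 3 * (int n - 1)"
    using sum_base_mult_le by (simp add: c0 gmult_def)
  let ?e = "\<lambda>m. ptH (axis m 1)"
  have inj: "inj_on ?e {1, 2, 3}"
  proof (rule inj_onI)
    fix l m :: 4 assume lm: "l \<in> {1, 2, 3}" "m \<in> {1, 2, 3}" "?e l = ?e m"
    then have "l \<noteq> 0" "m \<noteq> 0" by auto
    then obtain c where c: "axis m 1 = c *s (axis l 1 :: complex ^ 4)"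
      using ptH_eqD[of "axis l 1" "axis m 1"] lm(3) axis1_nonzero axis_in_hyp by blast
    have "(axis m 1 :: complex ^ 4) $ m = c * axis l 1 $ m" by (subst c) simp
    then show "l = m" by (auto simp: axis_def split: if_splits)
  qed
  have X: "?e m \<in> base_locus W" "base_mult A (?e m) = n" if "m \<noteq> 0" for m
    using base_locus_triI[OF axis_in_hyp[OF that] axis1_nonzero axis_tri(1)[OF that]] axis_tri(2)[OF that] by simp_all
  have "3 * (int n - 1) = (\<Sum>m\<in>{1, 2, 3 :: 4}. int (base_mult A (?e m)) - 1)" using X by simp
  also have "\<dots> = (\<Sum>p\<in>?e ` {1, 2, 3}. int (base_mult A p) - 1)"
    by (subst sum.reindex[OF inj]) simp
  also have "\<dots> \<le> (\<Sum>p\<in>base_locus W. int (base_mult A p) - 1)"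
    by (rule sum_mono2) (use X finite_base_locus base_mult_pos in force)+
  finally show "3 * (int n - 1) \<le> (\<Sum>p\<in>base_locus W. int (base_mult A p) - 1)" .
qed

text \<open>A root of unity can relate two coordinates only if both vanish or neither does, which
  leaves the pairs \<open>0, m\<close> and \<open>j, k\<close>.\<close>

lemma lines_through_one_zero:
  assumes d: "distinct [0, m, j, k]" and y: "y \<in> hyp (axis 0 1)" "y $ m = 0" "y $ j \<noteq> 0" "y $ k \<noteq> 0"
    and L: "L \<in> trace_lines" "ptH y \<subseteq> L"
  shows "L = ln 0 m 1 \<or> (\<exists>z\<in>unity n. y $ j = z * y $ k \<and> L = ln j k z)"
proof -
  obtain i i' w where i: "i \<noteq> i'" "w \<in> unity n" "L = ln i i' w" using L(1) by (auto simp: trace_lines_def)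
  then have e: "y $ i = w * y $ i'" using ptH_ln[OF y(1) i(1,2)] L(2) by simp
  have w: "w \<noteq> 0" using unity_nonzero[OF n i(2)] .
  have y0: "y $ 0 = 0" using y(1) coord_0 by blast
  have "{i, i'} = {0, m} \<or> {i, i'} = {j, k}"
    using cases4[OF d, of i] cases4[OF d, of i'] i(1) e w y y0 by auto
  then consider "i = 0" "i' = m" | "i = m" "i' = 0" | "i = j" "i' = k" | "i = k" "i' = j"
    by (auto simp: doubleton_eq_iff)
  then show ?thesis
  proof cases
    case 1 then show ?thesis using ln_0 d i by simp
  next
    case 2 then show ?thesis using ln_0_swap d i by simp
  next
    case 3 then show ?thesis using i e by blast
  next
    case 4
    have "y $ j = (1 / w) * y $ k" using e w 4 by simp
    moreover have "L = ln j k (1 / w)" using ln_swap[OF i(2), of k j] i 4 by simp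
    moreover have "1 / w \<in> unity n" by (rule unity_divide[OF one_in_unity i(2)])
    ultimately show ?thesis by blast
  qed
qed

text \<open>The points in which the line \<open>y_m = 0\<close> meets the lines
  \<open>y_j = z y_k\<close> of the same block.\<close>

definition special_points :: "4 \<Rightarrow> 4 \<Rightarrow> 4 \<Rightarrow> ppoint set" where
  "special_points m j k = (\<lambda>z. ptH (vec4 0 m j 0 0 z 1)) ` unity n"

lemma special_point:
  assumes d: "distinct [0, m, j, k]" and z: "z \<in> unity n"
  shows "vec4 0 m j 0 0 z 1 \<in> hyp (axis 0 1)" "vec4 0 m j 0 0 z 1 \<noteq> 0"
    "ptH (vec4 0 m j 0 0 z 1) \<in> other_points (base_locus W) A"
    "num_lines_through A (ptH (vec4 0 m j 0 0 z 1)) = 2"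
proof -
  let ?y = "vec4 0 m j 0 0 z 1"
  have v: "?y $ 0 = 0" "?y $ m = 0" "?y $ j = z" "?y $ k = 1" using vec4_nth[OF d] by simp_all
  have z0: "z \<noteq> 0" using unity_nonzero[OF n z] .
  show y: "?y \<in> hyp (axis 0 1)" using v coord_0 by blast
  show y0: "?y \<noteq> 0" using v(4) by auto
  have nt: "\<not> tri n ?y" unfolding tri_iff[OF d] v using z0 n by (simp add: power_0_left)
  have 1: "ln 0 m 1 \<in> trace_lines" "ptH ?y \<subseteq> ln 0 m 1"
    using trace_linesI[of 0 m 1] ptH_ln[OF y, of 0 m 1] d one_in_unity v by auto
  have 2: "ln j k z \<in> trace_lines" "ptH ?y \<subseteq> ln j k z"
    using trace_linesI[of j k z] ptH_ln[OF y, of j k z] d z v by auto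
  show op: "ptH ?y \<in> other_points (base_locus W) A"
    using other_pointsI[OF y y0 nt 1(1) 2(1) ln_0_neq[OF d z] 1(2) 2(2)] .
  have "{L \<in> lines_of A. ptH ?y \<subseteq> L} \<subseteq> {ln 0 m 1, ln j k z}"
  proof
    fix L assume "L \<in> {L \<in> lines_of A. ptH ?y \<subseteq> L}"
    then have "L \<in> trace_lines" "ptH ?y \<subseteq> L" using lines_of_trace_lines by auto
    then have "L = ln 0 m 1 \<or> (\<exists>w\<in>unity n. ?y $ j = w * ?y $ k \<and> L = ln j k w)"
      by (intro lines_through_one_zero[OF d y]) (simp_all add: v z0)
    then show "L \<in> {ln 0 m 1, ln j k z}" using v by auto
  qed
  then have "num_lines_through A (ptH ?y) \<le> card {ln 0 m 1, ln j k z}"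
    unfolding num_lines_through_def by (rule card_mono[rotated]) simp
  also have "\<dots> \<le> 2" by (simp add: card_insert_if)
  finally show "num_lines_through A (ptH ?y) = 2" using num_lines_ge_2[OF op] by simp
qed

lemma card_special_points:
  assumes d: "distinct [0, m, j, k]"
  shows "card (special_points m j k) = n"
proof -
  have "inj_on (\<lambda>z. ptH (vec4 0 m j 0 0 z 1)) (unity n)"
  proof (rule inj_onI)
    fix z w assume zw: "z \<in> unity n" "w \<in> unity n" "ptH (vec4 0 m j 0 0 z 1) = ptH (vec4 0 m j 0 0 w 1)"
    then obtain c where c: "vec4 0 m j 0 0 w 1 = c *s vec4 0 m j 0 0 z 1"
      using ptH_eqD special_point(1,2)[OF d] by blast
    have s: "vec4 0 m j 0 0 w 1 $ r = c * vec4 0 m j 0 0 z 1 $ r" for r unfolding c by simp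
    show "z = w" using s[of j] s[of k] by (simp add: vec4_nth[OF d])
  qed
  then show ?thesis by (simp add: special_points_def card_image card_unity[OF n])
qed

lemma special_points_disjoint:
  assumes d: "distinct [0, m, j, k]" and d': "distinct [0, m', j', k']" and m: "m \<noteq> m'"
  shows "special_points m j k \<inter> special_points m' j' k' = {}"
proof (rule ccontr)
  assume "\<not> ?thesis"
  then obtain z w where zw: "z \<in> unity n" "w \<in> unity n" "ptH (vec4 0 m j 0 0 z 1) = ptH (vec4 0 m' j' 0 0 w 1)"
    by (auto simp: special_points_def)
  then obtain c where c: "c \<noteq> 0" "vec4 0 m' j' 0 0 w 1 = c *s vec4 0 m j 0 0 z 1"
    using ptH_eqD special_point(1,2)[OF d] special_point(1)[OF d'] by blast
  have "vec4 0 m' j' 0 0 w 1 $ m = 0" unfolding c(2) using vec4_nth(2)[OF d] by simp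
  moreover have "vec4 0 m' j' 0 0 w 1 $ m \<noteq> 0"
    using cases4[OF d', of m] d m vec4_nth[OF d'] unity_nonzero[OF n zw(2)] by auto
  ultimately show False by simp
qed

lemma special_pointI:
  assumes d: "distinct [0, m, j, k]" and y: "y \<in> hyp (axis 0 1)" "y \<noteq> 0" "\<not> tri n y" "y $ m = 0"
    and L: "L \<in> trace_lines" "L' \<in> trace_lines" "L \<noteq> L'" "ptH y \<subseteq> L" "ptH y \<subseteq> L'"
  shows "ptH y \<in> special_points m j k"
proof -
  have y0: "y $ 0 = 0" using y(1) coord_0 by blast
  have nz: "y $ j \<noteq> 0" "y $ k \<noteq> 0" using y(3,4) y0 unfolding tri_iff[OF d] by auto
  obtain z where z: "z \<in> unity n" "y $ j = z * y $ k"
    using lines_through_one_zero[OF d y(1,4) nz L(1,4)] lines_through_one_zero[OF d y(1,4) nz L(2,5)] L(3) by blast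
  have "vec4 0 m j 0 0 z 1 = (1 / y $ k) *s y"
    unfolding vec_eq_iff all4[OF d] vec4_nth[OF d] using y0 y(4) z nz by simp
  then have "ptH (vec4 0 m j 0 0 z 1) = ptH y" using ptH_scale[OF y(1,2), of "1 / y $ k"] nz by simp
  then show ?thesis unfolding special_points_def using z(1) by (metis image_eqI)
qed

text \<open>Each pair of coordinates determines at most one line through the point, so two different
  lines use two of the three pairs and force three equal powers. Intersection points off the base
  therefore have a second zero coordinate.\<close>

lemma lines_through_no_zero:
  assumes y: "y \<in> hyp (axis 0 1)" "y $ 1 \<noteq> 0" "y $ 2 \<noteq> 0" "y $ 3 \<noteq> 0" and L: "L \<in> trace_lines" "ptH y \<subseteq> L"
  shows "\<exists>(j, k)\<in>{(1, 2), (1, 3), (2, 3)}. y $ j ^ n = y $ k ^ n \<and> L = ln j k (y $ j / y $ k)"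
proof -
  have d: "distinct [0, 1, 2, 3 :: 4]" by simp
  obtain i i' w where i: "i \<noteq> i'" "w \<in> unity n" "L = ln i i' w" using L(1) by (auto simp: trace_lines_def)
  then have e: "y $ i = w * y $ i'" using ptH_ln[OF y(1) i(1,2)] L(2) by simp
  have w: "w \<noteq> 0" using unity_nonzero[OF n i(2)] .
  have y0: "y $ 0 = 0" using y(1) coord_0 by blast
  have i0: "i \<noteq> 0" "i' \<noteq> 0" using cases4[OF d, of i] cases4[OF d, of i'] i(1) e w y y0 by auto
  have nz: "y $ m \<noteq> 0" if "m \<noteq> 0" for m using cases4[OF d, of m] that y by auto
  have p: "y $ i ^ n = y $ i' ^ n" unfolding e using i(2) by (simp add: power_mult_distrib unity_def)
  have 1: "L = ln i i' (y $ i / y $ i')" using e i(3) nz[OF i0(2)] by simp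
  have 2: "L = ln i' i (y $ i' / y $ i)"
    using ln_swap[OF i(2), of i i'] i(3) e nz[OF i0(1)] nz[OF i0(2)] w by simp
  have "(i, i') \<in> {(1, 2), (1, 3), (2, 3)} \<or> (i', i) \<in> {(1, 2), (1, 3), (2, 3)}"
    using cases4[OF d, of i] cases4[OF d, of i'] i(1) i0 by auto
  moreover have "case (i, i') of (j, k) \<Rightarrow> y $ j ^ n = y $ k ^ n \<and> L = ln j k (y $ j / y $ k)" using p 1 by simp
  moreover have "case (i', i) of (j, k) \<Rightarrow> y $ j ^ n = y $ k ^ n \<and> L = ln j k (y $ j / y $ k)" using p 2 by simp
  ultimately show ?thesis by blast
qed

lemma other_points_eq:
  "other_points (base_locus W) A = special_points 1 2 3 \<union> special_points 2 1 3 \<union> special_points 3 1 2"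
proof
  show "special_points 1 2 3 \<union> special_points 2 1 3 \<union> special_points 3 1 2 \<subseteq> other_points (base_locus W) A"
    using special_point(3)[of 1 2 3] special_point(3)[of 2 1 3] special_point(3)[of 3 1 2]
    by (auto simp: special_points_def)
  show "other_points (base_locus W) A \<subseteq> special_points 1 2 3 \<union> special_points 2 1 3 \<union> special_points 3 1 2"
  proof
    fix p assume p: "p \<in> other_points (base_locus W) A"
    then obtain L L' where L: "L \<in> lines_of A" "L' \<in> lines_of A" "L \<noteq> L'" "p = L \<inter> L'" and pX: "p \<notin> base_locus W"
      by (auto simp: other_points_def)
    have tl: "L \<in> trace_lines" "L' \<in> trace_lines" using L lines_of_trace_lines by auto
    have "is_point p" unfolding L(4) by (rule lines_meet_point) (use tl trace_line_is_line L(3) in auto)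
    then obtain y where y: "y \<in> hyp (axis 0 1)" "y \<noteq> 0" "p = ptH y" by (rule is_point_ptHE)
    have nt: "\<not> tri n y" using base_locus_triI(1) y pX by blast
    have pL: "ptH y \<subseteq> L" "ptH y \<subseteq> L'" using L(4) y(3) by auto
    have sp: "p \<in> special_points m j k" if "distinct [0, m, j, k]" "y $ m = 0" for m j k
      using special_pointI[OF that(1) y(1,2) nt that(2) tl L(3) pL] y(3) by simp
    show "p \<in> special_points 1 2 3 \<union> special_points 2 1 3 \<union> special_points 3 1 2"
    proof (cases "y $ 1 = 0 \<or> y $ 2 = 0 \<or> y $ 3 = 0")
      case True
      then show ?thesis using sp[of 1 2 3] sp[of 2 1 3] sp[of 3 1 2] by auto
    next
      case False
      then have nz: "y $ 1 \<noteq> 0" "y $ 2 \<noteq> 0" "y $ 3 \<noteq> 0" by auto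
      have d: "distinct [0, 1, 2, 3 :: 4]" by simp
      have "\<not> (y $ 1 ^ n = y $ 2 ^ n \<and> y $ 2 ^ n = y $ 3 ^ n)" using nt unfolding tri_iff[OF d] by blast
      then have False
        using lines_through_no_zero[OF y(1) nz tl(1) pL(1)] lines_through_no_zero[OF y(1) nz tl(2) pL(2)] L(3) by auto
      then show ?thesis ..
    qed
  qed
qed

lemma sum_other_points: "(\<Sum>p\<in>other_points (base_locus W) A. int (num_lines_through A p) - 1) = 3 * int n"
proof -
  have "(\<Sum>p\<in>other_points (base_locus W) A. int (num_lines_through A p) - 1) = (\<Sum>p\<in>other_points (base_locus W) A. 1)"
  proof (rule sum.cong[OF refl])
    fix p assume "p \<in> other_points (base_locus W) A"
    then have "num_lines_through A p = 2"
      unfolding other_points_eq special_points_def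
      using special_point(4)[of 1 2 3] special_point(4)[of 2 1 3] special_point(4)[of 3 1 2] by auto
    then show "int (num_lines_through A p) - 1 = 1" by simp
  qed
  moreover have "card (other_points (base_locus W) A) = 3 * n"
  proof -
    have f: "finite (special_points m j k)" for m j k by (simp add: special_points_def finite_unity[OF n])
    have "special_points 1 2 3 \<inter> special_points 2 1 3 = {}" "special_points 1 2 3 \<inter> special_points 3 1 2 = {}"
      "special_points 2 1 3 \<inter> special_points 3 1 2 = {}"
      by (rule special_points_disjoint; simp)+
    then have "card (special_points 1 2 3 \<union> special_points 2 1 3 \<union> special_points 3 1 2)
      = card (special_points 1 2 3) + card (special_points 2 1 3) + card (special_points 3 1 2)"
      by (simp add: card_Un_disjoint f Int_Un_distrib2)
    then show ?thesis unfolding other_points_eq by (simp add: card_special_points)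
  qed
  ultimately show ?thesis by simp
qed

lemma complete_eq:
  "3 + int (card (base_locus W)) =
          (2 - int 3) * (3 * int d - (int d)\<^sup>2
             + (\<Sum>p\<in>base_locus W. (int (base_mult A p))\<^sup>2 - int (base_mult A p)))
          + 2 * int (card (lines_of A))
          - (\<Sum>p\<in>other_points (base_locus W) A. int (num_lines_through A p) - 1)"
  unfolding complete_iff[OF refl thr_base_eq, simplified]
  using sum_other_points card_lines_of sum_base_mult degree_of_G_empty[OF refl] complete_iff[OF refl thr_base_eq] by simp

text \<open>For \<open>n = 1\<close> the weight 2 would require four equal coordinates, impossible
  with \<open>y_0 = 0\<close>. All multiplicities are 1, and the sum of their squares counts the
  points.\<close>

lemma card_base_locus_1: "n = 1 \<Longrightarrow> card (base_locus W) = d\<^sup>2"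
proof -
  assume n1: "n = 1"
  have "size {#l \<in># A ! b. p \<subseteq> l#} = 1" if p: "p \<in> base_locus W" and b: "b < 3" for p b
  proof -
    have "is_point p" using p by (auto simp: base_locus_def)
    then obtain y where y: "y \<in> hyp (axis 0 1)" "y \<noteq> 0" "p = ptH y" by (rule is_point_ptHE)
    have "tri n y" using base_locus_tri y p by blast
    moreover have "tri_weight n y = 1"
    proof -
      have "\<not> (\<forall>i j. y $ i = y $ j)" using y coord_0 by (metis vec_eq_iff zero_index)
      then show ?thesis by (simp add: tri_weight_def n1)
    qed
    ultimately show ?thesis using thr_base[OF y(1,2) _ b] y(3) by simp
  qed
  then show ?thesis using bezout by simp
qed

end

section \<open>Realization of G(n,1,3) on the plane \<open>y_0 = 0\<close>\<close>

definition coordinate_param :: "complex ^ 3 ^ 4" where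
  "coordinate_param = (\<chi> i. if i = 1 then axis 1 1 else if i = 2 then axis 2 1 else if i = 3 then axis 3 1 else 0)"

lemma coordinate_param_nth:
  "(coordinate_param *v x) $ 0 = 0" "(coordinate_param *v x) $ 1 = x $ 1"
  "(coordinate_param *v x) $ 2 = x $ 2" "(coordinate_param *v x) $ 3 = x $ 3"
proof -
  have e: "(coordinate_param *v x) $ i = dot (coordinate_param $ i) x" for i
    by (simp add: matrix_vector_mult_def dot_def)
  show "(coordinate_param *v x) $ 0 = 0" "(coordinate_param *v x) $ 1 = x $ 1"
    "(coordinate_param *v x) $ 2 = x $ 2" "(coordinate_param *v x) $ 3 = x $ 3"
    unfolding e by (simp_all add: coordinate_param_def dot_axis_left)
qed

lemma inj_coordinate_param: "inj ((*v) coordinate_param)"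
proof (rule injI)
  fix x y assume "coordinate_param *v x = coordinate_param *v y"
  then have "(coordinate_param *v x) $ i = (coordinate_param *v y) $ i" for i by simp
  from this[of 1] this[of 2] this[of 3] show "x = y"
    by (simp add: coordinate_param_nth vec_eq_iff forall_3)
qed

lemma range_coordinate_param: "range ((*v) coordinate_param) = hyp (axis 0 1)"
proof
  show "range ((*v) coordinate_param) \<subseteq> hyp (axis 0 1)"
    by (auto simp: hyp_def dot_axis_left coordinate_param_nth)
  show "hyp (axis 0 1) \<subseteq> range ((*v) coordinate_param)"
  proof
    fix y :: "complex ^ 4" assume "y \<in> hyp (axis 0 1)"
    then have y0: "y $ 0 = 0" by (simp add: hyp_def dot_axis_left)
    have d4: "distinct [0, 1, 2, 3 :: 4]" by simp
    have "y = coordinate_param *v vector [y $ 1, y $ 2, y $ 3]"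
      unfolding vec_eq_iff all4[OF d4] by (simp add: coordinate_param_nth vector_3 y0)
    then show "y \<in> range ((*v) coordinate_param)" by blast
  qed
qed

lemma Q_trace_coordinate:
  assumes n: "n \<ge> 1"
  shows "Q_trace n coordinate_param (axis 0 1)"
proof
  show "n \<ge> 1" by (rule n)
  show "axis 0 (1 :: complex) \<noteq> (0 :: complex ^ 4)" by (metis axis_nth zero_index zero_neq_one)
  show "inj ((*v) coordinate_param)" by (rule inj_coordinate_param)
  show "range ((*v) coordinate_param) = hyp (axis 0 1)" by (rule range_coordinate_param)
  fix i j :: 4 and z assume ij: "i \<noteq> j" and z: "z \<in> unity n"
  have h: "axis m 1 \<in> hyp (axis 0 1)" if "m \<noteq> 0" for m :: 4
    unfolding hyp_def mem_Collect_eq dot_axis_left using that by (simp add: axis_def)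
  show "\<exists>y\<in>hyp (axis 0 1). y $ i \<noteq> z * y $ j"
  proof (cases "i = 0")
    case True
    then have "axis j 1 $ i \<noteq> z * axis j 1 $ j" using ij unity_nonzero[OF n z] by (simp add: axis_def)
    then show ?thesis using h[of j] ij True by blast
  next
    case False
    have "axis i 1 $ i \<noteq> z * axis i 1 $ j" using ij by (simp add: axis_def)
    then show ?thesis using h[OF False] by blast
  qed
qed

lemma blocks_coordinate:
  assumes n: "n \<ge> 1"
  shows "Q_trace.blocks n coordinate_param = G_multinet n"
proof -
  interpret Q_trace n coordinate_param "axis 0 1" by (rule Q_trace_coordinate[OF n])
  have inj: "inj ((*v) (mat 1 :: complex ^ 3 ^ 3))" by (simp add: inj_def)
  have b: "blk i j k l = coord_block n p q r"
    if "\<And>x z. z \<in> unity n \<Longrightarrow> x \<in> ln i j z \<longleftrightarrow> x $ p = 0"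
      "\<And>x z. z \<in> unity n \<Longrightarrow> x \<in> ln k l z \<longleftrightarrow> x $ q = z * x $ r" for i j k l p q r
    using image_blk_coord[OF inj, of i j p k l q r] that by simp
  have "blk 0 1 2 3 = coord_block n 1 2 3" "blk 0 2 1 3 = coord_block n 2 1 3" "blk 0 3 1 2 = coord_block n 3 1 2"
    by (rule b; use unity_nonzero[OF n] in \<open>auto simp: mem_ln coordinate_param_nth\<close>)+
  then show ?thesis by (simp add: blocks_def G_multinet_eq[OF n])
qed

lemma coordinate_trace_G_multinet:
  assumes n: "n \<ge> 1"
  shows "coordinate_trace n coordinate_param (G_pencil n) (2 * n) (G_multinet n)"
proof -
  interpret Q_trace n coordinate_param "axis 0 1" by (rule Q_trace_coordinate[OF n])
  show ?thesis
    by unfold_locales (use multinet_G_multinet[OF n] blocks_coordinate[OF n] in simp_all)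
qed

lemma complete_G_multinet:
  assumes n: "n \<ge> 1"
  shows "complete_multinet 3 (2 * n) (G_multinet n)"
  unfolding complete_multinet_def
  using n multinet_G_multinet[OF n] coordinate_trace.complete_eq[OF coordinate_trace_G_multinet[OF n]] by auto

lemma hyp_axis_not_plane:
  assumes n: "n \<ge> 1"
  shows "hyp (axis 0 1) \<notin> Q_planes n"
proof
  assume "hyp (axis 0 1) \<in> Q_planes n"
  then obtain \<alpha> where \<alpha>: "zero_set \<alpha> = hyp (axis 0 1)" "\<alpha> dvd prod_list (Q_blocks n)" by (auto simp: Q_planes_def)
  have d: "distinct [0, 1, 2, 3 :: 4]" by simp
  \<comment> \<open>A point of the plane whose coordinates have pairwise different n-th powers
    \<open>0, 1, 2^n, 4^n\<close>, so that no plane of the arrangement contains it.\<close>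
  let ?y = "vec4 0 1 2 0 1 2 4"
  have v: "?y $ 0 = 0" "?y $ 1 = 1" "?y $ 2 = 2" "?y $ 3 = 4" using vec4_nth[OF d] by simp_all
  have "?y \<in> zero_set \<alpha>" unfolding \<alpha>(1) using v by (simp add: hyp_def dot_axis_left)
  then have "eval_poly (prod_list (Q_blocks n)) ?y = 0"
    using \<alpha>(2) by (auto simp: dvd_def zero_set_def)
  moreover have "(4 :: complex) ^ n = 2 ^ n * 2 ^ n" by (simp flip: power_mult_distrib)
  moreover have "(4 :: complex) ^ n \<noteq> 1"
    using two_not_unity[of "2 * n"] n by (simp add: power_mult)
  ultimately show False
    using two_not_unity[OF n] n by (simp add: Q_blocks_def v power_0_left)
qed

text \<open>The blocks of the trace share no line, so their greatest common divisor is 1 and the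
  trace is itself the induced multinet.\<close>

lemma induced_G_multinet:
  assumes n: "n \<ge> 1"
  shows "induced_from_Q n (G_multinet n)"
proof -
  let ?P = coordinate_param
  let ?R = "map (restrict_along ?P) (Q_blocks n)"
  interpret Q_trace n ?P "axis 0 1" by (rule Q_trace_coordinate[OF n])
  have lenR: "length ?R = 3" "length (G_multinet n) = 3" "length (Q_blocks n) = 3"
    by (simp_all add: Q_blocks_def G_multinet_def)
  have split: "splits_into (?R ! b) (G_multinet n ! b)" if "b < 3" for b
    using splits_restrict_along[OF that] that lenR blocks_coordinate[OF n] by simp
  have "is_gcd3 1 ?R"
    unfolding is_gcd3_def
  proof (intro conjI allI impI ballI)
    fix h assume h: "\<forall>f\<in>set ?R. h dvd f"
    have "?R ! 0 \<in> set ?R" "?R ! 1 \<in> set ?R" using lenR(1) by (metis nth_mem zero_less_numeral, metis nth_mem one_less_numeral_iff semiring_norm(77))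
    then have "h dvd ?R ! 0" "h dvd ?R ! 1" using h by blast+
    moreover have "splits_into (?R ! 0) (G_multinet n ! 0)" "splits_into (?R ! 1) (G_multinet n ! 1)"
      by (rule split, simp)+
    moreover have "set_mset (G_multinet n ! 0) \<inter> set_mset (G_multinet n ! 1) = {}"
      by (rule G_blocks_disjoint[OF n]) simp_all
    ultimately show "h dvd 1" using coprime_splits by blast
  qed simp
  moreover have "?R = map (\<lambda>r. 1 * r) ?R" by simp
  moreover have "list_all2 splits_into ?R (G_multinet n)"
    by (rule list_all2_all_nthI) (use lenR split in auto)
  ultimately have ex: "\<exists>g R. is_gcd3 g ?R \<and> ?R = map (\<lambda>r. g * r) R \<and> list_all2 splits_into R (G_multinet n)" by blast
  have "vec.dim (range ((*v) ?P)) = vec.dim (UNIV :: (complex ^ 3) set)"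
    using inj_coordinate_param by (intro vec.dim_image_eq) (auto intro: inj_on_subset)
  also have "\<dots> = 3" by (subst vec_dim_card) simp
  finally have dim: "vec.dim (hyp (axis 0 (1 :: complex) :: complex ^ 4)) = 3" unfolding range_coordinate_param .
  have sub: "vec.subspace (hyp (axis 0 (1 :: complex) :: complex ^ 4))"
    by (simp add: vec.subspace_def hyp_def dot_add_right)
  have "induced_by n (hyp (axis 0 1)) (G_multinet n)"
    unfolding induced_by_def
    using dim sub hyp_axis_not_plane[OF n] inj_coordinate_param range_coordinate_param ex by blast
  then show ?thesis unfolding induced_from_Q_def by blast
qed

lemma proj_equiv_refl: "proj_equiv A A"
proof -
  have "invertible (mat 1 :: complex ^ 3 ^ 3)" by (auto simp: invertible_def)
  moreover have "mset (map (image_mset (\<lambda>l. (\<lambda>v. (mat 1 :: complex ^ 3 ^ 3) *v v) ` l)) A) = mset A" by simp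
  ultimately show ?thesis unfolding proj_equiv_def by blast
qed

lemma is_net_A3: "is_net 3 2 A3_net"
proof -
  have "coordinate_trace 1 coordinate_param (G_pencil 1) 2 A3_net"
    using coordinate_trace_G_multinet[of 1] by (simp add: A3_net_eq)
  then interpret coordinate_trace 1 coordinate_param "G_pencil 1" 2 A3_net .
  show ?thesis unfolding is_net_def using multinet card_base_locus_1 by blast
qed

theorem theorem4p8:
  shows "(\<forall>n\<ge>1. \<forall>k d A. induced_from_Q n A \<and> complete_multinet k d A \<longrightarrow>
            (k = 3 \<and> d = 2 \<and> proj_equiv A A3_net) \<or>
            (k = 3 \<and> d = 2 * n \<and> proj_equiv A (G_multinet n))) \<and>
         (is_net 3 2 A3_net \<and> complete_multinet 3 2 A3_net \<and>
            (\<exists>m\<ge>1. \<exists>A. induced_from_Q m A \<and> proj_equiv A A3_net)) \<and>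
         (\<forall>n\<ge>1. complete_multinet 3 (2 * n) (G_multinet n) \<and>
            (\<exists>m\<ge>1. \<exists>A. induced_from_Q m A \<and> proj_equiv A (G_multinet n)))"
proof (intro conjI allI impI)
  fix n :: nat and k d A assume "1 \<le> n" "induced_from_Q n A \<and> complete_multinet k d A"
  then show "(k = 3 \<and> d = 2 \<and> proj_equiv A A3_net) \<or> (k = 3 \<and> d = 2 * n \<and> proj_equiv A (G_multinet n))"
    using complete_induced_from_Q by blast
next
  show "is_net 3 2 A3_net" by (rule is_net_A3)
  show "complete_multinet 3 2 A3_net" using complete_G_multinet[of 1] by (simp add: A3_net_eq)
  show "\<exists>m\<ge>1. \<exists>A. induced_from_Q m A \<and> proj_equiv A A3_net"
    using induced_G_multinet[of 1] proj_equiv_refl unfolding A3_net_eq by blast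
next
  fix n :: nat assume "1 \<le> n"
  then show "complete_multinet 3 (2 * n) (G_multinet n)"
    "\<exists>m\<ge>1. \<exists>A. induced_from_Q m A \<and> proj_equiv A (G_multinet n)"
    using complete_G_multinet induced_G_multinet proj_equiv_refl by blast+
qed


end
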